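(* Let $N\ge1$, $\omega\in\mathbb{R}$, and let $v\in H$ be any positive solution of $$-\Delta v+(|x|^2-\omega)\frac{f(v)}{\sqrt{1+2f^2(v)}}+\frac{f(v)^3}{\sqrt{1+2f^2(v)}}=0\quad\text{in }\mathbb{R}^N.$$ Then $$v(x)\sim|x|^{\frac{\omega-N}{2}}e^{-\frac{|x|^2}{2}}\quad\text{as }|x|\to\infty,$$ that is, there exist $C_1,C_2>0$ such that $$C_1|x|^{\frac{\omega-N}{2}}e^{-\frac{|x|^2}{2}}\le v(x)\le C_2|x|^{\frac{\omega-N}{2}}e^{-\frac{|x|^2}{2}}\quad\text{for large }|x|.$$ Consequently, if $u$ is a positive solution of $$-\Delta u-u\,\Delta u^2+|x|^2u+u^3=\omega u\quad\text{in }\mathbb{R}^N,$$ then $u(x)\sim|x|^{\frac{\omega-N}{2}}e^{-\frac{|x|^2}{2}}$ as $|x|\to\infty$ (in the same two-sided sense).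
   Context: $f:\mathbb{R}\to\mathbb{R}$ is the odd function with $f(0)=0$ and $f'(t)=\frac{1}{\sqrt{1+2f^2(t)}}$ for $t>0$. $H=\{u\in H^1(\mathbb{R}^N):\int_{\mathbb{R}^N}|u|^2|x|^2\,dx<\infty\}$ with $\|u\|_H^2=\int_{\mathbb{R}^N}(|\nabla u|^2+|u|^2|x|^2)\,dx$. Solutions $v\in H$ of the first equation are weak solutions, i.e. critical points on $H$ of $\frac12\int|\nabla v|^2+\frac12\int(|x|^2-\omega)f(v)^2+\frac14\int f(v)^4$ (integrals over $\mathbb{R}^N$). Solutions $u$ of the second (quasilinear) equation are understood through the substitution $u=f(v)$, i.e. $v=f^{-1}(u)\in H$ solves the first equation. Positive means $>0$ in $\mathbb{R}^N$. *)

theory Defs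
  imports "HOL-Analysis.Analysis"
begin

text \<open>
  The space \<open>\<real>\<^sup>N\<close> is an arbitrary Euclidean space \<open>'a\<close> with \<open>N = DIM('a)\<close>.  Elements of Sobolev
  spaces are represented by functions \<open>'a \<Rightarrow> real\<close>; two functions that agree almost everywhere
  represent the same element.
\<close>

section \<open>The change of variables\<close>

text \<open>
  The differential equation is imposed on \<open>t > 0\<close> with initial value \<open>f 0 = 0\<close>.  Continuity at \<open>0\<close> is
  what makes \<open>f 0 = 0\<close> an initial condition for it; without this clause, \<open>f\<close> would not be unique.
\<close>

definition dual_change :: "(real \<Rightarrow> real) \<Rightarrow> bool" where
  "dual_change f \<longleftrightarrow>
     f 0 = 0 \<and> isCont f 0 \<and> (\<forall>t. f (- t) = - f t) \<and>
     (\<forall>t>0. (f has_real_derivative 1 / sqrt (1 + 2 * (f t)\<^sup>2)) (at t))"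

section \<open>Weak gradients and the space H\<close>

primrec C_k :: "nat \<Rightarrow> ('a::euclidean_space \<Rightarrow> real) \<Rightarrow> bool" where
  "C_k 0 \<phi> \<longleftrightarrow> continuous_on UNIV \<phi>"
| "C_k (Suc k) \<phi> \<longleftrightarrow>
     \<phi> differentiable_on UNIV \<and> (\<forall>b\<in>Basis. C_k k (\<lambda>x. frechet_derivative \<phi> (at x) b))"

definition test_function :: "('a::euclidean_space \<Rightarrow> real) \<Rightarrow> bool" where
  "test_function \<phi> \<longleftrightarrow> (\<forall>k. C_k k \<phi>) \<and> compact (closure {x. \<phi> x \<noteq> 0})"

definition locally_integrable :: "('a::euclidean_space \<Rightarrow> 'b::euclidean_space) \<Rightarrow> bool" where
  "locally_integrable g \<longleftrightarrow>
     g \<in> borel_measurable lebesgue \<and> (\<forall>K. compact K \<longrightarrow> set_integrable lebesgue K g)"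

definition has_weak_gradient ::
    "('a::euclidean_space \<Rightarrow> real) \<Rightarrow> ('a \<Rightarrow> 'a) \<Rightarrow> bool" where
  "has_weak_gradient u G \<longleftrightarrow>
     locally_integrable u \<and> locally_integrable G \<and>
     (\<forall>\<phi>. test_function \<phi> \<longrightarrow> (\<forall>b\<in>Basis.
        (LINT x|lebesgue. u x * frechet_derivative \<phi> (at x) b)
          = - (LINT x|lebesgue. (G x \<bullet> b) * \<phi> x)))"

text \<open>Weak gradients are unique up to null sets, so integrals do not depend on the choice.\<close>

definition weak_gradient :: "('a::euclidean_space \<Rightarrow> real) \<Rightarrow> 'a \<Rightarrow> 'a" where
  "weak_gradient u = (SOME G. has_weak_gradient u G)"

definition square_integrable :: "('a::euclidean_space \<Rightarrow> 'b::euclidean_space) \<Rightarrow> bool" where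
  "square_integrable g \<longleftrightarrow>
     g \<in> borel_measurable lebesgue \<and> integrable lebesgue (\<lambda>x. (norm (g x))\<^sup>2)"

definition H1 :: "('a::euclidean_space \<Rightarrow> real) set" where
  "H1 = {u. square_integrable u \<and> (\<exists>G. has_weak_gradient u G \<and> square_integrable G)}"

definition H :: "('a::euclidean_space \<Rightarrow> real) set" where
  "H = {u \<in> H1. integrable lebesgue (\<lambda>x. (u x)\<^sup>2 * (norm x)\<^sup>2)}"

definition norm_H :: "('a::euclidean_space \<Rightarrow> real) \<Rightarrow> real" where
  "norm_H u =
     sqrt (LINT x|lebesgue. (norm (weak_gradient u x))\<^sup>2 + (u x)\<^sup>2 * (norm x)\<^sup>2)"

section \<open>Solutions\<close>

definition energy ::
    "(real \<Rightarrow> real) \<Rightarrow> real \<Rightarrow> ('a::euclidean_space \<Rightarrow> real) \<Rightarrow> real" where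
  "energy f \<omega> v =
     1/2 * (LINT x|lebesgue. (norm (weak_gradient v x))\<^sup>2)
   + 1/2 * (LINT x|lebesgue. ((norm x)\<^sup>2 - \<omega>) * (f (v x))\<^sup>2)
   + 1/4 * (LINT x|lebesgue. (f (v x)) ^ 4)"

text \<open>Vanishing of the Frechet derivative at \<open>v\<close> of a functional on \<open>H\<close> normed by \<open>norm_H\<close>.\<close>

definition critical_point_H ::
    "(('a::euclidean_space \<Rightarrow> real) \<Rightarrow> real) \<Rightarrow> ('a \<Rightarrow> real) \<Rightarrow> bool" where
  "critical_point_H J v \<longleftrightarrow>
     v \<in> H \<and>
     (\<forall>\<epsilon>>0. \<exists>\<delta>>0. \<forall>\<phi>\<in>H. norm_H \<phi> < \<delta> \<longrightarrow>
        \<bar>J (\<lambda>x. v x + \<phi> x) - J v\<bar> \<le> \<epsilon> * norm_H \<phi>)"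

text \<open>
  Weak solutions in \<open>H\<close> of
  \<open>- \<Delta>v + (|x|\<^sup>2 - \<omega>) f(v) / sqrt (1 + 2 f(v)\<^sup>2) + f(v)\<^sup>3 / sqrt (1 + 2 f(v)\<^sup>2) = 0\<close>,
  the Euler-Lagrange equation of \<open>energy f \<omega>\<close> because \<open>f' = 1 / sqrt (1 + 2 f\<^sup>2)\<close>.
\<close>

definition solves_semilinear ::
    "(real \<Rightarrow> real) \<Rightarrow> real \<Rightarrow> ('a::euclidean_space \<Rightarrow> real) \<Rightarrow> bool" where
  "solves_semilinear f \<omega> v \<longleftrightarrow> critical_point_H (energy f \<omega>) v"

text \<open>
  Solutions of \<open>- \<Delta>u - u \<Delta>(u\<^sup>2) + |x|\<^sup>2 u + u\<^sup>3 = \<omega> u\<close>, understood through the substitution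
  \<open>u = f(v)\<close>; since \<open>f\<close> is a bijection of the real line, \<open>v\<close> is \<open>f\<^sup>-\<^sup>1(u)\<close>.
\<close>

definition solves_quasilinear ::
    "(real \<Rightarrow> real) \<Rightarrow> real \<Rightarrow> ('a::euclidean_space \<Rightarrow> real) \<Rightarrow> bool" where
  "solves_quasilinear f \<omega> u \<longleftrightarrow> (\<exists>v. (\<forall>x. u x = f (v x)) \<and> solves_semilinear f \<omega> v)"

definition ae_positive :: "('a::euclidean_space \<Rightarrow> real) \<Rightarrow> bool" where
  "ae_positive v \<longleftrightarrow> (AE x in lebesgue. 0 < v x)"

section \<open>Two-sided asymptotics\<close>

text \<open>
  \<open>C1 w(x) \<le> v(x) \<le> C2 w(x)\<close> for large \<open>|x|\<close>.  For an arbitrary representative of a Sobolev class this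
  is meaningful only almost everywhere; where the representative is continuous (everywhere, for
  the continuous representative) it is required pointwise.
\<close>

definition asymp_two_sided ::
    "('a::euclidean_space \<Rightarrow> real) \<Rightarrow> ('a \<Rightarrow> real) \<Rightarrow> bool" where
  "asymp_two_sided v w \<longleftrightarrow>
     (\<exists>C1>0. \<exists>C2>0. \<exists>R.
        (AE x in lebesgue. R \<le> norm x \<longrightarrow> C1 * w x \<le> v x \<and> v x \<le> C2 * w x) \<and>
        (\<forall>x. R \<le> norm x \<and> isCont v x \<longrightarrow> C1 * w x \<le> v x \<and> v x \<le> C2 * w x))"

end

theory Submission
  imports Defs "HOL-Probability.Probability"
begin

text \<open>
  Testing criticality with products of one-dimensional cutoffs and Gaussians gives an identity for
  the Gaussian averages \<open>I(a) = \<integral> v(y) exp (- a |x - y|\<^sup>2) dy\<close>.  Read as a differential inequality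
  in \<open>a\<close> it makes \<open>a\<^sup>N\<^sup>/\<^sup>2 I(a)\<close> monotone up to explicit exponential factors, in both directions.
  Letting \<open>a\<close> tend to infinity, this bounds \<open>v\<close> above and below by its averages, without elliptic
  regularity.  Mollifications of \<open>v\<close> satisfy the differential inequalities with a small error, so the
  classical maximum principle on annuli compares \<open>v\<close> with radial barriers.  A first barrier
  \<open>exp (- |x|\<^sup>2 / 4)\<close> gives Gaussian decay, which turns the nonlinearity into a perturbation
  \<open>O(|x|\<^sup>-\<^sup>2) v\<close> of \<open>(|x|\<^sup>2 - \<omega>) v\<close>.  The barriers \<open>w\<^sub>\<gamma> - w\<^sub>\<gamma>\<^sub>-\<^sub>1\<close> and \<open>w\<^sub>\<gamma> + w\<^sub>\<gamma>\<^sub>-\<^sub>1\<close> with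
  \<open>w\<^sub>\<gamma>(x) = |x|\<^sup>\<gamma> exp (- |x|\<^sup>2 / 2)\<close> and \<open>\<gamma> = (\<omega> - N) / 2\<close> then give the two bounds.
\<close>

text \<open>The exponent comes from the Laplacian of \<open>w\<^sub>\<gamma>\<close>, which is
  (|x|^2 - 2 \<gamma> - N + O(|x|^-2)) times \<open>w\<^sub>\<gamma>\<close>: matching 2 \<gamma> +
  N with \<omega> leaves only the small remainder. A bounded error in the potential would act like a
  shift of \<omega> and could change the exponent. Decay of v like 1/|x| makes |x|^2 v^3 at most a
  constant times v, which is such an error; hence the intermediate Gaussian decay. The obstacle is
  that v is merely an element of H. A Gaussian average is smooth, its Laplacian at every point is
  the same average of the right-hand side, and up to the factor a^(N/2) the averages are a heat flow
  at time 1/(4a); bounds at a = 1, read off from integrals of v, are carried along this flow.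
  Averaging does not commute with the potential |x|^2, but the error vanishes uniformly on annuli as
  a grows and is absorbed because the potential is at least 1 far out. Gaussians factor over the
  coordinates, which is why test functions may be products.\<close>

section \<open>Calculus of the change of variables and of its nonlinearities\<close>

lemma one_plus_two_sq: "0 < 1 + 2 * (x::real)\<^sup>2" "1 \<le> 1 + 2 * x\<^sup>2" "1 \<le> sqrt (1 + 2 * x\<^sup>2)"
  by (auto simp: add_pos_nonneg)

lemma one_plus_two_sq_nz: "1 + 2 * (x::real)\<^sup>2 \<noteq> 0"
  using one_plus_two_sq(1)[of x] by linarith

lemma inverse_le_one: "1 \<le> (x::real) \<Longrightarrow> 1 / x \<le> 1"
  by simp

text \<open>The equation is assumed on t > 0 only. Oddness carries it to t < 0; at 0 the mean value
  theorem turns the difference quotient f h / h into a value of the right-hand side at a point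
  between 0 and h, which tends to 1 by continuity of f at 0.\<close>

lemma dual_change_deriv:
  assumes "dual_change f"
  shows "(f has_real_derivative 1 / sqrt (1 + 2 * (f t)\<^sup>2)) (at t)"
proof -
  have f0: "f 0 = 0" and c0: "isCont f 0" and odd: "\<And>t. f (- t) = - f t"
    and d: "\<And>t. t > 0 \<Longrightarrow> (f has_real_derivative 1 / sqrt (1 + 2 * (f t)\<^sup>2)) (at t)"
    using assms by (auto simp: dual_change_def)
  consider "t > 0" | "t < 0" | "t = 0" by linarith
  then show ?thesis
  proof cases
    case 1 then show ?thesis using d by simp
  next
    case 2
    have "((\<lambda>s. - f (- s)) has_real_derivative - (1 / sqrt (1 + 2 * (f (- t))\<^sup>2) * (-1))) (at t)"
      using 2 by (intro DERIV_minus DERIV_chain2[where f=f and g=uminus] d) (auto intro!: derivative_eq_intros)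
    moreover have "(\<lambda>s. - f (- s)) = f" using odd by auto
    ultimately show ?thesis using odd by simp
  next
    case 3
    have "((\<lambda>h. f h / h) \<longlongrightarrow> 1) (at 0)"
    proof (rule LIM_I)
      fix r :: real assume "0 < r"
      have "isCont (\<lambda>s. 1 / sqrt (1 + 2 * (f s)\<^sup>2)) 0"
        by (intro continuous_intros c0) (simp add: f0)
      then have "(\<lambda>s. 1 / sqrt (1 + 2 * (f s)\<^sup>2)) \<midarrow>0\<rightarrow> 1" by (simp add: isCont_def f0)
      from LIM_D[OF this \<open>0 < r\<close>] obtain e where e: "e > 0"
        "\<And>s. s \<noteq> 0 \<Longrightarrow> \<bar>s\<bar> < e \<Longrightarrow> \<bar>1 / sqrt (1 + 2 * (f s)\<^sup>2) - 1\<bar> < r" by auto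
      have pos: "\<bar>f h / h - 1\<bar> < r" if h: "0 < h" "h < e" for h
      proof -
        have "continuous_on {0..h} f"
          unfolding continuous_on_eq_continuous_within
          by (metis atLeastAtMost_iff c0 continuous_at_imp_continuous_at_within d DERIV_isCont less_eq_real_def)
        moreover have "\<And>s. 0 < s \<Longrightarrow> s < h \<Longrightarrow> f differentiable (at s)"
          using d real_differentiable_def by blast
        ultimately obtain l z where z: "0 < z" "z < h" "DERIV f z :> l" "f h - f 0 = (h - 0) * l"
          using MVT[of 0 h f] h by blast
        then have "l = 1 / sqrt (1 + 2 * (f z)\<^sup>2)" using d DERIV_unique by blast
        moreover have "f h / h = l" using z that f0 by simp
        ultimately show ?thesis using e(2)[of z] z that by auto
      qed
      have "\<bar>f h / h - 1\<bar> < r" if "h \<noteq> 0" "\<bar>h\<bar> < e" for h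
        using pos[of h] pos[of "- h"] that odd[of h] by (cases "h > 0") auto
      then show "\<exists>s>0. \<forall>x. x \<noteq> 0 \<and> norm (x - 0) < s \<longrightarrow> norm (f x / x - 1) < r"
        using e(1) by (intro exI[of _ e]) auto
    qed
    then show ?thesis using 3 f0 by (simp add: DERIV_def)
  qed
qed

text \<open>\<open>dual_p f\<close> is f f' and \<open>dual_q f\<close> is f^3 f', the derivatives
  of f^2 / 2 and f^4 / 4: the two nonlinearities of the Euler-Lagrange equation.\<close>

definition dual_p :: "(real \<Rightarrow> real) \<Rightarrow> real \<Rightarrow> real" where
  "dual_p f t = f t / sqrt (1 + 2 * (f t)\<^sup>2)"

definition dual_q :: "(real \<Rightarrow> real) \<Rightarrow> real \<Rightarrow> real" where
  "dual_q f t = (f t) ^ 3 / sqrt (1 + 2 * (f t)\<^sup>2)"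

context
  fixes f :: "real \<Rightarrow> real"
  assumes dc: "dual_change f"
begin

lemma dual_deriv_sq: "((\<lambda>t. (f t)\<^sup>2) has_real_derivative 2 * dual_p f t) (at t)"
  by (rule derivative_eq_intros dual_change_deriv[OF dc] refl)+ (simp add: dual_p_def)

lemma dual_deriv_pow4: "((\<lambda>t. (f t) ^ 4) has_real_derivative 4 * dual_q f t) (at t)"
  by (rule derivative_eq_intros dual_change_deriv[OF dc] refl)+ (simp add: dual_q_def)

text \<open>With s = sqrt (1 + 2 F^2), the derivative of F / s in F is s^-3; the chain rule adds the
  factor f' = 1 / s.\<close>

lemma dual_deriv_p: "(dual_p f has_real_derivative 1 / (1 + 2 * (f t)\<^sup>2)\<^sup>2) (at t)"
proof -
  have p: "1 + 2 * (f t)\<^sup>2 > 0" by (simp add: add_pos_nonneg)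
  let ?s = "sqrt (1 + 2 * (f t)\<^sup>2)"
  have s: "?s > 0" "?s\<^sup>2 = 1 + 2 * (f t)\<^sup>2" using p by auto
  \<comment> \<open>The nested fraction left by the quotient rule is simplified for abstract s and
    F; the relation s^2 = 1 + 2 F^2 enters only afterwards.\<close>
  have quot: "(1 / s * s - F * (2 * (2 * F * (1 / s)) * inverse s / 2)) / (s * s)
      = (s\<^sup>2 - 2 * F\<^sup>2) / (s\<^sup>2)\<^sup>2" if "s > 0" for s F :: real
    using that by (simp add: divide_simps power2_eq_square)
  have "((\<lambda>t. f t / sqrt (1 + 2 * (f t)\<^sup>2)) has_real_derivative
      (1 / ?s * ?s - f t * (2 * (2 * f t * (1 / ?s)) * inverse ?s / 2)) / (?s * ?s)) (at t)"
    by (rule derivative_eq_intros dual_change_deriv[OF dc] refl p | use s in simp)+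
  moreover have "(1 / ?s * ?s - f t * (2 * (2 * f t * (1 / ?s)) * inverse ?s / 2)) / (?s * ?s)
     = 1 / (1 + 2 * (f t)\<^sup>2)\<^sup>2"
  proof -
    have "(1 / ?s * ?s - f t * (2 * (2 * f t * (1 / ?s)) * inverse ?s / 2)) / (?s * ?s)
      = (?s\<^sup>2 - 2 * (f t)\<^sup>2) / (?s\<^sup>2)\<^sup>2"
      by (rule quot) (use s in simp)
    also have "\<dots> = 1 / (1 + 2 * (f t)\<^sup>2)\<^sup>2" unfolding s(2) by simp
    finally show ?thesis .
  qed
  ultimately show ?thesis by (simp add: dual_p_def[abs_def])
qed

lemma dual_deriv_q:
  "(dual_q f has_real_derivative (3 * (f t)\<^sup>2 + 4 * (f t) ^ 4) / (1 + 2 * (f t)\<^sup>2)\<^sup>2) (at t)"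
proof -
  have p: "1 + 2 * (f t)\<^sup>2 > 0" by (simp add: add_pos_nonneg)
  let ?s = "sqrt (1 + 2 * (f t)\<^sup>2)"
  have s: "?s > 0" "?s\<^sup>2 = 1 + 2 * (f t)\<^sup>2" using p by auto
  \<comment> \<open>Writing the cubic nonlinearity as f^2 times the first one reduces its derivative
    to the product rule.\<close>
  have "((\<lambda>t. (f t)\<^sup>2 * dual_p f t) has_real_derivative
     2 * dual_p f t * dual_p f t + 1 / (1 + 2 * (f t)\<^sup>2)\<^sup>2 * (f t)\<^sup>2) (at t)"
    by (rule DERIV_mult dual_deriv_sq dual_deriv_p)+
  moreover have "(\<lambda>t. (f t)\<^sup>2 * dual_p f t) = dual_q f"
    by (auto simp: dual_p_def dual_q_def power2_eq_square power3_eq_cube)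
  moreover have "2 * dual_p f t * dual_p f t + 1 / (1 + 2 * (f t)\<^sup>2)\<^sup>2 * (f t)\<^sup>2
     = (3 * (f t)\<^sup>2 + 4 * (f t) ^ 4) / (1 + 2 * (f t)\<^sup>2)\<^sup>2"
  proof -
    have "dual_p f t * dual_p f t = (f t)\<^sup>2 / (1 + 2 * (f t)\<^sup>2)"
      using p by (simp add: dual_p_def power2_eq_square)
    also have "\<dots> = (f t)\<^sup>2 * (1 + 2 * (f t)\<^sup>2) / (1 + 2 * (f t)\<^sup>2)\<^sup>2"
      using p by (simp add: power2_eq_square)
    finally have "2 * dual_p f t * dual_p f t
       = 2 * (f t)\<^sup>2 * (1 + 2 * (f t)\<^sup>2) / (1 + 2 * (f t)\<^sup>2)\<^sup>2"
      by (simp add: mult.assoc)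
    then show ?thesis
      by (simp add: add_divide_distrib[symmetric] algebra_simps power2_eq_square power4_eq_xxxx)
  qed
  ultimately show ?thesis by simp
qed

lemma dual_f0: "f 0 = 0" using dc by (simp add: dual_change_def)

lemma dual_cont: "continuous_on UNIV f" "continuous_on UNIV (dual_p f)" "continuous_on UNIV (dual_q f)"
  by (meson DERIV_isCont continuous_at_imp_continuous_on dual_change_deriv[OF dc] dual_deriv_p dual_deriv_q)+

lemma dual_measurable [measurable]:
  "f \<in> borel_measurable borel" "dual_p f \<in> borel_measurable borel" "dual_q f \<in> borel_measurable borel"
  using dual_cont by (auto intro: borel_measurable_continuous_onI)

text \<open>All by the mean value theorem: f' lies in [0, 1], and on [0, t], where f is at most t,
  it is at least 1 / sqrt (1 + 2 t^2). The lower bound makes f(v) comparable to v as long as v is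
  bounded.\<close>

lemma dual_f_bounds:
  assumes "0 \<le> t"
  shows "0 \<le> f t" "f t \<le> t" "t / sqrt (1 + 2 * t\<^sup>2) \<le> f t"
proof -
  have le: "0 \<le> f t \<and> f t \<le> t" if t: "0 \<le> t" for t
  proof (cases "t = 0")
    case False
    with t have "0 < t" by simp
    then obtain z where z: "f t - f 0 = (t - 0) * (1 / sqrt (1 + 2 * (f z)\<^sup>2))"
      using MVT2[of 0 t f "\<lambda>t. 1 / sqrt (1 + 2 * (f t)\<^sup>2)"] dual_change_deriv[OF dc] by blast
    have "0 \<le> 1 / sqrt (1 + 2 * (f z)\<^sup>2)" "1 / sqrt (1 + 2 * (f z)\<^sup>2) \<le> 1"
      by (auto intro!: inverse_le_one one_plus_two_sq)
    with t have "t * (1 / sqrt (1 + 2 * (f z)\<^sup>2)) \<le> t" "0 \<le> t * (1 / sqrt (1 + 2 * (f z)\<^sup>2))"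
      by (auto intro!: mult_left_le simp del: times_divide_eq_right)
    then show ?thesis using z dual_f0 by simp
  qed (simp add: dual_f0)
  from le[OF assms] show "0 \<le> f t" "f t \<le> t" by auto
  show "t / sqrt (1 + 2 * t\<^sup>2) \<le> f t"
  proof (cases "t = 0")
    case False
    then obtain z where z: "0 < z" "z < t" "f t - f 0 = (t - 0) * (1 / sqrt (1 + 2 * (f z)\<^sup>2))"
      using MVT2[of 0 t f "\<lambda>t. 1 / sqrt (1 + 2 * (f t)\<^sup>2)"] dual_change_deriv[OF dc] assms by auto
    have "(f z)\<^sup>2 \<le> t\<^sup>2" using le[of z] z by (intro power_mono) auto
    then have "1 / sqrt (1 + 2 * t\<^sup>2) \<le> 1 / sqrt (1 + 2 * (f z)\<^sup>2)"
      using one_plus_two_sq[of t] one_plus_two_sq[of "f z"] by (intro divide_left_mono mult_pos_pos) (auto simp: one_plus_two_sq)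
    then have "t * (1 / sqrt (1 + 2 * t\<^sup>2)) \<le> t * (1 / sqrt (1 + 2 * (f z)\<^sup>2))"
      using assms by (rule mult_left_mono)
    then show ?thesis using z dual_f0 by simp
  qed (simp add: dual_f0)
qed

lemma dual_f_pos_iff: "0 < f t \<longleftrightarrow> 0 < t"
proof
  assume "0 < t" then show "0 < f t"
    using dual_f_bounds(3)[of t] by (smt (verit) divide_pos_pos real_sqrt_gt_zero zero_le_power2)
next
  assume "0 < f t"
  show "0 < t"
  proof (rule ccontr)
    assume "\<not> 0 < t"
    then have "f (- t) \<ge> 0" using dual_f_bounds(1)[of "- t"] by simp
    moreover have "f (- t) = - f t" using dc by (simp add: dual_change_def)
    ultimately show False using \<open>0 < f t\<close> by simp
  qed
qed

text \<open>These are the slopes of the two nonlinearities; the last bound is the expansion (1 + 2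
  f^2)^2 = 1 + 4 f^2 + 4 f^4. Slopes of size at most 1 give the energy a quadratic remainder along
  every test function.\<close>

lemma dual_slope_bounds:
  "0 \<le> 1 / (1 + 2 * (f t)\<^sup>2)\<^sup>2" "1 / (1 + 2 * (f t)\<^sup>2)\<^sup>2 \<le> 1"
  "0 \<le> (3 * (f t)\<^sup>2 + 4 * (f t) ^ 4) / (1 + 2 * (f t)\<^sup>2)\<^sup>2"
  "(3 * (f t)\<^sup>2 + 4 * (f t) ^ 4) / (1 + 2 * (f t)\<^sup>2)\<^sup>2 \<le> 1"
proof -
  have p: "1 \<le> (1 + 2 * (f t)\<^sup>2)\<^sup>2" by (rule one_le_power) simp
  then show "0 \<le> 1 / (1 + 2 * (f t)\<^sup>2)\<^sup>2" "1 / (1 + 2 * (f t)\<^sup>2)\<^sup>2 \<le> 1"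
    by (auto intro!: inverse_le_one)
  show "0 \<le> (3 * (f t)\<^sup>2 + 4 * (f t) ^ 4) / (1 + 2 * (f t)\<^sup>2)\<^sup>2" by auto
  have "3 * (f t)\<^sup>2 + 4 * (f t) ^ 4 \<le> (1 + 2 * (f t)\<^sup>2)\<^sup>2"
    by (simp add: power2_eq_square power4_eq_xxxx algebra_simps)
  then show "(3 * (f t)\<^sup>2 + 4 * (f t) ^ 4) / (1 + 2 * (f t)\<^sup>2)\<^sup>2 \<le> 1"
    using p by (subst pos_divide_le_eq) (auto simp: one_plus_two_sq_nz)
qed

lemma lipschitz_from_deriv:
  fixes g g' :: "real \<Rightarrow> real"
  assumes "\<And>t. (g has_real_derivative g' t) (at t)" "\<And>t. \<bar>g' t\<bar> \<le> 1"
  shows "\<bar>g s - g t\<bar> \<le> \<bar>s - t\<bar>"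
proof -
  have "\<bar>g s - g t\<bar> \<le> 1 * \<bar>s - t\<bar>"
    using field_differentiable_bound[of UNIV g g' 1 s t] assms
    by (simp)
  then show ?thesis by simp
qed

text \<open>A derivative bound for the function u -> g u - c g'(t) u on the segment from t to t + s;
  the factor 1/2 of the sharp remainder is given away.\<close>

lemma taylor_bound:
  fixes g g' g'' :: "real \<Rightarrow> real"
  assumes "\<And>t. (g has_real_derivative c * g' t) (at t)" "\<And>t. (g' has_real_derivative g'' t) (at t)"
    "\<And>t. \<bar>g'' t\<bar> \<le> 1"
  shows "\<bar>g (t + s) - g t - c * g' t * s\<bar> \<le> \<bar>c\<bar> * s\<^sup>2"
proof -
  have "\<bar>(g (t + s) - c * g' t * (t + s)) - (g t - c * g' t * t)\<bar> \<le> (\<bar>c\<bar> * \<bar>s\<bar>) * \<bar>(t + s) - t\<bar>"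
  proof (rule field_differentiable_bound[of "closed_segment t (t+s)", where f="\<lambda>u. g u - c * g' t * u" and f'="\<lambda>u. c * g' u - c * g' t", simplified real_norm_def])
    fix u assume "u \<in> closed_segment t (t + s)"
    then have "\<bar>u - t\<bar> \<le> \<bar>s\<bar>" using segment_bound1[of u t "t+s"] by simp
    then have "\<bar>g' u - g' t\<bar> \<le> \<bar>s\<bar>" using lipschitz_from_deriv[OF assms(2,3), of u t] by linarith
    then show "\<bar>c * g' u - c * g' t\<bar> \<le> \<bar>c\<bar> * \<bar>s\<bar>"
      by (simp add: right_diff_distrib[symmetric] abs_mult mult_left_mono)
    show "((\<lambda>u. g u - c * g' t * u) has_field_derivative c * g' u - c * g' t) (at u within closed_segment t (t + s))"
      by (rule DERIV_subset[where s=UNIV]) (auto intro!: derivative_eq_intros assms(1))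
  qed auto
  then show ?thesis by (simp add: algebra_simps power2_eq_square)
qed

lemma dual_p_lip: "\<bar>dual_p f s - dual_p f t\<bar> \<le> \<bar>s - t\<bar>"
  using lipschitz_from_deriv[OF dual_deriv_p, of s t] dual_slope_bounds by auto

lemma dual_q_lip: "\<bar>dual_q f s - dual_q f t\<bar> \<le> \<bar>s - t\<bar>"
  using lipschitz_from_deriv[OF dual_deriv_q, of s t] dual_slope_bounds by (auto simp del: zero_le_divide_iff)

lemma dual_p_abs: "\<bar>dual_p f t\<bar> \<le> \<bar>t\<bar>" and dual_q_abs: "\<bar>dual_q f t\<bar> \<le> \<bar>t\<bar>"
  using dual_p_lip[of t 0] dual_q_lip[of t 0] by (auto simp: dual_p_def dual_q_def dual_f0)

lemma dual_sq_taylor: "\<bar>(f (t + s))\<^sup>2 - (f t)\<^sup>2 - 2 * dual_p f t * s\<bar> \<le> 2 * s\<^sup>2"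
  using taylor_bound[OF dual_deriv_sq dual_deriv_p] dual_slope_bounds by auto

lemma dual_pow4_taylor: "\<bar>(f (t + s)) ^ 4 - (f t) ^ 4 - 4 * dual_q f t * s\<bar> \<le> 4 * s\<^sup>2"
  using taylor_bound[OF dual_deriv_pow4 dual_deriv_q] dual_slope_bounds by (auto simp del: zero_le_divide_iff)

lemma dual_p_nonneg: "0 \<le> t \<Longrightarrow> 0 \<le> dual_p f t" and dual_q_nonneg: "0 \<le> t \<Longrightarrow> 0 \<le> dual_q f t"
  using dual_f_bounds(1) by (auto simp: dual_p_def dual_q_def)

lemma dual_q_le_cube:
  assumes "0 \<le> t" shows "dual_q f t \<le> t ^ 3"
proof -
  have "dual_q f t \<le> f t ^ 3 / 1" unfolding dual_q_def
    using dual_f_bounds[OF assms] one_plus_two_sq[of "f t"] by (intro divide_left_mono) (auto simp: one_plus_two_sq)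
  also have "\<dots> \<le> t ^ 3" using dual_f_bounds[OF assms] by (simp add: power_mono)
  finally show ?thesis .
qed

text \<open>As a function of f^2, the slope (1 + 2 f^2)^-2 lies above its tangent 1 - 4 f^2 at 0,
  and f(z) <= t for the intermediate point z. So the first nonlinearity is the identity up to a
  cubic error.\<close>

lemma dual_p_ge:
  assumes "0 \<le> t" shows "t - 4 * t ^ 3 \<le> dual_p f t"
proof (cases "t = 0")
  case False
  then obtain z where z: "0 < z" "z < t" "dual_p f t - dual_p f 0 = (t - 0) * (1 / (1 + 2 * (f z)\<^sup>2)\<^sup>2)"
    using MVT2[of 0 t "dual_p f" "\<lambda>t. 1 / (1 + 2 * (f t)\<^sup>2)\<^sup>2"] dual_deriv_p assms by auto
  let ?s = "(f z)\<^sup>2"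
  have s: "0 \<le> ?s" "?s \<le> t\<^sup>2" using dual_f_bounds[of z] z by (auto intro!: power_mono)
  have "(1 - 4 * ?s) * (1 + 2 * ?s)\<^sup>2 \<le> 1"
  proof -
    have "(1 - 4 * ?s) * (1 + 2 * ?s)\<^sup>2 = 1 - 12 * ?s^2 - 16 * ?s^3"
      by (simp add: power2_eq_square power3_eq_cube algebra_simps)
    also have "\<dots> \<le> 1" using s by (smt (verit) zero_le_power)
    finally show ?thesis .
  qed
  then have "1 - 4 * ?s \<le> 1 / (1 + 2 * ?s)\<^sup>2"
    using s by (subst pos_le_divide_eq) (auto simp: one_plus_two_sq_nz)
  then have "1 - 4 * t\<^sup>2 \<le> 1 / (1 + 2 * ?s)\<^sup>2" using s by linarith
  then have "t * (1 - 4 * t\<^sup>2) \<le> t * (1 / (1 + 2 * ?s)\<^sup>2)" using assms by (rule mult_left_mono)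
  then show ?thesis using z by (simp add: dual_p_def dual_f0 algebra_simps power2_eq_square power3_eq_cube)
qed (simp add: dual_p_def dual_f0)

end

section \<open>Integrals depending on a parameter\<close>

text \<open>Differentiation under the integral sign. The bound D on the derivative, required only
  for parameters within \<delta> of \<open>s0\<close>, yields a Lipschitz bound for k in the
  parameter, and this dominates all difference quotients.\<close>

lemma has_real_derivative_integral:
  fixes k k' :: "real \<Rightarrow> 'b \<Rightarrow> real"
  assumes \<delta>: "0 < \<delta>"
    and d: "\<And>s y. \<bar>s - s0\<bar> < \<delta> \<Longrightarrow> ((\<lambda>s. k s y) has_real_derivative k' s y) (at s)"
    and m: "\<And>s. k s \<in> borel_measurable M" "k' s0 \<in> borel_measurable M"
    and i: "integrable M (k s0)"
    and b: "\<And>s y. \<bar>s - s0\<bar> < \<delta> \<Longrightarrow> \<bar>k' s y\<bar> \<le> D y" "integrable M D"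
  shows "((\<lambda>s. \<integral>y. k s y \<partial>M) has_real_derivative (\<integral>y. k' s0 y \<partial>M)) (at s0)"
proof -
  have lip: "\<bar>k (s0 + h) y - k s0 y\<bar> \<le> D y * \<bar>h\<bar>" if "\<bar>h\<bar> < \<delta>" for h y
  proof -
    have "\<bar>k (s0 + h) y - k s0 y\<bar> \<le> D y * \<bar>s0 + h - s0\<bar>"
    proof (rule field_differentiable_bound[of "{s0 - \<bar>h\<bar> .. s0 + \<bar>h\<bar>}", where f="\<lambda>s. k s y" and f'="\<lambda>s. k' s y", simplified real_norm_def])
      fix s assume "s \<in> {s0 - \<bar>h\<bar> .. s0 + \<bar>h\<bar>}"
      then have "\<bar>s - s0\<bar> < \<delta>" using that by auto
      then show "((\<lambda>s. k s y) has_real_derivative k' s y) (at s within {s0 - \<bar>h\<bar> .. s0 + \<bar>h\<bar>})"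
        "\<bar>k' s y\<bar> \<le> D y"
        using d b by (auto intro: has_field_derivative_at_within)
    qed auto
    then show ?thesis by simp
  qed
  \<comment> \<open>Integrability is given at \<open>s0\<close> only; the Lipschitz bound transports
    it to nearby parameters.\<close>
  have int: "integrable M (k (s0 + h))" if "\<bar>h\<bar> < \<delta>" for h
  proof -
    have "integrable M (\<lambda>y. k (s0 + h) y - k s0 y)"
      by (rule Bochner_Integration.integrable_bound[OF integrable_mult_left[OF b(2), of "\<bar>h\<bar>"]])
        (use m lip[OF that] in \<open>auto intro: order_trans[OF _ abs_ge_self]\<close>)
    from Bochner_Integration.integrable_add[OF this i] show ?thesis by simp
  qed
  have "((\<lambda>h. ((\<integral>y. k (s0 + h) y \<partial>M) - (\<integral>y. k s0 y \<partial>M)) / h) \<longlongrightarrow> (\<integral>y. k' s0 y \<partial>M)) (at 0 within ball 0 \<delta>)"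
    unfolding tendsto_at_iff_sequentially
  proof (intro allI impI)
    fix X :: "nat \<Rightarrow> real" assume X: "\<forall>i. X i \<in> ball 0 \<delta> - {0}" "X \<longlonglongrightarrow> 0"
    have eq: "(\<integral>y. (k (s0 + X n) y - k s0 y) / X n \<partial>M) = ((\<integral>y. k (s0 + X n) y \<partial>M) - (\<integral>y. k s0 y \<partial>M)) / X n" for n
      using int[of "X n"] i X by simp
    have "(\<lambda>n. \<integral>y. (k (s0 + X n) y - k s0 y) / X n \<partial>M) \<longlonglongrightarrow> (\<integral>y. k' s0 y \<partial>M)"
    proof (rule integral_dominated_convergence[where w=D])
      show "AE y in M. (\<lambda>n. (k (s0 + X n) y - k s0 y) / X n) \<longlonglongrightarrow> k' s0 y"
      proof (rule AE_I2)
        fix y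
        have "((\<lambda>h. (k (s0 + h) y - k s0 y) / h) \<longlongrightarrow> k' s0 y) (at 0)"
          using d[of s0 y] \<delta> by (simp add: DERIV_def)
        then show "(\<lambda>n. (k (s0 + X n) y - k s0 y) / X n) \<longlonglongrightarrow> k' s0 y"
          using X unfolding tendsto_at_iff_sequentially by (auto simp: comp_def)
      qed
      show "AE y in M. norm ((k (s0 + X n) y - k s0 y) / X n) \<le> D y" for n
        using lip[of "X n"] X(1)[rule_format, of n] by (auto simp: pos_divide_le_eq)
    qed (use m b in auto)
    then show "((\<lambda>h. ((\<integral>y. k (s0 + h) y \<partial>M) - (\<integral>y. k s0 y \<partial>M)) / h) \<circ> X) \<longlonglongrightarrow> (\<integral>y. k' s0 y \<partial>M)"
      unfolding comp_def eq .
  qed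
  then show ?thesis
    using \<delta> by (simp add: DERIV_def at_within_open[of 0 "ball 0 \<delta>"])
qed

lemma isCont_integral:
  fixes k :: "'a::metric_space \<Rightarrow> 'b \<Rightarrow> real"
  assumes \<delta>: "0 < \<delta>"
    and c: "\<And>y. isCont (\<lambda>x. k x y) x0"
    and m: "\<And>x. k x \<in> borel_measurable M"
    and b: "\<And>x y. dist x x0 < \<delta> \<Longrightarrow> \<bar>k x y\<bar> \<le> D y" "integrable M D"
  shows "isCont (\<lambda>x. \<integral>y. k x y \<partial>M) x0"
proof -
  have "((\<lambda>x. \<integral>y. k x y \<partial>M) \<longlongrightarrow> (\<integral>y. k x0 y \<partial>M)) (at x0 within ball x0 \<delta>)"
    unfolding tendsto_at_iff_sequentially comp_def
  proof (intro allI impI)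
    fix X assume X: "\<forall>i. X i \<in> ball x0 \<delta> - {x0}" "X \<longlonglongrightarrow> x0"
    show "(\<lambda>n. \<integral>y. k (X n) y \<partial>M) \<longlonglongrightarrow> (\<integral>y. k x0 y \<partial>M)"
    proof (rule integral_dominated_convergence[where w=D])
      show "AE y in M. (\<lambda>n. k (X n) y) \<longlonglongrightarrow> k x0 y"
        using c X(2) by (intro AE_I2 isCont_tendsto_compose[where g="\<lambda>x. k x _"]) auto
      show "AE y in M. norm (k (X n) y) \<le> D y" for n
        using b(1)[of "X n"] X(1) by (auto simp: dist_commute)
    qed (use m b in auto)
  qed
  then show ?thesis using \<delta> by (simp add: isCont_def at_within_open[of x0 "ball x0 \<delta>"])
qed

section \<open>The sign of a function from its integrals over boxes\<close>

text \<open>The lower corner exceeds the upper one in every coordinate: a way to write the empty set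
  as a box.\<close>

lemma unit_boxes_empty: "cbox One (0::'a::euclidean_space) = {} \<and> box One (0::'a) = {}"
proof -
  obtain b :: 'a where "b \<in> Basis" using nonempty_Basis by blast
  then show ?thesis unfolding box_eq_empty by force
qed

text \<open>A form of the Lebesgue differentiation argument. The set A of points of U in a big box
  where k > 0 is enclosed in an open W so tight that the integral of |k| over W - A is small, and A
  is covered, up to a null set, by disjoint open boxes inside U and W. The integral of k over the
  union of these boxes is at most 0, so the integral over A is at most the small error.\<close>

lemma AE_le_zero_of_box_integrals:
  fixes k :: "'a::euclidean_space \<Rightarrow> real"
  assumes [measurable]: "k \<in> borel_measurable borel" and "open U"
    and int: "\<And>a b. set_integrable lborel (cbox a b) k"
    and le: "\<And>a b. cbox a b \<subseteq> U \<Longrightarrow> (LINT x:box a b|lborel. k x) \<le> 0"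
  shows "AE x in lborel. x \<in> U \<longrightarrow> k x \<le> 0"
proof -
  have [measurable]: "U \<in> sets borel" using \<open>open U\<close> by simp
  have *: "AE x in lborel. x \<in> U \<inter> box (- (real n *\<^sub>R One)) (real n *\<^sub>R One) \<longrightarrow> k x \<le> 0" if "n \<ge> 1" for n :: nat
  proof -
    define a where "a = - (real n *\<^sub>R (One::'a))"
    define b where "b = real n *\<^sub>R (One::'a)"
    define A where "A = {x \<in> U \<inter> box a b. k x > 0}"
    have [measurable]: "A \<in> sets borel" unfolding A_def by measurable
    have box: "box a b \<noteq> {}" using that by (auto simp: a_def b_def box_eq_empty)
    have Acb: "A \<subseteq> cbox a b" using box_subset_cbox A_def by blast
    have ik: "integrable lborel (\<lambda>x. indicator (cbox a b) x * k x)"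
      using int[of a b] by (simp add: set_integrable_def)
    have sub: "set_integrable lborel S k" if "S \<subseteq> cbox a b" "S \<in> sets borel" for S
      using set_integrable_subset[OF int[of a b]] that by auto
    \<comment> \<open>Outer regularity is applied to the measure with density |k| rather than to
      Lebesgue measure, so that the excess of W over A is small in exactly the quantity to be
      estimated.\<close>
    define \<nu> where "\<nu> = density lborel (\<lambda>x. ennreal \<bar>indicator (cbox a b) x * k x\<bar>)"
    have sn[simp, measurable_cong]: "sets \<nu> = sets borel" by (simp add: \<nu>_def)
    have emn: "emeasure \<nu> S = ennreal (LINT x:S|lborel. \<bar>indicator (cbox a b) x * k x\<bar>)" if [measurable]: "S \<in> sets borel" for S
    proof -
      have "integrable lborel (\<lambda>x. indicator S x *\<^sub>R \<bar>indicator (cbox a b) x * k x\<bar>)"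
        using ik by (intro integrable_mult_indicator) auto
      then have "(\<integral>\<^sup>+x. ennreal (indicator S x * \<bar>indicator (cbox a b) x * k x\<bar>) \<partial>lborel)
           = ennreal (LINT x:S|lborel. \<bar>indicator (cbox a b) x * k x\<bar>)"
        by (subst nn_integral_eq_integral) (auto simp: set_lebesgue_integral_def)
      moreover have "emeasure \<nu> S = (\<integral>\<^sup>+x. ennreal (indicator S x * \<bar>indicator (cbox a b) x * k x\<bar>) \<partial>lborel)"
        unfolding \<nu>_def by (subst emeasure_density) (auto intro!: nn_integral_cong split: split_indicator)
      ultimately show ?thesis by simp
    qed
    have fin: "emeasure \<nu> (space \<nu>) \<noteq> \<infinity>"
      using emn[of UNIV] by (simp add: \<nu>_def)
    interpret \<nu>: finite_measure \<nu> by standard (rule fin)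
    have A0: "(LINT x:A|lborel. k x) \<le> e" if "e > 0" for e :: real
    proof -
      have "emeasure \<nu> A = (INF W\<in>{W. A \<subseteq> W \<and> open W}. emeasure \<nu> W)"
        by (rule outer_regular[OF sn fin]) simp
      moreover have "emeasure \<nu> A < emeasure \<nu> A + ennreal e"
        using \<open>e > 0\<close> by (simp add: \<nu>.emeasure_eq_measure ennreal_plus[symmetric] ennreal_less_iff del: ennreal_plus)
      ultimately have "(INF W\<in>{W. A \<subseteq> W \<and> open W}. emeasure \<nu> W) < emeasure \<nu> A + ennreal e" by simp
      then obtain W where W: "A \<subseteq> W" "open W" "emeasure \<nu> W < emeasure \<nu> A + ennreal e"
        unfolding INF_less_iff by blast
      have [measurable]: "W \<in> sets borel" using W by simp
      have nWA: "measure \<nu> (W - A) \<le> e"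
      proof -
        have "measure \<nu> W < measure \<nu> A + e"
          using W(3) \<open>e > 0\<close> by (simp add: \<nu>.emeasure_eq_measure ennreal_plus[symmetric] ennreal_less_iff del: ennreal_plus)
        then show ?thesis using W(1) by (subst \<nu>.finite_measure_Diff) auto
      qed
      \<comment> \<open>Every box of the covering contains a tag from A, and A lies in U and W; this
        gauge therefore forces all boxes into U and W.\<close>
      define g where "g x = (if x \<in> U \<inter> W then U \<inter> W else UNIV)" for x
      have g: "gauge g" using \<open>open U\<close> \<open>open W\<close> by (auto simp: gauge_def g_def)
      from covering_lemma[OF Acb box g] obtain \<D> where D: "countable \<D>"  "\<Union>\<D> \<subseteq> cbox a b"
        "\<And>K. K \<in> \<D> \<Longrightarrow> interior K \<noteq> {} \<and> (\<exists>c d. K = cbox c d)"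
        "pairwise (\<lambda>A B. interior A \<inter> interior B = {}) \<D>"
        "\<And>K. K \<in> \<D> \<Longrightarrow> \<exists>x \<in> A \<inter> K. K \<subseteq> g x" "A \<subseteq> \<Union>\<D>" by metis
      have KU: "K \<subseteq> U \<inter> W" if "K \<in> \<D>" for K
        using D(5)[OF that] W(1) by (auto simp: g_def A_def split: if_splits)
      \<comment> \<open>The countable family is enumerated by natural numbers; a number that is not
        the index of a box gets the empty set.\<close>
      define B where "B i = (if \<exists>K\<in>\<D>. to_nat_on \<D> K = i then interior (from_nat_into \<D> i) else {})" for i
      define V where "V = (\<Union>i. B i)"
      have Bcase: "B i = {} \<or> (\<exists>K\<in>\<D>. to_nat_on \<D> K = i \<and> B i = interior K)" for i
        using D(1) by (auto simp: B_def)
      have Bbox: "\<exists>c d. B i = box c d \<and> cbox c d \<subseteq> U" for i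
      proof -
        consider "B i = {}" | K where "K\<in>\<D>" "B i = interior K" using Bcase by blast
        then show ?thesis
        proof cases
          case 1
          moreover have "cbox One (0::'a) = {}" "box One (0::'a) = {}"
            using unit_boxes_empty by auto
          ultimately have "B i = box One 0 \<and> cbox One (0::'a) \<subseteq> U" by simp
          then show ?thesis by blast
        next
          case 2
          then obtain c d where "K = cbox c d" using D(3) by blast
          then have "B i = box c d \<and> cbox c d \<subseteq> U" using 2 KU[of K] by (simp add: interior_cbox)
          then show ?thesis by blast
        qed
      qed
      have disj: "B i \<inter> B j = {}" if "i \<noteq> j" for i j
        using Bcase[of i] Bcase[of j] that D(4) unfolding pairwise_def by (metis inf_bot_left inf_bot_right)
      have Bo: "B i \<in> sets borel" for i using Bbox[of i] by auto
      then have [measurable]: "V \<in> sets borel" unfolding V_def by auto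
      have VD: "V \<subseteq> \<Union>\<D>" unfolding V_def using Bcase interior_subset by blast
      then have VW: "V \<subseteq> W" "V \<subseteq> cbox a b" using KU D(2) by blast+
      have V0: "(LINT x:V|lborel. k x) \<le> 0"
      proof (rule LIMSEQ_le_const2)
        have Veq: "V = (\<Union>n. \<Union>i<n. B i)" unfolding V_def by (auto intro: lessI)
        show "(\<lambda>n. LINT x:(\<Union>i<n. B i)|lborel. k x) \<longlonglongrightarrow> (LINT x:V|lborel. k x)"
          unfolding Veq
        proof (rule set_integral_cont_up)
          show "incseq (\<lambda>n. \<Union>i<n. B i)" by (intro monoI UN_mono) auto
          show "set_integrable lborel (\<Union>n. \<Union>i<n. B i) k" using sub[OF VW(2)] unfolding Veq[symmetric] by simp
        qed (use Bo in auto)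
        have "(LINT x:(\<Union>i<n. B i)|lborel. k x) \<le> 0" for n
        proof -
          have "(LINT x:(\<Union>i<n. B i)|lborel. k x) = (\<Sum>i<n. LINT x:(B i)|lborel. k x)"
          proof (rule set_integral_finite_Union)
            show "set_integrable lborel (B i) k" for i
              using VW(2) Bo[of i] unfolding V_def by (intro sub) blast+
          qed (use Bo disj in \<open>auto simp: disjoint_family_on_def\<close>)
          also have "\<dots> \<le> 0"
          proof (rule sum_nonpos)
            fix i
            obtain c d where "B i = box c d" "cbox c d \<subseteq> U" using Bbox[of i] by blast
            then show "(LINT x:(B i)|lborel. k x) \<le> 0" using le by simp
          qed
          finally show ?thesis .
        qed
        then show "\<exists>N. \<forall>n\<ge>N. (LINT x:(\<Union>i<n. B i)|lborel. k x) \<le> 0" by blast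
      qed
      \<comment> \<open>Passing from the closed boxes to their interiors loses countably many
        boundaries, a null set.\<close>
      have nul: "AE x in lborel. x \<in> A \<longrightarrow> x \<in> V"
      proof -
        have "AE x in lborel. x \<notin> (\<Union>K\<in>\<D>. K - interior K)"
        proof (rule AE_not_in)
         show "(\<Union>K\<in>\<D>. K - interior K) \<in> null_sets lborel"
        proof (rule null_sets_UN'[OF D(1)])
          fix K assume "K \<in> \<D>"
          then obtain c d where "K = cbox c d" using D(3) by blast
          then show "K - interior K \<in> null_sets lborel" using null_sets_cbox_Diff_box by simp
         qed
        qed
        moreover have "x \<in> V" if xA: "x \<in> A" "x \<notin> (\<Union>K\<in>\<D>. K - interior K)" for x
        proof -
          obtain K where K: "K \<in> \<D>" "x \<in> interior K" using xA D(6) by blast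
          then have "x \<in> B (to_nat_on \<D> K)" using D(1) by (auto simp: B_def)
          then show ?thesis by (auto simp: V_def)
        qed
        ultimately show ?thesis by (auto elim!: eventually_mono)
      qed
      have "(LINT x:A|lborel. k x) = (LINT x:A \<inter> V|lborel. k x)"
        by (rule set_integral_cong_set) (use nul in \<open>auto simp: set_borel_measurable_def\<close>)
      also have "\<dots> = (LINT x:V|lborel. k x) - (LINT x:V - A|lborel. k x)"
      proof -
        have "V = (A \<inter> V) \<union> (V - A)" by auto
        then have "(LINT x:V|lborel. k x) = (LINT x:(A \<inter> V) \<union> (V - A)|lborel. k x)" by simp
        also have "\<dots> = (LINT x:A \<inter> V|lborel. k x) + (LINT x:V - A|lborel. k x)"
          by (rule set_integral_Un) (use VW in \<open>auto intro!: sub\<close>)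
        finally show ?thesis by simp
      qed
      \<comment> \<open>V - A is contained in W - A, so taking it away costs at most the integral of
        |k| over W - A.\<close>
      also have "\<dots> \<le> 0 + measure \<nu> (W - A)"
      proof -
        have "- (LINT x:V - A|lborel. k x) \<le> (LINT x:W - A|lborel. \<bar>indicator (cbox a b) x * k x\<bar>)"
          unfolding set_lebesgue_integral_def Bochner_Integration.integral_minus[symmetric]
        proof (rule integral_mono)
          show "integrable lborel (\<lambda>x. - (indicat_real (V - A) x *\<^sub>R k x))"
            using sub[of "V - A"] VW by (auto simp: set_integrable_def)
          show "integrable lborel (\<lambda>x. indicat_real (W - A) x *\<^sub>R \<bar>indicator (cbox a b) x * k x\<bar>)"
            using ik by (intro integrable_mult_indicator) auto
          show "- (indicat_real (V - A) x *\<^sub>R k x) \<le> indicat_real (W - A) x *\<^sub>R \<bar>indicator (cbox a b) x * k x\<bar>" for x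
            using VW by (auto split: split_indicator)
        qed
        also have "\<dots> = measure \<nu> (W - A)"
          by (simp add: measure_def emn set_lebesgue_integral_def Bochner_Integration.integral_nonneg)
        finally show ?thesis using V0 by simp
      qed
      finally show ?thesis using nWA by simp
    qed
    then have "(LINT x:A|lborel. k x) \<le> 0" by (rule field_le_epsilon) simp
    moreover have i: "integrable lborel (\<lambda>x. indicator A x *\<^sub>R k x)" using sub[OF Acb] by (simp add: set_integrable_def)
    moreover have nn: "0 \<le> indicator A x *\<^sub>R k x" for x by (auto simp: A_def split: split_indicator)
    ultimately have "(LINT x|lborel. indicator A x *\<^sub>R k x) = 0"
      using Bochner_Integration.integral_nonneg[of lborel "\<lambda>x. indicator A x *\<^sub>R k x"] by (auto simp: set_lebesgue_integral_def intro: antisym)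
    then have "AE x in lborel. indicator A x *\<^sub>R k x = 0"
      using integral_nonneg_eq_0_iff_AE[OF i] nn by auto
    then have "AE x in lborel. x \<in> U \<inter> box a b \<longrightarrow> k x \<le> 0"
      by eventually_elim (auto simp: A_def split: split_indicator_asm)
    then show ?thesis unfolding a_def b_def .
  qed
  have "AE x in lborel. \<forall>n. n \<ge> 1 \<longrightarrow> x \<in> U \<inter> box (- (real n *\<^sub>R One)) (real n *\<^sub>R One) \<longrightarrow> k x \<le> 0"
    using * by (auto simp: AE_all_countable)
  then show ?thesis
  proof eventually_elim
    fix x assume h: "\<forall>n. n \<ge> 1 \<longrightarrow> x \<in> U \<inter> box (- (real n *\<^sub>R One)) (real n *\<^sub>R One) \<longrightarrow> k x \<le> 0"
    show "x \<in> U \<longrightarrow> k x \<le> 0"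
    proof
      assume "x \<in> U"
      have "x \<in> (\<Union>n::nat. box (- (real n *\<^sub>R One)) (real n *\<^sub>R One))" unfolding UN_box_eq_UNIV by simp
      then obtain n :: nat where n: "x \<in> box (- (real n *\<^sub>R One)) (real n *\<^sub>R One)" by blast
      then have "n \<ge> 1" by (cases n) (auto simp: box_idem)
      then show "k x \<le> 0" using h n \<open>x \<in> U\<close> by blast
    qed
  qed
qed

section \<open>Affine substitution and Gaussian bounds\<close>

lemma integrable_affine_euclidean:
  fixes F :: "'a::euclidean_space \<Rightarrow> real"
  assumes "c \<noteq> 0" and [measurable]: "F \<in> borel_measurable borel"
  shows "integrable lborel (\<lambda>x. F (t + c *\<^sub>R x)) \<longleftrightarrow> integrable lborel F"
    and "(\<integral>x. F x \<partial>lborel) = \<bar>c\<bar> ^ DIM('a) * (\<integral>x. F (t + c *\<^sub>R x) \<partial>lborel)"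
proof -
  let ?T = "\<lambda>x. t + c *\<^sub>R x"
  have eq: "lborel = density (distr lborel borel ?T) (\<lambda>_. ennreal (\<bar>c\<bar>^DIM('a)))"
    by (rule lborel_affine[OF \<open>c \<noteq> 0\<close>])
  have "integrable lborel F \<longleftrightarrow> integrable (distr lborel borel ?T) (\<lambda>x. \<bar>c\<bar>^DIM('a) *\<^sub>R F x)"
    by (subst eq, rule integrable_density) auto
  also have "\<dots> \<longleftrightarrow> integrable lborel (\<lambda>x. \<bar>c\<bar>^DIM('a) *\<^sub>R F (?T x))"
    by (rule integrable_distr_eq) auto
  finally show "integrable lborel (\<lambda>x. F (?T x)) \<longleftrightarrow> integrable lborel F" using \<open>c \<noteq> 0\<close> by simp
  have "(\<integral>x. F x \<partial>lborel) = (\<integral>x. \<bar>c\<bar>^DIM('a) *\<^sub>R F x \<partial>(distr lborel borel ?T))"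
    by (subst eq, rule integral_density) auto
  also have "\<dots> = (\<integral>x. \<bar>c\<bar>^DIM('a) *\<^sub>R F (?T x) \<partial>lborel)" by (rule integral_distr) auto
  finally show "(\<integral>x. F x \<partial>lborel) = \<bar>c\<bar> ^ DIM('a) * (\<integral>x. F (?T x) \<partial>lborel)" by simp
qed

text \<open>Up to a constant, exp (-a |y|^2) is the product over the coordinates of centred normal
  densities of variance 1 / (2 a), each of integral 1.\<close>

lemma integrable_gaussian:
  fixes x :: "'a::euclidean_space"
  assumes "0 < a"
  shows "integrable lborel (\<lambda>y. exp (- a * (norm (x - y))\<^sup>2))"
proof -
  define \<sigma> where "\<sigma> = sqrt (1 / (2 * a))"
  have \<sigma>: "\<sigma> > 0" "2 * \<sigma>\<^sup>2 = 1 / a" using assms by (auto simp: \<sigma>_def)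
  let ?c = "1 / sqrt (2 * pi * \<sigma>\<^sup>2)"
  have "(\<integral>\<^sup>+(y::'a). (\<Prod>b\<in>Basis. ennreal (normal_density 0 \<sigma> (y \<bullet> b))) \<partial>lborel) = (\<Prod>b\<in>(Basis::'a set). (\<integral>\<^sup>+s. ennreal (normal_density 0 \<sigma> s) \<partial>lborel))"
    using nn_integral_lborel_prod[where f="\<lambda>(b::'a) s. ennreal (normal_density 0 \<sigma> s)"] by auto
  also have "\<dots> = 1"
    using \<sigma> by (subst nn_integral_eq_integral) auto
  finally have 1: "(\<integral>\<^sup>+(y::'a). (\<Prod>b\<in>Basis. ennreal (normal_density 0 \<sigma> (y \<bullet> b))) \<partial>lborel) = 1" .
  have 2: "(\<Prod>b\<in>Basis. normal_density 0 \<sigma> (y \<bullet> b)) = ?c ^ DIM('a) * exp (- a * (norm y)\<^sup>2)" for y :: 'a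
  proof -
    have "(\<Prod>b\<in>Basis. normal_density 0 \<sigma> (y \<bullet> b)) = ?c ^ DIM('a) * exp (\<Sum>b\<in>Basis. - (y \<bullet> b)\<^sup>2 / (2 * \<sigma>\<^sup>2))"
      by (simp only: normal_density_def prod.distrib prod_constant exp_sum[OF finite_Basis] diff_0_right)
    also have "(\<Sum>b\<in>Basis. - (y \<bullet> b)\<^sup>2 / (2 * \<sigma>\<^sup>2)) = - a * (norm y)\<^sup>2"
      unfolding \<sigma>(2) power2_norm_eq_inner euclidean_inner[of y y]
      by (simp add: sum_negf sum_distrib_left power2_eq_square mult.commute)
    finally show ?thesis .
  qed
  have "integrable lborel (\<lambda>y::'a. ?c ^ DIM('a) * exp (- a * (norm y)\<^sup>2))"
    unfolding 2[symmetric]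
  proof (rule integrableI_nonneg)
    show "(\<integral>\<^sup>+(y::'a). ennreal (\<Prod>b\<in>Basis. normal_density 0 \<sigma> (y \<bullet> b)) \<partial>lborel) < \<infinity>"
      using 1 by (subst prod_ennreal[symmetric]) (auto)
  qed (auto intro!: prod_nonneg)
  then have "integrable lborel (\<lambda>y::'a. exp (- a * (norm y)\<^sup>2))" using \<sigma> by simp
  then have "integrable lborel (\<lambda>y::'a. exp (- a * (norm (- x + 1 *\<^sub>R y))\<^sup>2))"
    by (subst integrable_affine_euclidean(1)[where F="\<lambda>y. exp (- a * (norm y)\<^sup>2)"]) auto
  then show ?thesis by (simp add: norm_minus_commute)
qed

text \<open>Half of the Gaussian exponent pays for the polynomial: the quotient tends to 0, so it is
  below 1 beyond some S, and before S the polynomial is at most its value at |S|.\<close>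

lemma poly_gauss_bound:
  assumes "0 < a"
  obtains C :: real where "C > 0" "\<And>s. 0 \<le> s \<Longrightarrow> (1 + s) ^ m * exp (- a * s\<^sup>2) \<le> C * exp (- (a/2) * s\<^sup>2)"
proof -
  have "((\<lambda>s. (1 + s) ^ m * exp (- (a/2) * s\<^sup>2)) \<longlongrightarrow> 0) at_top"
    using assms by real_asymp
  then have "eventually (\<lambda>s. (1 + s) ^ m * exp (- (a/2) * s\<^sup>2) < 1) at_top"
    by (rule order_tendstoD) simp
  then obtain S where S: "\<And>s. S \<le> s \<Longrightarrow> (1 + s) ^ m * exp (- (a/2) * s\<^sup>2) < 1"
    by (auto simp: eventually_at_top_linorder)
  define C where "C = 1 + (1 + \<bar>S\<bar>) ^ m"
  have "(1 + s) ^ m * exp (- (a/2) * s\<^sup>2) \<le> C" if "0 \<le> s" for s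
  proof (cases "S \<le> s")
    case True then show ?thesis using S[OF True] by (auto simp: C_def intro: order_trans[OF less_imp_le])
  next
    case False
    have "(1 + s) ^ m * exp (- (a/2) * s\<^sup>2) \<le> (1 + s) ^ m * 1" using that assms by (intro mult_left_mono) auto
    also have "\<dots> \<le> (1 + \<bar>S\<bar>) ^ m" using that False by (auto intro!: power_mono)
    finally show ?thesis by (simp add: C_def)
  qed
  then have "(1 + s) ^ m * exp (- a * s\<^sup>2) \<le> C * exp (- (a/2) * s\<^sup>2)" if "0 \<le> s" for s
  proof -
    have e: "exp (- a * s\<^sup>2) = exp (- (a/2) * s\<^sup>2) * exp (- (a/2) * s\<^sup>2)" by (simp add: exp_add[symmetric])
    show ?thesis unfolding e using mult_right_mono[OF \<open>\<And>s. 0 \<le> s \<Longrightarrow> _ s \<le> C\<close>[OF that], of "exp (- (a/2) * s\<^sup>2)"] by (simp add: mult_ac)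
  qed
  moreover have "C > 0" by (simp add: C_def add_pos_nonneg)
  ultimately show ?thesis using that by blast
qed

section \<open>Smooth functions of one variable and cutoffs\<close>

text \<open>The one-variable counterpart of \<open>C_k\<close>, so that the partial derivatives of a
  product of such functions can be followed factor by factor.\<close>

primrec Dk :: "nat \<Rightarrow> (real \<Rightarrow> real) \<Rightarrow> bool" where
  "Dk 0 g \<longleftrightarrow> continuous_on UNIV g"
| "Dk (Suc k) g \<longleftrightarrow> (\<forall>x. (g has_real_derivative deriv g x) (at x)) \<and> Dk k (deriv g)"

definition smooth :: "(real \<Rightarrow> real) \<Rightarrow> bool" where
  "smooth g \<longleftrightarrow> (\<forall>k. Dk k g)"

lemma Dk_SucI:
  assumes "\<And>x. (g has_real_derivative g' x) (at x)" "Dk k g'"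
  shows "Dk (Suc k) g"
proof -
  have "deriv g = g'" using DERIV_imp_deriv[OF assms(1)] by auto
  then show ?thesis using assms by simp
qed

lemma Dk_SucE: "Dk (Suc k) g \<Longrightarrow> \<exists>g'. (\<forall>x. (g has_real_derivative g' x) (at x)) \<and> Dk k g'"
  unfolding Dk.simps by blast

lemma Dk_mono: "Dk (Suc k) g \<Longrightarrow> Dk k g"
proof (induction k arbitrary: g)
  case 0
  then have "\<And>x. isCont g x" using DERIV_isCont by fastforce
  then show ?case by (simp add: continuous_at_imp_continuous_on)
qed (auto intro: Dk_SucI)

lemma Dk_const: "Dk k (\<lambda>_. c)"
proof (induction k arbitrary: c)
  case (Suc k) then show ?case by (intro Dk_SucI[where g'="\<lambda>_. 0"]) auto
qed simp

lemma Dk_add: "Dk k g \<Longrightarrow> Dk k h \<Longrightarrow> Dk k (\<lambda>x. g x + h x)"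
proof (induction k arbitrary: g h)
  case (Suc k)
  obtain g' where g': "\<And>x. (g has_real_derivative g' x) (at x)" "Dk k g'" using Dk_SucE[OF Suc.prems(1)] by blast
  obtain h' where h': "\<And>x. (h has_real_derivative h' x) (at x)" "Dk k h'" using Dk_SucE[OF Suc.prems(2)] by blast
  show ?case by (rule Dk_SucI[OF DERIV_add[OF g'(1) h'(1)]]) (rule Suc.IH[OF g'(2) h'(2)])
qed (auto intro: continuous_on_add)

lemma Dk_mult: "Dk k g \<Longrightarrow> Dk k h \<Longrightarrow> Dk k (\<lambda>x. g x * h x)"
proof (induction k arbitrary: g h)
  case (Suc k)
  obtain g' where g': "\<And>x. (g has_real_derivative g' x) (at x)" "Dk k g'" using Dk_SucE[OF Suc.prems(1)] by blast
  obtain h' where h': "\<And>x. (h has_real_derivative h' x) (at x)" "Dk k h'" using Dk_SucE[OF Suc.prems(2)] by blast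
  show ?case
    by (rule Dk_SucI[OF DERIV_mult[OF g'(1) h'(1)]])
      (intro Dk_add Suc.IH g'(2) h'(2) Dk_mono[OF Suc.prems(1)] Dk_mono[OF Suc.prems(2)])
qed (auto intro: continuous_on_mult)

lemma Dk_affine: "Dk k g \<Longrightarrow> Dk k (\<lambda>x. g (c * x + d))"
proof (induction k arbitrary: g)
  case 0 then show ?case
    by (auto intro!: continuous_on_compose2[where g=g and t=UNIV] continuous_intros)
next
  case (Suc k)
  obtain g' where g': "\<And>x. (g has_real_derivative g' x) (at x)" "Dk k g'" using Dk_SucE[OF Suc.prems(1)] by blast
  have "((\<lambda>x. g (c * x + d)) has_real_derivative g' (c * x + d) * c) (at x)" for x
    by (rule DERIV_chain2[OF g'(1)]) (auto intro!: derivative_eq_intros)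
  then show ?case by (rule Dk_SucI) (rule Dk_mult[OF Suc.IH[OF g'(2)] Dk_const])
qed

lemma smooth_Dk: "smooth g \<Longrightarrow> Dk k g" by (simp add: smooth_def)

lemma smoothI: "(\<And>x. (g has_real_derivative g' x) (at x)) \<Longrightarrow> smooth g' \<Longrightarrow> smooth g"
  unfolding smooth_def by (metis Dk_SucI Dk_mono)

lemma smooth_deriv: "smooth g \<Longrightarrow> smooth (deriv g)"
  unfolding smooth_def by (metis Dk.simps(2))

lemma smooth_DERIV: "smooth g \<Longrightarrow> (g has_real_derivative deriv g x) (at x)"
  unfolding smooth_def by (metis Dk.simps(2))

lemma smooth_continuous: "smooth g \<Longrightarrow> continuous_on UNIV g"
  unfolding smooth_def by (metis Dk.simps(1))

lemma smooth_const: "smooth (\<lambda>_. c)"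
  and smooth_mult: "smooth g \<Longrightarrow> smooth h \<Longrightarrow> smooth (\<lambda>x. g x * h x)"
  and smooth_affine: "smooth g \<Longrightarrow> smooth (\<lambda>x. g (c * x + d))"
  by (auto simp: smooth_def Dk_const Dk_mult Dk_affine)

lemma smooth_linear: "smooth (\<lambda>s. c * s + d)"
  by (rule smoothI[where g'="\<lambda>_. c"]) (auto intro!: derivative_eq_intros smooth_const)

lemma DERIV_gauss1: "((\<lambda>s. exp (- a * (s - c)\<^sup>2)) has_real_derivative (- 2 * a) * (s - c) * exp (- a * (s - c)\<^sup>2)) (at s)"
  by (auto intro!: derivative_eq_intros)

text \<open>The derivative is a linear polynomial times the function itself, so each order follows
  from the preceding one.\<close>

lemma smooth_gauss: "smooth (\<lambda>s::real. exp (- a * (s - c)\<^sup>2))"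
proof -
  have "Dk k (\<lambda>s::real. exp (- a * (s - c)\<^sup>2))" for k
  proof (induction k)
    case 0 show ?case by (auto intro!: continuous_intros)
  next
    case (Suc k)
    have "Dk k (\<lambda>s. (- 2 * a) * s + 2 * a * c)" using smooth_linear smooth_Dk by blast
    then have "Dk k (\<lambda>s. (- 2 * a) * (s - c))" by (simp add: algebra_simps)
    then show ?case by (intro Dk_SucI[OF DERIV_gauss1] Dk_mult[OF _ Suc.IH])
  qed
  then show ?thesis by (simp add: smooth_def)
qed

text \<open>For m = 0 this is the classical smooth function that is flat at 0. The powers of 1 / t
  are included because the family is then closed, up to linear combinations, under
  differentiation.\<close>

definition bump :: "nat \<Rightarrow> real \<Rightarrow> real" where
  "bump m t = (if t \<le> 0 then 0 else exp (- (1 / t)) / t ^ m)"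

lemma bump_nonneg: "0 \<le> bump m t" by (simp add: bump_def)

text \<open>With u = 1 / t this is u^m <= m! e^u, a single term of the exponential series.\<close>

lemma bump_le: "bump m t \<le> fact m"
proof (cases "t \<le> 0")
  case False
  define u where "u = 1 / t"
  have u: "u > 0" "bump m t = u ^ m * exp (- u)" using False by (auto simp: bump_def u_def power_one_over field_simps)
  have "u ^ m /\<^sub>R fact m \<le> exp u"
    unfolding exp_def using u(1)
    by (intro sum_le_suminf[of _ "{m}", simplified]) (auto intro: summable_exp simp: divide_inverse)
  then have "u ^ m \<le> fact m * exp u" by (simp add: field_simps)
  then have "u ^ m * exp (- u) \<le> fact m * exp u * exp (- u)" by (rule mult_right_mono) simp
  then show ?thesis unfolding u(2) by (simp add: mult.assoc exp_minus)
qed (simp add: bump_def)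

lemma bump_le_abs: "bump m t \<le> fact (Suc m) * \<bar>t\<bar>"
proof (cases "t \<le> 0")
  case True
  have "0 \<le> fact (Suc m) * \<bar>t\<bar>" by (intro mult_nonneg_nonneg) auto
  then show ?thesis using True by (simp only: bump_def if_True)
next
  case False
  then have "bump m t = bump (Suc m) t * t" by (simp add: bump_def)
  also have "\<dots> \<le> fact (Suc m) * t" using False bump_le[of "Suc m" t] by (intro mult_right_mono) auto
  finally show ?thesis using False by simp
qed

lemma bump_tendsto_0: "(bump m \<longlongrightarrow> 0) (at 0)"
proof (rule tendsto_sandwich[of "\<lambda>_. 0" _ _ "\<lambda>t. fact (Suc m) * \<bar>t\<bar>"])
  have "((\<lambda>t. fact (Suc m) * \<bar>t\<bar>) \<longlongrightarrow> fact (Suc m) * \<bar>0\<bar>) (at (0::real))" by (intro tendsto_intros)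
  then show "((\<lambda>t::real. fact (Suc m) * \<bar>t\<bar>) \<longlongrightarrow> 0) (at 0)" by simp
qed (use bump_nonneg bump_le_abs in auto)

text \<open>Away from 0 this is a computation; at 0 the difference quotient of \<open>bump m\<close>
  is \<open>bump (Suc m)\<close>, which tends to 0.\<close>

lemma DERIV_bump: "(bump m has_real_derivative bump (m + 2) t - real m * bump (Suc m) t) (at t)"
proof -
  consider "t < 0" | "t > 0" | "t = 0" by linarith
  then show ?thesis
  proof cases
    case 1
    have "((\<lambda>_. 0) has_real_derivative 0) (at t)" by simp
    then have "(bump m has_real_derivative 0) (at t)"
      by (rule has_field_derivative_transform_within_open[where S="{..<0}"]) (use 1 in \<open>auto simp: bump_def\<close>)
    then show ?thesis using 1 by (simp add: bump_def)
  next
    case 2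
    have "((\<lambda>t. exp (- (1 / t)) * inverse t ^ m) has_real_derivative
       exp (- (1 / t)) * (1 / t\<^sup>2) * inverse t ^ m + (real m * inverse t ^ (m - 1) * (- (1 / t\<^sup>2))) * exp (- (1 / t))) (at t)"
    proof (rule DERIV_mult)
      show "((\<lambda>t. exp (- (1 / t))) has_real_derivative exp (- (1 / t)) * (1 / t\<^sup>2)) (at t)"
        using 2 by (auto intro!: derivative_eq_intros simp: power2_eq_square)
      have "((\<lambda>t. inverse t ^ m) has_real_derivative real m * (- (inverse t ^ Suc (Suc 0)) * inverse t ^ (m - Suc 0))) (at t)"
        using 2 by (intro DERIV_power DERIV_inverse) auto
      then show "((\<lambda>t. inverse t ^ m) has_real_derivative real m * inverse t ^ (m - 1) * (- (1 / t\<^sup>2))) (at t)"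
        by (simp add: power2_eq_square divide_inverse mult_ac)
    qed
    also have "exp (- (1 / t)) * (1 / t\<^sup>2) * inverse t ^ m + (real m * inverse t ^ (m - 1) * (- (1 / t\<^sup>2))) * exp (- (1 / t))
      = bump (m + 2) t - real m * bump (Suc m) t"
    proof -
      have "real m * inverse t ^ (m - 1) * (1 / t\<^sup>2) = real m / t ^ Suc m"
        using 2 by (cases m) (auto simp: power_inverse divide_inverse power2_eq_square)
      then show ?thesis using 2 by (simp add: bump_def power_inverse divide_inverse power2_eq_square mult_ac)
    qed
    finally show ?thesis
      by (rule has_field_derivative_transform_within_open[where S="{0<..}"])
        (use 2 in \<open>auto simp: bump_def divide_inverse power_inverse\<close>)
  next
    case 3
    have "((\<lambda>h. bump m h / h) \<longlongrightarrow> 0) (at 0)"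
    proof (rule Lim_transform_eventually[OF bump_tendsto_0[of "Suc m"]])
      show "\<forall>\<^sub>F x in at 0. bump (Suc m) x = bump m x / x"
        by (auto simp: bump_def)
    qed
    then show ?thesis using 3 by (simp add: DERIV_def bump_def[of _ 0])
  qed
qed

text \<open>The induction on the order runs over all m at once, because the derivative involves two
  other members of the family.\<close>

lemma smooth_bump: "smooth (bump m)"
proof -
  have "\<forall>m. Dk k (bump m)" for k
  proof (induction k)
    case 0 show ?case using DERIV_bump DERIV_isCont continuous_at_imp_continuous_on by (metis Dk.simps(1))
  next
    case (Suc k)
    have "Dk k (\<lambda>t. bump (m + 2) t + (- real m) * bump (Suc m) t)" for m
      using Suc by (intro Dk_add Dk_mult Dk_const) auto
    then show ?case by (intro allI Dk_SucI[OF DERIV_bump]) simp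
  qed
  then show ?thesis by (simp add: smooth_def)
qed

lemma bump0_le_1: "bump 0 t \<le> 1" using bump_le[of 0] by simp

lemma bump_scaled_tendsto: "(\<lambda>n. bump 0 (real n * t)) \<longlonglongrightarrow> (if t > 0 then 1 else 0)"
proof (cases "t > 0")
  case True
  have "(\<lambda>n. exp (- (1 / (real n * t)))) \<longlonglongrightarrow> exp (- 0)"
    using True by real_asymp
  then have "(\<lambda>n. exp (- (1 / (real n * t)))) \<longlonglongrightarrow> 1" by simp
  moreover have "\<forall>\<^sub>F n in sequentially. exp (- (1 / (real n * t))) = bump 0 (real n * t)"
    using eventually_gt_at_top[of "0::nat"] True by (auto elim!: eventually_mono simp: bump_def mult_le_0_iff)
  ultimately have "(\<lambda>n. bump 0 (real n * t)) \<longlonglongrightarrow> 1" by (rule Lim_transform_eventually)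
  then show ?thesis using True by simp
next
  case False
  then have "bump 0 (real n * t) = 0" for n by (auto simp: bump_def mult_le_0_iff zero_less_mult_iff not_le)
  then show ?thesis using False by simp
qed

section \<open>Products of functions of one variable\<close>

text \<open>The factor in direction b is a function of its own, so that differentiating along b just
  updates \<open>g\<close> at b and yields a product of the same form.\<close>

definition Phi :: "('a::euclidean_space \<Rightarrow> real \<Rightarrow> real) \<Rightarrow> 'a \<Rightarrow> real" where
  "Phi g x = (\<Prod>b\<in>Basis. g b (x \<bullet> b))"

lemma has_derivative_Phi:
  fixes g :: "'a::euclidean_space \<Rightarrow> real \<Rightarrow> real"
  assumes "\<And>b. b \<in> Basis \<Longrightarrow> (g b has_real_derivative g' b (x \<bullet> b)) (at (x \<bullet> b))"
  shows "(Phi g has_derivative (\<lambda>h. \<Sum>b\<in>Basis. (h \<bullet> b) * Phi (g(b := g' b)) x)) (at x)"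
proof -
  have "((\<lambda>x. \<Prod>b\<in>Basis. g b (x \<bullet> b)) has_derivative
     (\<lambda>h. \<Sum>b\<in>Basis. (g' b (x \<bullet> b) * (h \<bullet> b)) * (\<Prod>j\<in>Basis - {b}. g j (x \<bullet> j)))) (at x)"
  proof (rule has_derivative_prod)
    fix b :: 'a assume "b \<in> Basis"
    have "((\<lambda>x. g b (x \<bullet> b)) has_derivative (\<lambda>h. (h \<bullet> b) * g' b (x \<bullet> b))) (at x)"
      by (rule has_derivative_compose[of "\<lambda>x. x \<bullet> b" "\<lambda>h. h \<bullet> b" x UNIV "g b" "\<lambda>h. h * g' b (x \<bullet> b)"])
        (use assms[OF \<open>b \<in> Basis\<close>] in \<open>auto intro!: derivative_eq_intros simp: has_field_derivative_def mult_commute_abs\<close>)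
    then show "((\<lambda>x. g b (x \<bullet> b)) has_derivative (\<lambda>h. g' b (x \<bullet> b) * (h \<bullet> b))) (at x)"
      by (simp add: mult.commute)
  qed
  moreover have "(g' b (x \<bullet> b) * (h \<bullet> b)) * (\<Prod>j\<in>Basis - {b}. g j (x \<bullet> j)) = (h \<bullet> b) * Phi (g(b := g' b)) x"
    if "b \<in> Basis" for b h
  proof -
    have "Phi (g(b := g' b)) x = g' b (x \<bullet> b) * (\<Prod>j\<in>Basis - {b}. (g(b := g' b)) j (x \<bullet> j))"
      unfolding Phi_def using that by (subst prod.remove[of _ b]) auto
    also have "(\<Prod>j\<in>Basis - {b}. (g(b := g' b)) j (x \<bullet> j)) = (\<Prod>j\<in>Basis - {b}. g j (x \<bullet> j))"
      by (rule prod.cong) auto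
    finally show ?thesis by (simp only: mult_ac)
  qed
  ultimately show ?thesis unfolding Phi_def[abs_def] by (simp cong: sum.cong)
qed

lemma frechet_derivative_Phi:
  fixes g :: "'a::euclidean_space \<Rightarrow> real \<Rightarrow> real"
  assumes g: "\<And>b. b \<in> Basis \<Longrightarrow> smooth (g b)" and b: "b \<in> Basis"
  shows "frechet_derivative (Phi g) (at x) b = Phi (g(b := deriv (g b))) x"
proof -
  have "(Phi g has_derivative (\<lambda>h. \<Sum>b\<in>Basis. (h \<bullet> b) * Phi (g(b := deriv (g b))) x)) (at x)"
    using has_derivative_Phi[where g'="\<lambda>b. deriv (g b)"] smooth_DERIV[OF g] by blast
  then have "frechet_derivative (Phi g) (at x) = (\<lambda>h. \<Sum>b\<in>Basis. (h \<bullet> b) * Phi (g(b := deriv (g b))) x)"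
    by (rule frechet_derivative_at[symmetric])
  then have "frechet_derivative (Phi g) (at x) b = (\<Sum>j\<in>Basis. (b \<bullet> j) * Phi (g(j := deriv (g j))) x)" by simp
  also have "\<dots> = (\<Sum>j\<in>Basis. if j = b then Phi (g(j := deriv (g j))) x else 0)"
    by (rule sum.cong) (use b in \<open>auto simp: inner_Basis\<close>)
  finally show ?thesis using b by simp
qed

lemma C_k_Phi:
  fixes g :: "'a::euclidean_space \<Rightarrow> real \<Rightarrow> real"
  assumes "\<And>b. b \<in> Basis \<Longrightarrow> smooth (g b)"
  shows "C_k k (Phi g)"
  using assms
proof (induction k arbitrary: g)
  case 0
  have "continuous_on UNIV (\<lambda>x. g b (x \<bullet> b))" if "b \<in> Basis" for b
    by (rule continuous_on_compose2[OF smooth_continuous[OF 0[OF that]]]) (auto intro!: continuous_intros)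
  then show ?case by (auto simp: Phi_def[abs_def] intro!: continuous_on_prod)
next
  case (Suc k)
  have "Phi g differentiable_on UNIV"
    unfolding differentiable_on_def differentiable_def
    using has_derivative_Phi[where g'="\<lambda>b. deriv (g b)"] smooth_DERIV[OF Suc.prems] by blast
  moreover have "C_k k (\<lambda>x. frechet_derivative (Phi g) (at x) b)" if "b \<in> Basis" for b
  proof -
    have "C_k k (Phi (g(b := deriv (g b))))" using Suc.prems smooth_deriv by (intro Suc.IH) auto
    then show ?thesis using frechet_derivative_Phi[OF Suc.prems that] by simp
  qed
  ultimately show ?case by simp
qed

lemma test_function_Phi:
  fixes g :: "'a::euclidean_space \<Rightarrow> real \<Rightarrow> real"
  assumes "\<And>b. b \<in> Basis \<Longrightarrow> smooth (g b)" "\<And>b s. b \<in> Basis \<Longrightarrow> R < \<bar>s\<bar> \<Longrightarrow> g b s = 0"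
  shows "test_function (Phi g)"
proof -
  have "{x. Phi g x \<noteq> 0} \<subseteq> cbox (- R *\<^sub>R One) (R *\<^sub>R One)"
  proof
    fix x assume "x \<in> {x. Phi g x \<noteq> 0}"
    then have "\<bar>x \<bullet> b\<bar> \<le> R" if "b \<in> Basis" for b
      using assms(2)[OF that, of "x \<bullet> b"] that by (force simp: Phi_def)
    then show "x \<in> cbox (- R *\<^sub>R One) (R *\<^sub>R One)" by (auto simp: mem_box abs_le_iff minus_le_iff)
  qed
  then have "bounded {x. Phi g x \<noteq> 0}" using bounded_cbox bounded_subset by blast
  then show ?thesis using C_k_Phi[OF assms(1)] by (auto simp: test_function_def compact_closure)
qed

section \<open>Test functions and weak gradients\<close>

definition grad :: "('a::euclidean_space \<Rightarrow> real) \<Rightarrow> 'a \<Rightarrow> 'a" where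
  "grad \<phi> x = (\<Sum>b\<in>Basis. frechet_derivative \<phi> (at x) b *\<^sub>R b)"

lemma grad_inner: "b \<in> Basis \<Longrightarrow> grad \<phi> x \<bullet> b = frechet_derivative \<phi> (at x) b"
  by (simp add: grad_def inner_sum_left inner_Basis if_distrib cong: if_cong)

lemma test_function_support:
  assumes "test_function \<phi>"
  obtains R where "0 < R" "\<And>x. R < norm x \<Longrightarrow> \<phi> x = 0"
proof -
  have "bounded (closure {x. \<phi> x \<noteq> 0})" using assms by (auto simp: test_function_def compact_imp_bounded)
  then obtain R where "R > 0" "\<And>x. x \<in> closure {x. \<phi> x \<noteq> 0} \<Longrightarrow> norm x \<le> R" by (auto simp: bounded_pos)
  then show ?thesis using that[of R] closure_subset by (metis (mono_tags, lifting) mem_Collect_eq not_le subsetD)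
qed

lemma test_function_differentiable: "test_function \<phi> \<Longrightarrow> \<phi> differentiable at x"
proof -
  assume "test_function \<phi>"
  then have "C_k (Suc 0) \<phi>" unfolding test_function_def by blast
  then show ?thesis by (simp add: differentiable_on_def)
qed

lemma test_function_continuous: "test_function \<phi> \<Longrightarrow> continuous_on UNIV \<phi>"
  by (simp add: continuous_at_imp_continuous_on differentiable_imp_continuous_within test_function_differentiable)

lemma test_function_partial_continuous:
  "test_function \<phi> \<Longrightarrow> b \<in> Basis \<Longrightarrow> continuous_on UNIV (\<lambda>x. frechet_derivative \<phi> (at x) b)"
proof -
  assume "test_function \<phi>" "b \<in> Basis"
  then have "C_k (Suc 0) \<phi>" unfolding test_function_def by blast
  then show ?thesis using \<open>b \<in> Basis\<close> by simp
qed

lemma frechet_derivative_outside: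
  fixes \<phi> :: "'a::euclidean_space \<Rightarrow> real"
  assumes "\<And>x. R < norm x \<Longrightarrow> \<phi> x = 0" "R < norm x"
  shows "frechet_derivative \<phi> (at x) = (\<lambda>_. 0)"
proof -
  have "open {x::'a. R < norm x}" by (intro open_Collect_less continuous_intros)
  have "(\<phi> has_derivative (\<lambda>_. 0)) (at x)"
    by (rule has_derivative_transform_within_open[OF has_derivative_const \<open>open {x::'a. R < norm x}\<close>])
      (use assms in auto)
  then show ?thesis by (rule frechet_derivative_at[symmetric])
qed

lemma grad_continuous: "test_function \<phi> \<Longrightarrow> continuous_on UNIV (grad \<phi>)"
  unfolding grad_def[abs_def] by (intro continuous_on_sum continuous_on_scaleR test_function_partial_continuous) auto

lemma grad_outside:
  fixes \<phi> :: "'a::euclidean_space \<Rightarrow> real"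
  assumes "\<And>x. R < norm x \<Longrightarrow> \<phi> x = 0" "R < norm x"
  shows "grad \<phi> x = 0"
  using frechet_derivative_outside[OF assms] by (simp add: grad_def)

lemma continuous_measurable_lebesgue:
  fixes g :: "'a::euclidean_space \<Rightarrow> 'b::euclidean_space"
  assumes "continuous_on UNIV g" shows "g \<in> borel_measurable lebesgue"
proof -
  have "g \<in> borel_measurable lborel" using assms by (simp add: borel_measurable_continuous_onI)
  then show ?thesis by (rule measurable_completion)
qed

lemma continuous_bounded_on_cball:
  fixes g :: "'a::euclidean_space \<Rightarrow> real"
  assumes "continuous_on UNIV g"
  obtains B where "\<And>x. norm x \<le> R \<Longrightarrow> \<bar>g x\<bar> \<le> B"
proof -
  have "compact (g ` cball 0 R)" using assms by (intro compact_continuous_image) (auto intro: continuous_on_subset)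
  then have "bounded (g ` cball 0 R)" by (rule compact_imp_bounded)
  then obtain B where "\<forall>y\<in>g ` cball 0 R. norm y \<le> B" unfolding bounded_iff by blast
  then show ?thesis by (intro that[of B]) auto
qed

lemma set_integrable_lebesgue_bounded:
  assumes "continuous_on UNIV (g::'a::euclidean_space \<Rightarrow> 'b::euclidean_space)" "compact K"
  shows "set_integrable lebesgue K g"
proof -
  have [measurable]: "g \<in> borel_measurable borel" using assms by (simp add: borel_measurable_continuous_onI)
  have "K \<in> sets borel" using assms(2) by (simp add: borel_compact)
  have "integrable lborel (\<lambda>x. indicator K x *\<^sub>R g x)"
    using borel_integrable_compact[OF assms(2), of g] assms(1) continuous_on_subset
    by (auto simp: set_integrable_def)
  moreover have "(\<lambda>x. indicator K x *\<^sub>R g x) \<in> borel_measurable lborel"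
    using \<open>K \<in> sets borel\<close> by simp
  ultimately show ?thesis by (simp add: set_integrable_def integrable_completion)
qed

lemma locally_integrable_continuous:
  "continuous_on UNIV (g::'a::euclidean_space \<Rightarrow> 'b::euclidean_space) \<Longrightarrow> locally_integrable g"
  unfolding locally_integrable_def
  by (auto intro: set_integrable_lebesgue_bounded continuous_measurable_lebesgue)

lemma locally_integrable_mult:
  fixes u :: "'a::euclidean_space \<Rightarrow> real"
  assumes "locally_integrable u" "continuous_on UNIV \<psi>" "\<And>x. R < norm x \<Longrightarrow> \<psi> x = (0::real)"
  shows "integrable lebesgue (\<lambda>x. u x * \<psi> x)"
proof -
  have [measurable]: "u \<in> borel_measurable lebesgue" "\<psi> \<in> borel_measurable lebesgue"
    using assms(1) continuous_measurable_lebesgue[OF assms(2)] by (auto simp: locally_integrable_def)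
  obtain B where B: "\<And>x. norm x \<le> R \<Longrightarrow> \<bar>\<psi> x\<bar> \<le> B"
    using continuous_bounded_on_cball[OF assms(2)] by blast
  have i: "integrable lebesgue (\<lambda>x. indicator (cball 0 R) x *\<^sub>R u x)"
    using assms(1) by (auto simp: locally_integrable_def set_integrable_def)
  show ?thesis
  proof (rule Bochner_Integration.integrable_bound[OF integrable_mult_left[OF i, of B]])
    show "AE x in lebesgue. norm (u x * \<psi> x) \<le> norm ((indicator (cball 0 R) x *\<^sub>R u x) * B)"
    proof (rule AE_I2)
      fix x
      show "norm (u x * \<psi> x) \<le> norm ((indicator (cball 0 R) x *\<^sub>R u x) * B)"
      proof (cases "norm x \<le> R")
        case True then show ?thesis using B[OF True] by (auto simp: abs_mult intro!: mult_left_mono)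
      qed (use assms(3) in auto)
    qed
  qed simp
qed

lemma locally_integrable_inner:
  "locally_integrable (G :: 'a::euclidean_space \<Rightarrow> 'a) \<Longrightarrow> locally_integrable (\<lambda>x. G x \<bullet> b)"
  unfolding locally_integrable_def
proof (intro conjI allI impI; elim conjE)
  fix K :: "'a set" assume "compact K" "\<forall>K. compact K \<longrightarrow> set_integrable lebesgue K G"
  then have "integrable lebesgue (\<lambda>x. (indicator K x *\<^sub>R G x) \<bullet> b)"
    unfolding set_integrable_def by (intro integrable_inner_left) auto
  then show "set_integrable lebesgue K (\<lambda>x. G x \<bullet> b)" by (simp add: set_integrable_def)
qed simp

lemma locally_integrable_add:
  fixes u w :: "'a::euclidean_space \<Rightarrow> 'b::euclidean_space"
  assumes "locally_integrable u" "locally_integrable w"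
  shows "locally_integrable (\<lambda>x. u x + t *\<^sub>R w x)"
  unfolding locally_integrable_def
proof (intro conjI allI impI)
  show "(\<lambda>x. u x + t *\<^sub>R w x) \<in> borel_measurable lebesgue"
    using assms by (auto simp: locally_integrable_def intro!: borel_measurable_add borel_measurable_scaleR)
  fix K :: "'a set" assume "compact K"
  then have "integrable lebesgue (\<lambda>x. indicator K x *\<^sub>R u x)" "integrable lebesgue (\<lambda>x. indicator K x *\<^sub>R w x)"
    using assms by (auto simp: locally_integrable_def set_integrable_def)
  then have "integrable lebesgue (\<lambda>x. indicator K x *\<^sub>R u x + t *\<^sub>R (indicator K x *\<^sub>R w x))"
    by (intro Bochner_Integration.integrable_add integrable_scaleR_right)
  then show "set_integrable lebesgue K (\<lambda>x. u x + t *\<^sub>R w x)"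
    by (simp add: set_integrable_def algebra_simps)
qed

lemma has_weak_gradient_add:
  fixes u w :: "'a::euclidean_space \<Rightarrow> real"
  assumes u: "has_weak_gradient u G" and w: "has_weak_gradient w W"
  shows "has_weak_gradient (\<lambda>x. u x + t * w x) (\<lambda>x. G x + t *\<^sub>R W x)"
  unfolding has_weak_gradient_def
proof (intro conjI allI impI ballI)
  show "locally_integrable (\<lambda>x. u x + t * w x)" "locally_integrable (\<lambda>x. G x + t *\<^sub>R W x)"
    using locally_integrable_add[of u w t] locally_integrable_add[of G W t] u w by (auto simp: has_weak_gradient_def)
  fix \<phi> :: "'a \<Rightarrow> real" and b :: 'a assume \<phi>: "test_function \<phi>" and b: "b \<in> Basis"
  obtain R where R: "\<And>x. R < norm x \<Longrightarrow> \<phi> x = 0" using test_function_support[OF \<phi>] by metis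
  have dR: "R < norm x \<Longrightarrow> frechet_derivative \<phi> (at x) b = 0" for x using frechet_derivative_outside[where \<phi>=\<phi> and R=R, OF R] by simp
  have i: "integrable lebesgue (\<lambda>x. u x * frechet_derivative \<phi> (at x) b)" "integrable lebesgue (\<lambda>x. w x * frechet_derivative \<phi> (at x) b)"
     "integrable lebesgue (\<lambda>x. (G x \<bullet> b) * \<phi> x)" "integrable lebesgue (\<lambda>x. (W x \<bullet> b) * \<phi> x)"
    using u w unfolding has_weak_gradient_def
    by (intro locally_integrable_mult[OF _ test_function_partial_continuous[OF \<phi> b], of _ R]
        locally_integrable_mult[OF _ test_function_continuous[OF \<phi>], of _ R] locally_integrable_inner; simp add: dR R)+
  have "(LINT x|lebesgue. (u x + t * w x) * frechet_derivative \<phi> (at x) b)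
    = (LINT x|lebesgue. u x * frechet_derivative \<phi> (at x) b + t * (w x * frechet_derivative \<phi> (at x) b))"
    by (simp add: algebra_simps)
  also have "\<dots> = (LINT x|lebesgue. u x * frechet_derivative \<phi> (at x) b) + t * (LINT x|lebesgue. w x * frechet_derivative \<phi> (at x) b)"
    using i by simp
  also have "\<dots> = - (LINT x|lebesgue. (G x \<bullet> b) * \<phi> x) - t * (LINT x|lebesgue. (W x \<bullet> b) * \<phi> x)"
    using u w \<phi> b by (simp add: has_weak_gradient_def)
  also have "\<dots> = - (LINT x|lebesgue. (G x \<bullet> b) * \<phi> x + t * ((W x \<bullet> b) * \<phi> x))"
    using i by simp
  finally show "(LINT x|lebesgue. (u x + t * w x) * frechet_derivative \<phi> (at x) b)
    = - (LINT x|lebesgue. ((G x + t *\<^sub>R W x) \<bullet> b) * \<phi> x)"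
    by (simp add: algebra_simps inner_add_left)
qed

text \<open>By translation invariance the integral of F(x + t b) does not depend on t, and its
  derivative at t = 0, taken under the integral sign, is the integral of the partial derivative.
  Only |t| < 1 matters, so the dominating function may be supported in the ball of radius R +
  1.\<close>

lemma integral_partial_zero:
  fixes F :: "'a::euclidean_space \<Rightarrow> real"
  assumes d: "\<And>x. F differentiable at x" and b: "b \<in> Basis"
    and c: "continuous_on UNIV (\<lambda>x. frechet_derivative F (at x) b)"
    and R: "\<And>x. R < norm x \<Longrightarrow> F x = 0"
  shows "(LINT x|lborel. frechet_derivative F (at x) b) = 0"
proof -
  let ?D = "\<lambda>x. frechet_derivative F (at x) b"
  have cF: "continuous_on UNIV F" by (simp add: continuous_at_imp_continuous_on d differentiable_imp_continuous_within)
  have [measurable]: "F \<in> borel_measurable borel" "?D \<in> borel_measurable borel"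
    using c cF by (auto intro: borel_measurable_continuous_onI)
  obtain B where B: "\<And>x. norm x \<le> R \<Longrightarrow> \<bar>?D x\<bar> \<le> B"
    using continuous_bounded_on_cball[OF c] by blast
  have D0: "?D x = 0" if "R < norm x" for x using frechet_derivative_outside[where \<phi>=F and R=R, OF R that] by simp
  have B': "\<bar>?D x\<bar> \<le> \<bar>B\<bar>" for x using B[of x] D0[of x] by (cases "norm x \<le> R") auto
  have nb: "norm b = 1" using b by simp
  have "((\<lambda>t. \<integral>x. F (x + t *\<^sub>R b) \<partial>lborel) has_real_derivative (\<integral>x. ?D (x + 0 *\<^sub>R b) \<partial>lborel)) (at 0)"
  proof (rule has_real_derivative_integral[where \<delta>=1 and D="\<lambda>x. \<bar>B\<bar> * indicator (cball 0 (R + 1)) x"])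
    fix s :: real and x :: 'a assume s: "\<bar>s - 0\<bar> < 1"
    have "(F has_derivative frechet_derivative F (at (x + s *\<^sub>R b))) (at (x + s *\<^sub>R b))"
      using d frechet_derivative_works by blast
    then have "((\<lambda>t. F (x + t *\<^sub>R b)) has_derivative (\<lambda>h. frechet_derivative F (at (x + s *\<^sub>R b)) (h *\<^sub>R b))) (at s)"
      by (rule has_derivative_compose[rotated]) (auto intro!: derivative_eq_intros)
    moreover have "linear (frechet_derivative F (at (x + s *\<^sub>R b)))"
      using d by (rule linear_frechet_derivative)
    ultimately show "((\<lambda>t. F (x + t *\<^sub>R b)) has_real_derivative ?D (x + s *\<^sub>R b)) (at s)"
      by (simp add: has_field_derivative_def linear_cmul mult_commute_abs)
    show "\<bar>?D (x + s *\<^sub>R b)\<bar> \<le> \<bar>B\<bar> * indicator (cball 0 (R + 1)) x"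
    proof (cases "norm x \<le> R + 1")
      case False
      have "norm x \<le> norm (x + s *\<^sub>R b) + norm (s *\<^sub>R b)" by (metis add_diff_cancel_right' norm_triangle_ineq4)
      then have "R < norm (x + s *\<^sub>R b)" using False s nb by simp
      then show ?thesis using D0 by simp
    qed (use B' in simp)
  next
    show "integrable lborel (\<lambda>x. F (x + 0 *\<^sub>R b))"
    proof -
      have "set_integrable lborel (cball 0 R) F"
        using borel_integrable_compact[of "cball 0 R" F] cF by (auto simp: set_integrable_def intro: continuous_on_subset)
      moreover have "(\<lambda>x. indicator (cball 0 R) x *\<^sub>R F x) = F"
      proof
        fix x show "indicator (cball 0 R) x *\<^sub>R F x = F x" by (cases "norm x \<le> R") (auto simp: R)
      qed
      ultimately show ?thesis by (simp add: set_integrable_def)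
    qed
    show "integrable lborel (\<lambda>x. \<bar>B\<bar> * indicat_real (cball 0 (R + 1)) x)"
      using emeasure_lborel_cball_finite[of 0 "R + 1"] by (intro integrable_mult_right) (simp add: integrable_indicator_iff)
  qed auto
  moreover have "(\<integral>x. F (x + t *\<^sub>R b) \<partial>lborel) = (\<integral>x. F x \<partial>lborel)" for t
    using integrable_affine_euclidean(2)[of 1 F "t *\<^sub>R b"] by (simp add: add.commute)
  ultimately have "((\<lambda>t. \<integral>x. F x \<partial>lborel) has_real_derivative (\<integral>x. ?D x \<partial>lborel)) (at 0)" by simp
  then show ?thesis by (rule DERIV_unique[OF _ DERIV_const])
qed

text \<open>Integration by parts: the partial derivative of the product of two test functions
  integrates to 0.\<close>

lemma has_weak_gradient_test_function:
  fixes \<phi> :: "'a::euclidean_space \<Rightarrow> real"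
  assumes \<phi>: "test_function \<phi>"
  shows "has_weak_gradient \<phi> (grad \<phi>)"
  unfolding has_weak_gradient_def
proof (intro conjI allI impI ballI)
  show "locally_integrable \<phi>" "locally_integrable (grad \<phi>)"
    by (auto intro: locally_integrable_continuous test_function_continuous grad_continuous \<phi>)
  fix \<psi> :: "'a \<Rightarrow> real" and b :: 'a assume \<psi>: "test_function \<psi>" and b: "b \<in> Basis"
  let ?d\<phi> = "\<lambda>x. frechet_derivative \<phi> (at x) b" and ?d\<psi> = "\<lambda>x. frechet_derivative \<psi> (at x) b"
  obtain R where R: "\<And>x. R < norm x \<Longrightarrow> \<psi> x = 0" using test_function_support[OF \<psi>] by metis
  have dR: "R < norm x \<Longrightarrow> ?d\<psi> x = 0" for x using frechet_derivative_outside[where \<phi>=\<psi> and R=R, OF R] by simp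
  note cont = test_function_continuous[OF \<phi>] test_function_continuous[OF \<psi>]
    test_function_partial_continuous[OF \<phi> b] test_function_partial_continuous[OF \<psi> b]
  note d = test_function_differentiable[OF \<phi>] test_function_differentiable[OF \<psi>]
  have dd: "((\<lambda>x. \<phi> x * \<psi> x) has_derivative (\<lambda>h. \<phi> x * frechet_derivative \<psi> (at x) h + frechet_derivative \<phi> (at x) h * \<psi> x)) (at x)" for x
    using d by (intro has_derivative_mult) (auto simp: frechet_derivative_works[symmetric])
  then have fd: "frechet_derivative (\<lambda>x. \<phi> x * \<psi> x) (at x) b = \<phi> x * ?d\<psi> x + ?d\<phi> x * \<psi> x" for x
    using fun_cong[OF frechet_derivative_at[symmetric, OF dd[of x]], of b] by simp
  have "(LINT x|lborel. frechet_derivative (\<lambda>x. \<phi> x * \<psi> x) (at x) b) = 0"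
  proof (rule integral_partial_zero[OF _ b, where R=R])
    show "(\<lambda>x. \<phi> x * \<psi> x) differentiable at x" for x by (rule differentiableI[OF dd])
    show "continuous_on UNIV (\<lambda>x. frechet_derivative (\<lambda>x. \<phi> x * \<psi> x) (at x) b)"
      unfolding fd by (intro continuous_intros cont)
  qed (use R in auto)
  moreover have "(\<lambda>x. \<phi> x * ?d\<psi> x + ?d\<phi> x * \<psi> x) \<in> borel_measurable lborel"
    by (simp, intro borel_measurable_continuous_onI continuous_intros cont)
  ultimately have "(LINT x|lebesgue. \<phi> x * ?d\<psi> x + ?d\<phi> x * \<psi> x) = 0"
    unfolding fd by (simp add: integral_completion)
  moreover have "integrable lebesgue (\<lambda>x. \<phi> x * ?d\<psi> x)" "integrable lebesgue (\<lambda>x. ?d\<phi> x * \<psi> x)"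
    by (intro locally_integrable_mult[OF locally_integrable_continuous, where R=R] cont dR R; assumption)+
  ultimately have "(LINT x|lebesgue. \<phi> x * ?d\<psi> x) + (LINT x|lebesgue. ?d\<phi> x * \<psi> x) = 0" by simp
  then show "(LINT x|lebesgue. \<phi> x * ?d\<psi> x) = - (LINT x|lebesgue. (grad \<phi> x \<bullet> b) * \<psi> x)"
    using b by (simp add: grad_inner)
qed

text \<open>The fundamental lemma of the calculus of variations. Products of bumps converge
  boundedly to the indicator of an open box, so all box integrals of k vanish; the sign criterion
  for box integrals then applies to k and to -k.\<close>

lemma integral_test_zero_imp_AE_zero:
  fixes k :: "'a::euclidean_space \<Rightarrow> real"
  assumes k: "locally_integrable k" and z: "\<And>\<phi>. test_function \<phi> \<Longrightarrow> (LINT x|lebesgue. k x * \<phi> x) = 0"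
  shows "AE x in lebesgue. k x = 0"
proof -
  obtain k' where k'[measurable]: "k' \<in> borel_measurable lborel" and ae: "AE x in lborel. k x = k' x"
    using completion_ex_borel_measurable_real[of k lborel] k by (auto simp: locally_integrable_def)
  have ae': "AE x in lebesgue. k x = k' x" using ae by (rule AE_completion)
  have km[measurable]: "k \<in> borel_measurable lebesgue" and k'm: "k' \<in> borel_measurable lebesgue"
    using k by (auto simp: locally_integrable_def measurable_completion)
  have int: "set_integrable lborel (cbox a b) k'" for a b
  proof -
    have "integrable lebesgue (\<lambda>x. indicator (cbox a b) x *\<^sub>R k x)"
      using k by (auto simp: locally_integrable_def set_integrable_def)
    then have "integrable lebesgue (\<lambda>x. indicator (cbox a b) x *\<^sub>R k' x)"
    proof (rule integrable_cong_AE_imp)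
      have "(\<lambda>x. indicator (cbox a b) x *\<^sub>R k' x) \<in> borel_measurable lborel" by simp
      then show "(\<lambda>x. indicator (cbox a b) x *\<^sub>R k' x) \<in> borel_measurable lebesgue" by (rule measurable_completion)
      show "AE x in lebesgue. indicator (cbox a b) x *\<^sub>R k x = indicator (cbox a b) x *\<^sub>R k' x"
        using ae' by eventually_elim simp
    qed
    then show ?thesis by (simp add: set_integrable_def integrable_completion)
  qed
  have box0: "(LINT x:box l u|lborel. k' x) = 0" for l u :: 'a
  proof -
    \<comment> \<open>Scaling by n makes each bump tend to the indicator of the half line where its
      argument is positive, while the support stays within the box.\<close>
    define g where "g n b s = bump 0 (real n * s + (- real n * (l \<bullet> b))) * bump 0 ((- real n) * s + real n * (u \<bullet> b))" for n :: nat and b s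
    have gs: "smooth (g n b)" for n b
      unfolding g_def[abs_def] by (intro smooth_mult smooth_affine smooth_bump)
    have g0: "0 \<le> g n b s" "g n b s \<le> 1" for n b s
      unfolding g_def using bump_nonneg bump0_le_1 by (auto intro!: mult_le_one)
    have gz: "g n b s = 0" if "\<not> (l \<bullet> b < s \<and> s < u \<bullet> b)" for n b s
    proof -
      have "real n * s + (- real n * (l \<bullet> b)) \<le> 0 \<or> (- real n) * s + real n * (u \<bullet> b) \<le> 0"
        using that by (auto simp: not_less intro: mult_left_mono)
      then show ?thesis by (auto simp: g_def bump_def)
    qed
    have tf: "test_function (Phi (g n))" for n
    proof (rule test_function_Phi[where R="norm l + norm u"])
      fix b :: 'a and s assume b: "b \<in> Basis" "norm l + norm u < \<bar>s\<bar>"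
      have "\<bar>l \<bullet> b\<bar> \<le> norm l" "\<bar>u \<bullet> b\<bar> \<le> norm u" using b Basis_le_norm by auto
      then show "g n b s = 0" using b by (intro gz) auto
    qed (rule gs)
    have lim: "(\<lambda>n. Phi (g n) x) \<longlonglongrightarrow> indicator (box l u) x" for x
    proof -
      have "(\<lambda>n. g n b (x \<bullet> b)) \<longlonglongrightarrow> (if l \<bullet> b < x \<bullet> b \<and> x \<bullet> b < u \<bullet> b then 1 else 0)" for b
      proof -
        have "(\<lambda>n. bump 0 (real n * (x \<bullet> b - l \<bullet> b)) * bump 0 (real n * (u \<bullet> b - x \<bullet> b))) \<longlonglongrightarrow>
           (if x \<bullet> b - l \<bullet> b > 0 then 1 else 0) * (if u \<bullet> b - x \<bullet> b > 0 then 1 else 0)"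
          by (intro tendsto_mult bump_scaled_tendsto)
        then show ?thesis by (simp add: g_def algebra_simps split: if_splits)
      qed
      then have "(\<lambda>n. Phi (g n) x) \<longlonglongrightarrow> (\<Prod>b\<in>Basis. if l \<bullet> b < x \<bullet> b \<and> x \<bullet> b < u \<bullet> b then 1 else 0)"
        unfolding Phi_def by (intro tendsto_prod)
      also have "(\<Prod>b\<in>Basis. if l \<bullet> b < x \<bullet> b \<and> x \<bullet> b < u \<bullet> b then 1 else 0) = indicat_real (box l u) x"
        by (auto simp: indicator_def mem_box intro!: prod.neutral prod_zero)
      finally show ?thesis .
    qed
    have bd: "\<bar>Phi (g n) x\<bar> \<le> indicator (cbox l u) x" for n x
    proof (cases "x \<in> cbox l u")
      case True
      have "0 \<le> Phi (g n) x" "Phi (g n) x \<le> 1" unfolding Phi_def using g0 by (auto intro!: prod_nonneg prod_le_1)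
      then show ?thesis using True by simp
    next
      case False
      then obtain b where "b \<in> Basis" "\<not> (l \<bullet> b < x \<bullet> b \<and> x \<bullet> b < u \<bullet> b)" by (auto simp: mem_box intro: less_imp_le)
      then have "Phi (g n) x = 0" unfolding Phi_def using gz by (intro prod_zero) auto
      then show ?thesis by simp
    qed
    have zero: "(LINT x|lborel. k' x * Phi (g n) x) = 0" for n
    proof -
      have [measurable]: "Phi (g n) \<in> borel_measurable borel"
        using test_function_continuous[OF tf] by (rule borel_measurable_continuous_onI)
      have "0 = (LINT x|lebesgue. k x * Phi (g n) x)" using z[OF tf] by simp
      also have "\<dots> = (LINT x|lebesgue. k' x * Phi (g n) x)"
      proof (rule integral_cong_AE)
        have m: "Phi (g n) \<in> borel_measurable lebesgue" using test_function_continuous[OF tf] by (rule continuous_measurable_lebesgue)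
        show "(\<lambda>x. k x * Phi (g n) x) \<in> borel_measurable lebesgue" "(\<lambda>x. k' x * Phi (g n) x) \<in> borel_measurable lebesgue"
          using borel_measurable_times[OF km m] borel_measurable_times[OF k'm m] by auto
        show "AE x in lebesgue. k x * Phi (g n) x = k' x * Phi (g n) x"
          using ae' by eventually_elim simp
      qed
      also have "\<dots> = (LINT x|lborel. k' x * Phi (g n) x)" by (rule integral_completion) simp
      finally show ?thesis by simp
    qed
    have "(\<lambda>n. LINT x|lborel. k' x * Phi (g n) x) \<longlonglongrightarrow> (LINT x|lborel. indicator (box l u) x *\<^sub>R k' x)"
    proof (rule integral_dominated_convergence[where w="\<lambda>x. \<bar>indicator (cbox l u) x *\<^sub>R k' x\<bar>"])
      show "integrable lborel (\<lambda>x. \<bar>indicat_real (cbox l u) x *\<^sub>R k' x\<bar>)"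
        using int[of l u] by (intro integrable_abs) (simp add: set_integrable_def)
      show "AE x in lborel. (\<lambda>n. k' x * Phi (g n) x) \<longlonglongrightarrow> indicator (box l u) x *\<^sub>R k' x"
        using tendsto_mult[OF tendsto_const lim] by (auto simp: mult.commute)
      show "AE x in lborel. norm (k' x * Phi (g n) x) \<le> \<bar>indicator (cbox l u) x *\<^sub>R k' x\<bar>" for n
        using mult_left_mono[OF bd abs_ge_zero] by (auto simp: abs_mult mult.commute)
      show "(\<lambda>x. k' x * Phi (g n) x) \<in> borel_measurable lborel" for n
        using test_function_continuous[OF tf[of n]] by (auto intro!: borel_measurable_times dest: borel_measurable_continuous_onI)
    qed auto
    then show ?thesis unfolding zero by (simp add: LIMSEQ_const_iff set_lebesgue_integral_def)
  qed
  have "AE x in lborel. x \<in> UNIV \<longrightarrow> k' x \<le> 0"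
    by (rule AE_le_zero_of_box_integrals) (use int box0 k' in auto)
  moreover have "AE x in lborel. x \<in> UNIV \<longrightarrow> - k' x \<le> 0"
    by (rule AE_le_zero_of_box_integrals) (use int box0 k' in \<open>auto simp: set_integrable_def set_lebesgue_integral_def\<close>)
  ultimately have "AE x in lborel. k' x = 0" by eventually_elim simp
  then have "AE x in lebesgue. k' x = 0" by (rule AE_completion)
  with ae' show ?thesis by eventually_elim simp
qed

text \<open>\<open>weak_gradient\<close> is a choice; computations with the energy and with the norm
  of H replace it, up to a null set, by an explicit gradient.\<close>

lemma weak_gradient_unique:
  fixes u :: "'a::euclidean_space \<Rightarrow> real"
  assumes "has_weak_gradient u G" "has_weak_gradient u G'"
  shows "AE x in lebesgue. G x = G' x"
proof -
  have "AE x in lebesgue. (G x + (-1) *\<^sub>R G' x) \<bullet> b = 0" if b: "b \<in> Basis" for b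
  proof (rule integral_test_zero_imp_AE_zero)
    have l: "locally_integrable G" "locally_integrable G'" using assms by (auto simp: has_weak_gradient_def)
    then show "locally_integrable (\<lambda>x. (G x + (-1) *\<^sub>R G' x) \<bullet> b)"
      by (intro locally_integrable_inner locally_integrable_add)
    fix \<phi> :: "'a \<Rightarrow> real" assume \<phi>: "test_function \<phi>"
    obtain R where R: "\<And>x. R < norm x \<Longrightarrow> \<phi> x = 0" using test_function_support[OF \<phi>] by metis
    have i: "integrable lebesgue (\<lambda>x. (G x \<bullet> b) * \<phi> x)" "integrable lebesgue (\<lambda>x. (G' x \<bullet> b) * \<phi> x)"
      using l by (auto intro!: locally_integrable_mult[where R=R] locally_integrable_inner test_function_continuous \<phi> R)
    have "(LINT x|lebesgue. ((G x + (-1) *\<^sub>R G' x) \<bullet> b) * \<phi> x) = (LINT x|lebesgue. (G x \<bullet> b) * \<phi> x - (G' x \<bullet> b) * \<phi> x)"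
      by (simp add: algebra_simps inner_diff_left)
    also have "\<dots> = (LINT x|lebesgue. (G x \<bullet> b) * \<phi> x) - (LINT x|lebesgue. (G' x \<bullet> b) * \<phi> x)" using i by simp
    also have "\<dots> = 0"
    proof -
      have "- (LINT x|lebesgue. (G x \<bullet> b) * \<phi> x) = - (LINT x|lebesgue. (G' x \<bullet> b) * \<phi> x)"
        using assms \<phi> b unfolding has_weak_gradient_def by metis
      then show ?thesis by simp
    qed
    finally show "(LINT x|lebesgue. ((G x + (-1) *\<^sub>R G' x) \<bullet> b) * \<phi> x) = 0" .
  qed
  then have "AE x in lebesgue. \<forall>b\<in>Basis. (G x + (-1) *\<^sub>R G' x) \<bullet> b = 0"
    by (subst AE_finite_all) auto
  then show ?thesis
  proof eventually_elim
    case (elim x)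
    show ?case by (rule euclidean_eqI) (use elim in \<open>simp add: inner_diff_left\<close>)
  qed
qed

lemma has_weak_gradient_weak_gradient: "has_weak_gradient u G \<Longrightarrow> has_weak_gradient u (weak_gradient u)"
  unfolding weak_gradient_def by (rule someI[where P="has_weak_gradient u"])

section \<open>The Euler-Lagrange equation\<close>

text \<open>The right-hand side of the equation: it says that the Laplacian of v at x is
  \<open>dual_h f \<omega> x (v x)\<close>.\<close>

definition dual_h :: "(real \<Rightarrow> real) \<Rightarrow> real \<Rightarrow> 'a::euclidean_space \<Rightarrow> real \<Rightarrow> real" where
  "dual_h f \<omega> x t = ((norm x)\<^sup>2 - \<omega>) * dual_p f t + dual_q f t"

text \<open>One statement for both potential terms of the energy: F = f^2 with weight |x|^2 -
  \<omega> and c = 2, and F = f^4 with weight 1 and c = 4. There c F' is the derivative of F, and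
  the growth bounds make every integral finite in terms of weighted squares of v and \<phi>.\<close>

lemma energy_term_expansion:
  fixes v \<phi> w :: "'b \<Rightarrow> real" and F F' :: "real \<Rightarrow> real"
  assumes [measurable]: "v \<in> borel_measurable M" "\<phi> \<in> borel_measurable M" "w \<in> borel_measurable M"
      "F \<in> borel_measurable borel" "F' \<in> borel_measurable borel"
    and F: "\<And>s. \<bar>F s\<bar> \<le> c * s\<^sup>2" and F': "\<And>s. \<bar>F' s\<bar> \<le> \<bar>s\<bar>"
    and T: "\<And>s h. \<bar>F (s + h) - F s - c * F' s * h\<bar> \<le> c * h\<^sup>2"
    and iv: "integrable M (\<lambda>x. \<bar>w x\<bar> * (v x)\<^sup>2)" and i\<phi>: "integrable M (\<lambda>x. \<bar>w x\<bar> * (\<phi> x)\<^sup>2)"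
    and c: "0 \<le> c"
  shows "\<bar>(\<integral>x. w x * F (v x + t * \<phi> x) \<partial>M) - (\<integral>x. w x * F (v x) \<partial>M) - t * (c * (\<integral>x. w x * F' (v x) * \<phi> x \<partial>M))\<bar>
     \<le> t\<^sup>2 * (c * (\<integral>x. \<bar>w x\<bar> * (\<phi> x)\<^sup>2 \<partial>M))"
    and "integrable M (\<lambda>x. w x * F' (v x) * \<phi> x)"
proof -
  have i1: "integrable M (\<lambda>x. w x * F (v x + s * \<phi> x))" for s
  proof (rule Bochner_Integration.integrable_bound)
    show "integrable M (\<lambda>x. c * (2 * (\<bar>w x\<bar> * (v x)\<^sup>2) + 2 * s\<^sup>2 * (\<bar>w x\<bar> * (\<phi> x)\<^sup>2)))"
      using iv i\<phi> by (intro integrable_mult_right Bochner_Integration.integrable_add)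
    show "AE x in M. norm (w x * F (v x + s * \<phi> x)) \<le> norm (c * (2 * (\<bar>w x\<bar> * (v x)\<^sup>2) + 2 * s\<^sup>2 * (\<bar>w x\<bar> * (\<phi> x)\<^sup>2)))"
    proof (rule AE_I2)
      fix x
      have "(v x + s * \<phi> x)\<^sup>2 \<le> 2 * (v x)\<^sup>2 + 2 * s\<^sup>2 * (\<phi> x)\<^sup>2"
        using sum_squares_bound[of "v x" "s * \<phi> x"] by (simp add: power2_sum power_mult_distrib)
      then have "\<bar>F (v x + s * \<phi> x)\<bar> \<le> c * (2 * (v x)\<^sup>2 + 2 * s\<^sup>2 * (\<phi> x)\<^sup>2)"
        using order_trans[OF F mult_left_mono[OF _ c]] by blast
      then have "\<bar>w x\<bar> * \<bar>F (v x + s * \<phi> x)\<bar> \<le> \<bar>w x\<bar> * (c * (2 * (v x)\<^sup>2 + 2 * s\<^sup>2 * (\<phi> x)\<^sup>2))"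
        by (rule mult_left_mono) simp
      also have "\<dots> \<le> \<bar>c * (2 * (\<bar>w x\<bar> * (v x)\<^sup>2) + 2 * s\<^sup>2 * (\<bar>w x\<bar> * (\<phi> x)\<^sup>2))\<bar>"
        by (rule order_trans[OF eq_refl abs_ge_self]) (simp add: algebra_simps)
      finally show "norm (w x * F (v x + s * \<phi> x)) \<le> norm (c * (2 * (\<bar>w x\<bar> * (v x)\<^sup>2) + 2 * s\<^sup>2 * (\<bar>w x\<bar> * (\<phi> x)\<^sup>2)))"
        by (simp add: abs_mult)
    qed
  qed simp
  show i2: "integrable M (\<lambda>x. w x * F' (v x) * \<phi> x)"
  proof (rule Bochner_Integration.integrable_bound)
    show "integrable M (\<lambda>x. \<bar>w x\<bar> * (v x)\<^sup>2 + \<bar>w x\<bar> * (\<phi> x)\<^sup>2)"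
      using iv i\<phi> by (intro Bochner_Integration.integrable_add)
    show "AE x in M. norm (w x * F' (v x) * \<phi> x) \<le> norm (\<bar>w x\<bar> * (v x)\<^sup>2 + \<bar>w x\<bar> * (\<phi> x)\<^sup>2)"
    proof (rule AE_I2)
      fix x
      have "\<bar>F' (v x)\<bar> * \<bar>\<phi> x\<bar> \<le> \<bar>v x\<bar> * \<bar>\<phi> x\<bar>" using F' by (rule mult_right_mono) simp
      also have "\<dots> \<le> (v x)\<^sup>2 + (\<phi> x)\<^sup>2"
      proof -
        have "0 \<le> \<bar>v x\<bar> * \<bar>\<phi> x\<bar>" by simp
        then show ?thesis using sum_squares_bound[of "\<bar>v x\<bar>" "\<bar>\<phi> x\<bar>"] unfolding power2_abs by linarith
      qed
      finally have "\<bar>w x\<bar> * (\<bar>F' (v x)\<bar> * \<bar>\<phi> x\<bar>) \<le> \<bar>w x\<bar> * ((v x)\<^sup>2 + (\<phi> x)\<^sup>2)" by (rule mult_left_mono) simp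
      then show "norm (w x * F' (v x) * \<phi> x) \<le> norm (\<bar>w x\<bar> * (v x)\<^sup>2 + \<bar>w x\<bar> * (\<phi> x)\<^sup>2)"
        by (simp add: abs_mult distrib_left mult.assoc)
    qed
  qed simp
  let ?D = "\<lambda>x. w x * F (v x + t * \<phi> x) - w x * F (v x) - t * (c * (w x * F' (v x) * \<phi> x))"
  have i3: "integrable M (\<lambda>x. w x * F (v x))" using i1[of 0] by simp
  have iD: "integrable M ?D" using i1[of t] i2 i3 by (intro Bochner_Integration.integrable_diff integrable_mult_right)
  have "(\<integral>x. w x * F (v x + t * \<phi> x) \<partial>M) - (\<integral>x. w x * F (v x) \<partial>M) - t * (c * (\<integral>x. w x * F' (v x) * \<phi> x \<partial>M)) = (\<integral>x. ?D x \<partial>M)"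
    using i1[of t] i2 i3 by simp
  also have "\<bar>\<dots>\<bar> \<le> (\<integral>x. t\<^sup>2 * (c * (\<bar>w x\<bar> * (\<phi> x)\<^sup>2)) \<partial>M)"
  proof (rule order_trans[OF integral_abs_bound integral_mono])
    show "integrable M (\<lambda>x. \<bar>?D x\<bar>)" using iD by (rule integrable_abs)
    show "integrable M (\<lambda>x. t\<^sup>2 * (c * (\<bar>w x\<bar> * (\<phi> x)\<^sup>2)))" using i\<phi> by (intro integrable_mult_right)
    fix x
    have "?D x = w x * (F (v x + t * \<phi> x) - F (v x) - c * F' (v x) * (t * \<phi> x))" by (simp add: algebra_simps)
    then have "\<bar>?D x\<bar> = \<bar>w x\<bar> * \<bar>F (v x + t * \<phi> x) - F (v x) - c * F' (v x) * (t * \<phi> x)\<bar>" by (simp only: abs_mult)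
    also have "\<dots> \<le> \<bar>w x\<bar> * (c * (t * \<phi> x)\<^sup>2)" by (rule mult_left_mono[OF T]) simp
    finally show "\<bar>?D x\<bar> \<le> t\<^sup>2 * (c * (\<bar>w x\<bar> * (\<phi> x)\<^sup>2))" by (simp add: power_mult_distrib mult_ac)
  qed
  also have "\<dots> = t\<^sup>2 * (c * (\<integral>x. \<bar>w x\<bar> * (\<phi> x)\<^sup>2 \<partial>M))" by simp
  finally show "\<bar>(\<integral>x. w x * F (v x + t * \<phi> x) \<partial>M) - (\<integral>x. w x * F (v x) \<partial>M) - t * (c * (\<integral>x. w x * F' (v x) * \<phi> x \<partial>M))\<bar>
     \<le> t\<^sup>2 * (c * (\<integral>x. \<bar>w x\<bar> * (\<phi> x)\<^sup>2 \<partial>M))" .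
qed

lemma integrable_continuous_compact_support:
  fixes \<psi> :: "'a::euclidean_space \<Rightarrow> real"
  assumes "continuous_on UNIV \<psi>" "\<And>x. R < norm x \<Longrightarrow> \<psi> x = 0"
  shows "integrable lebesgue \<psi>"
  using locally_integrable_mult[OF locally_integrable_continuous[of "\<lambda>_. 1::real"] assms] by simp

text \<open>Along a test function the energy is affine up to a remainder C t^2. Criticality then
  bounds the first-order coefficient L by |t L| <= \<epsilon> t W + C t^2 for small t > 0, so L
  vanishes.\<close>

lemma critical_point_imp_weak_equation:
  fixes v \<phi> :: "'a::euclidean_space \<Rightarrow> real"
  assumes dc: "dual_change f" and v: "solves_semilinear f \<omega> v" and \<phi>: "test_function \<phi>"
  shows "(LINT x|lebesgue. weak_gradient v x \<bullet> grad \<phi> x) + (LINT x|lebesgue. dual_h f \<omega> x (v x) * \<phi> x) = 0"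
    and "has_weak_gradient v (weak_gradient v)"
proof -
  have vH: "v \<in> H" and crit: "\<And>\<epsilon>. \<epsilon> > 0 \<Longrightarrow> \<exists>\<delta>>0. \<forall>\<phi>\<in>H. norm_H \<phi> < \<delta> \<longrightarrow>
      \<bar>energy f \<omega> (\<lambda>x. v x + \<phi> x) - energy f \<omega> v\<bar> \<le> \<epsilon> * norm_H \<phi>"
    using v by (auto simp: solves_semilinear_def critical_point_H_def)
  obtain G where G: "has_weak_gradient v G" "square_integrable G"
    and v2: "v \<in> borel_measurable lebesgue" "integrable lebesgue (\<lambda>x. (v x)\<^sup>2)"
    and vx: "integrable lebesgue (\<lambda>x. (v x)\<^sup>2 * (norm x)\<^sup>2)"
    using vH by (auto simp: H_def H1_def square_integrable_def)
  define G0 where "G0 = weak_gradient v"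
  show G0: "has_weak_gradient v (weak_gradient v)" by (rule has_weak_gradient_weak_gradient[OF G(1)])
  then have G0': "has_weak_gradient v G0" by (simp add: G0_def)
  have aeG: "AE x in lebesgue. G x = G0 x" using weak_gradient_unique[OF G(1) G0'] .
  have [measurable]: "G0 \<in> borel_measurable lebesgue" "G \<in> borel_measurable lebesgue"
    using G0' G by (auto simp: has_weak_gradient_def locally_integrable_def)
  have iG0: "integrable lebesgue (\<lambda>x. (norm (G0 x))\<^sup>2)"
  proof (rule integrable_cong_AE_imp)
    show "integrable lebesgue (\<lambda>x. (norm (G x))\<^sup>2)" using G by (simp add: square_integrable_def)
    show "AE x in lebesgue. (norm (G x))\<^sup>2 = (norm (G0 x))\<^sup>2" using aeG by eventually_elim simp
  qed simp
  obtain R where R: "\<And>x. R < norm x \<Longrightarrow> \<phi> x = 0" using test_function_support[OF \<phi>] by metis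
  note c\<phi> = test_function_continuous[OF \<phi>] and cg = grad_continuous[OF \<phi>]
  have m\<phi>[measurable]: "\<phi> \<in> borel_measurable lebesgue" "grad \<phi> \<in> borel_measurable lebesgue"
    using continuous_measurable_lebesgue[OF c\<phi>] continuous_measurable_lebesgue[OF cg] by auto
  have gR: "grad \<phi> x = 0" if "R < norm x" for x using grad_outside[where \<phi>=\<phi> and R=R, OF R that] .
  have i\<phi>: "integrable lebesgue (\<lambda>x. (norm (grad \<phi> x))\<^sup>2)" "integrable lebesgue (\<lambda>x. (\<phi> x)\<^sup>2)"
     "integrable lebesgue (\<lambda>x. (\<phi> x)\<^sup>2 * (norm x)\<^sup>2)"
    by (rule integrable_continuous_compact_support[where R=R]; use R gR in \<open>auto intro!: continuous_intros c\<phi> cg\<close>)+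
  have iG\<phi>: "integrable lebesgue (\<lambda>x. G0 x \<bullet> grad \<phi> x)"
  proof (rule Bochner_Integration.integrable_bound[OF Bochner_Integration.integrable_add[OF iG0 i\<phi>(1)]])
    show "AE x in lebesgue. norm (G0 x \<bullet> grad \<phi> x) \<le> norm ((norm (G0 x))\<^sup>2 + (norm (grad \<phi> x))\<^sup>2)"
    proof (rule AE_I2)
      fix x :: 'a
      have "\<bar>G0 x \<bullet> grad \<phi> x\<bar> \<le> norm (G0 x) * norm (grad \<phi> x)" by (rule Cauchy_Schwarz_ineq2)
      also have "\<dots> \<le> (norm (G0 x))\<^sup>2 + (norm (grad \<phi> x))\<^sup>2"
      proof -
        have "0 \<le> norm (G0 x) * norm (grad \<phi> x)" by simp
        then show ?thesis using sum_squares_bound[of "norm (G0 x)" "norm (grad \<phi> x)"] by linarith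
      qed
      finally show "norm (G0 x \<bullet> grad \<phi> x) \<le> norm ((norm (G0 x))\<^sup>2 + (norm (grad \<phi> x))\<^sup>2)" by simp
    qed
  qed (intro borel_measurable_inner m\<phi> \<open>G0 \<in> borel_measurable lebesgue\<close>)
  have w\<phi>: "has_weak_gradient \<phi> (grad \<phi>)" by (rule has_weak_gradient_test_function[OF \<phi>])
  \<comment> \<open>The multiple t \<phi> is written as \<phi> + (t - 1) \<phi>, an instance of
    additivity.\<close>
  have wt: "has_weak_gradient (\<lambda>x. t * \<phi> x) (\<lambda>x. t *\<^sub>R grad \<phi> x)" for t
    using has_weak_gradient_add[OF w\<phi> w\<phi>, of "t - 1"] by (simp add: algebra_simps)
  have mx[measurable]: "(\<lambda>x. norm x) \<in> borel_measurable (lebesgue :: 'a measure)"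
    by (rule continuous_measurable_lebesgue) (intro continuous_intros)
  have mi: "(\<lambda>x. G0 x \<bullet> grad \<phi> x) \<in> borel_measurable lebesgue" using iG\<phi> by simp
  have mn0: "(\<lambda>x. norm (G0 x)) \<in> borel_measurable lebesgue" "(\<lambda>x. norm (grad \<phi> x)) \<in> borel_measurable lebesgue"
    by (rule measurable_compose[OF _ borel_measurable_norm]; fact)+
  \<comment> \<open>The norm of \<phi> in H, computed with the classical gradient; the norm of t
    \<phi> will be |t| W.\<close>
  define W where "W = sqrt (LINT x|lebesgue. (norm (grad \<phi> x))\<^sup>2 + (\<phi> x)\<^sup>2 * (norm x)\<^sup>2)"
  have W0: "0 \<le> W" unfolding W_def by (auto intro!: Bochner_Integration.integral_nonneg)
  have tH: "(\<lambda>x. t * \<phi> x) \<in> H" for t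
    unfolding H_def H1_def square_integrable_def
    by (intro CollectI conjI exI[of _ "\<lambda>x. t *\<^sub>R grad \<phi> x"] wt) (simp_all add: power_mult_distrib i\<phi> mult.assoc)
  have nH: "norm_H (\<lambda>x. t * \<phi> x) = \<bar>t\<bar> * W" for t
  proof -
    have ae: "AE x in lebesgue. weak_gradient (\<lambda>x. t * \<phi> x) x = t *\<^sub>R grad \<phi> x"
      by (rule weak_gradient_unique[OF has_weak_gradient_weak_gradient[OF wt] wt])
    have mw: "weak_gradient (\<lambda>x. t * \<phi> x) \<in> borel_measurable lebesgue"
      using has_weak_gradient_weak_gradient[OF wt[of t]] by (auto simp: has_weak_gradient_def locally_integrable_def)
    have mnw: "(\<lambda>x. norm (weak_gradient (\<lambda>x. t * \<phi> x) x)) \<in> borel_measurable lebesgue"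
      by (rule measurable_compose[OF mw borel_measurable_norm])
    have "(LINT x|lebesgue. (norm (weak_gradient (\<lambda>x. t * \<phi> x) x))\<^sup>2 + (t * \<phi> x)\<^sup>2 * (norm x)\<^sup>2)
      = (LINT x|lebesgue. t\<^sup>2 * ((norm (grad \<phi> x))\<^sup>2 + (\<phi> x)\<^sup>2 * (norm x)\<^sup>2))"
    proof (rule integral_cong_AE)
      show "AE x in lebesgue. (norm (weak_gradient (\<lambda>x. t * \<phi> x) x))\<^sup>2 + (t * \<phi> x)\<^sup>2 * (norm x)\<^sup>2
        = t\<^sup>2 * ((norm (grad \<phi> x))\<^sup>2 + (\<phi> x)\<^sup>2 * (norm x)\<^sup>2)"
        using ae by eventually_elim (simp add: power_mult_distrib algebra_simps)
    qed (intro borel_measurable_add borel_measurable_times borel_measurable_power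
        borel_measurable_const mx m\<phi> mi mnw mn0 \<open>G0 \<in> borel_measurable lebesgue\<close>)+
    then show ?thesis by (simp add: norm_H_def W_def real_sqrt_mult)
  qed
  define L1 where "L1 = (LINT x|lebesgue. G0 x \<bullet> grad \<phi> x)"
  define L2 where "L2 = (LINT x|lebesgue. ((norm x)\<^sup>2 - \<omega>) * dual_p f (v x) * \<phi> x)"
  define L3 where "L3 = (LINT x|lebesgue. 1 * dual_q f (v x) * \<phi> x)"
  define C1 where "C1 = (LINT x|lebesgue. (norm (grad \<phi> x))\<^sup>2)"
  define C2 where "C2 = (LINT x|lebesgue. \<bar>(norm x)\<^sup>2 - \<omega>\<bar> * (\<phi> x)\<^sup>2)"
  define C3 where "C3 = (LINT x|lebesgue. \<bar>1\<bar> * (\<phi> x)\<^sup>2)"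
  have e1: "(LINT x|lebesgue. (norm (weak_gradient (\<lambda>x. v x + t * \<phi> x) x))\<^sup>2)
     = (LINT x|lebesgue. (norm (weak_gradient v x))\<^sup>2) + 2 * t * L1 + t\<^sup>2 * C1" for t
  proof -
    have w: "has_weak_gradient (\<lambda>x. v x + t * \<phi> x) (\<lambda>x. G0 x + t *\<^sub>R grad \<phi> x)"
      by (rule has_weak_gradient_add[OF G0' w\<phi>])
    have ae: "AE x in lebesgue. weak_gradient (\<lambda>x. v x + t * \<phi> x) x = G0 x + t *\<^sub>R grad \<phi> x"
      by (rule weak_gradient_unique[OF has_weak_gradient_weak_gradient[OF w] w])
    have mw: "weak_gradient (\<lambda>x. v x + t * \<phi> x) \<in> borel_measurable lebesgue"
      using has_weak_gradient_weak_gradient[OF w] by (auto simp: has_weak_gradient_def locally_integrable_def)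
    have mnw: "(\<lambda>x. norm (weak_gradient (\<lambda>x. v x + t * \<phi> x) x)) \<in> borel_measurable lebesgue"
      by (rule measurable_compose[OF mw borel_measurable_norm])
    have "(LINT x|lebesgue. (norm (weak_gradient (\<lambda>x. v x + t * \<phi> x) x))\<^sup>2)
      = (LINT x|lebesgue. (norm (G0 x))\<^sup>2 + 2 * t * (G0 x \<bullet> grad \<phi> x) + t\<^sup>2 * (norm (grad \<phi> x))\<^sup>2)"
    proof (rule integral_cong_AE)
      show "AE x in lebesgue. (norm (weak_gradient (\<lambda>x. v x + t * \<phi> x) x))\<^sup>2
        = (norm (G0 x))\<^sup>2 + 2 * t * (G0 x \<bullet> grad \<phi> x) + t\<^sup>2 * (norm (grad \<phi> x))\<^sup>2"
        using ae
      proof eventually_elim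
        case (elim x)
        show ?case unfolding elim power2_norm_eq_inner
          by (simp add: inner_add_left inner_add_right inner_commute power2_eq_square algebra_simps)
      qed
    qed (intro borel_measurable_add borel_measurable_times borel_measurable_power
        borel_measurable_const mx m\<phi> mi mnw mn0 \<open>G0 \<in> borel_measurable lebesgue\<close>)+
    also have "\<dots> = (LINT x|lebesgue. (norm (G0 x))\<^sup>2) + 2 * t * L1 + t\<^sup>2 * C1"
      unfolding L1_def C1_def using iG0 iG\<phi> i\<phi>(1) by simp
    finally show ?thesis by (simp add: G0_def)
  qed
  have mn: "(\<lambda>x. (norm x)\<^sup>2 - \<omega>) \<in> borel_measurable (lebesgue :: 'a measure)"
    by (rule continuous_measurable_lebesgue) (intro continuous_intros)
  have weight: "integrable lebesgue (\<lambda>x. \<bar>(norm x)\<^sup>2 - \<omega>\<bar> * (u x)\<^sup>2)"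
    if "u \<in> borel_measurable lebesgue" "integrable lebesgue (\<lambda>x. (u x)\<^sup>2)" "integrable lebesgue (\<lambda>x. (u x)\<^sup>2 * (norm x)\<^sup>2)" for u :: "'a \<Rightarrow> real"
  proof (rule Bochner_Integration.integrable_bound)
    show "integrable lebesgue (\<lambda>x. (u x)\<^sup>2 * (norm x)\<^sup>2 + \<bar>\<omega>\<bar> * (u x)\<^sup>2)"
      using that by (intro Bochner_Integration.integrable_add integrable_mult_right)
    show "AE x in lebesgue. norm (\<bar>(norm x)\<^sup>2 - \<omega>\<bar> * (u x)\<^sup>2) \<le> norm ((u x)\<^sup>2 * (norm x)\<^sup>2 + \<bar>\<omega>\<bar> * (u x)\<^sup>2)"
    proof (rule AE_I2)
      fix x :: 'a
      have "\<bar>(norm x)\<^sup>2 - \<omega>\<bar> * (u x)\<^sup>2 \<le> ((norm x)\<^sup>2 + \<bar>\<omega>\<bar>) * (u x)\<^sup>2"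
        using zero_le_power2[of "norm x"] by (intro mult_right_mono) (arith, simp)
      then show "norm (\<bar>(norm x)\<^sup>2 - \<omega>\<bar> * (u x)\<^sup>2) \<le> norm ((u x)\<^sup>2 * (norm x)\<^sup>2 + \<bar>\<omega>\<bar> * (u x)\<^sup>2)"
        by (simp add: algebra_simps)
    qed
    show "(\<lambda>x. \<bar>(norm x)\<^sup>2 - \<omega>\<bar> * (u x)\<^sup>2) \<in> borel_measurable lebesgue"
      by (intro borel_measurable_times borel_measurable_power borel_measurable_abs mn that(1))
  qed
  have bm: "dual_p f \<in> borel_measurable borel" "dual_q f \<in> borel_measurable borel"
    "(\<lambda>s. (f s)\<^sup>2) \<in> borel_measurable borel" "(\<lambda>s. (f s)^4) \<in> borel_measurable borel"
    using dual_measurable[OF dc] by auto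
  have F2: "\<bar>(f s)\<^sup>2\<bar> \<le> 2 * s\<^sup>2" for s
    using dual_sq_taylor[OF dc, of 0 s] by (simp add: dual_f0[OF dc] dual_p_def)
  have F4: "\<bar>(f s) ^ 4\<bar> \<le> 4 * s\<^sup>2" for s
    using dual_pow4_taylor[OF dc, of 0 s] by (simp add: dual_f0[OF dc] dual_q_def)
  have one: "(\<lambda>_. 1::real) \<in> borel_measurable (lebesgue :: 'a measure)" by (rule borel_measurable_const)
  have iv1: "integrable lebesgue (\<lambda>x. \<bar>1\<bar> * (v x)\<^sup>2)" "integrable lebesgue (\<lambda>x. \<bar>1\<bar> * (\<phi> x)\<^sup>2)"
    using v2 i\<phi>(2) by simp_all
  note exp2 = energy_term_expansion[OF v2(1) m\<phi>(1) mn bm(3) bm(1) F2 dual_p_abs[OF dc] dual_sq_taylor[OF dc] weight[OF v2 vx] weight[OF m\<phi>(1) i\<phi>(2,3)]]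
  note exp4 = energy_term_expansion[OF v2(1) m\<phi>(1) one bm(4) bm(2) F4 dual_q_abs[OF dc] dual_pow4_taylor[OF dc] iv1]
  have e2: "\<bar>(LINT x|lebesgue. ((norm x)\<^sup>2 - \<omega>) * (f (v x + t * \<phi> x))\<^sup>2) - (LINT x|lebesgue. ((norm x)\<^sup>2 - \<omega>) * (f (v x))\<^sup>2) - t * (2 * L2)\<bar> \<le> t\<^sup>2 * (2 * C2)" for t
    unfolding L2_def C2_def by (rule exp2(1)) auto
  have i2: "integrable lebesgue (\<lambda>x. ((norm x)\<^sup>2 - \<omega>) * dual_p f (v x) * \<phi> x)"
    by (rule exp2(2)) simp
  have e3: "\<bar>(LINT x|lebesgue. 1 * (f (v x + t * \<phi> x))^4) - (LINT x|lebesgue. 1 * (f (v x))^4) - t * (4 * L3)\<bar> \<le> t\<^sup>2 * (4 * C3)" for t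
    unfolding L3_def C3_def by (rule exp4(1)) simp
  have i3: "integrable lebesgue (\<lambda>x. 1 * dual_q f (v x) * \<phi> x)"
    by (rule exp4(2)) simp
  define L where "L = L1 + L2 + L3"
  define C where "C = C1 / 2 + C2 + C3"
  have J: "\<bar>energy f \<omega> (\<lambda>x. v x + t * \<phi> x) - energy f \<omega> v - t * L\<bar> \<le> C * t\<^sup>2" for t
  proof -
    have C1: "0 \<le> t\<^sup>2 * C1" by (simp add: C1_def)
    define A2 where "A2 u = (LINT x|lebesgue. ((norm x)\<^sup>2 - \<omega>) * (f (u x))\<^sup>2)" for u :: "'a \<Rightarrow> real"
    define A4 where "A4 u = (LINT x|lebesgue. (f (u x))^4)" for u :: "'a \<Rightarrow> real"
    define A1 where "A1 = (LINT x|lebesgue. (norm (weak_gradient v x))\<^sup>2)"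
    define u where "u = (\<lambda>x. v x + t * \<phi> x)"
    have en: "energy f \<omega> u = 1/2 * (A1 + 2 * t * L1 + t\<^sup>2 * C1) + 1/2 * A2 u + 1/4 * A4 u"
      "energy f \<omega> v = 1/2 * A1 + 1/2 * A2 v + 1/4 * A4 v"
      unfolding energy_def A1_def A2_def A4_def u_def e1 by (rule refl)+
    have tri: "E = c + 1/2 * X + 1/4 * Y \<Longrightarrow> \<bar>X\<bar> \<le> x \<Longrightarrow> \<bar>Y\<bar> \<le> y \<Longrightarrow> 0 \<le> c \<Longrightarrow> \<bar>E\<bar> \<le> c + 1/2 * x + 1/4 * y"
      for E c X Y x y :: real by linarith
    have "\<bar>A2 u - A2 v - t * (2 * L2)\<bar> \<le> t\<^sup>2 * (2 * C2)"
      using e2[of t] unfolding A2_def u_def .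
    moreover have "\<bar>A4 u - A4 v - t * (4 * L3)\<bar> \<le> t\<^sup>2 * (4 * C3)"
      using e3[of t] unfolding A4_def u_def mult_1_left .
    moreover have "energy f \<omega> u - energy f \<omega> v - t * L
        = t\<^sup>2 * C1 / 2 + 1/2 * (A2 u - A2 v - t * (2 * L2)) + 1/4 * (A4 u - A4 v - t * (4 * L3))"
      unfolding en L_def by (simp add: algebra_simps)
    ultimately have "\<bar>energy f \<omega> u - energy f \<omega> v - t * L\<bar> \<le> t\<^sup>2 * C1 / 2 + 1/2 * (t\<^sup>2 * (2 * C2)) + 1/4 * (t\<^sup>2 * (4 * C3))"
      using C1 by (intro tri) auto
    also have "\<dots> = C * t\<^sup>2" by (simp add: C_def algebra_simps)
    finally show ?thesis by (simp only: u_def)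
  qed
  have le: "\<bar>L\<bar> \<le> \<epsilon> * (W + 1)" if \<epsilon>: "\<epsilon> > 0" for \<epsilon>
  proof -
    obtain \<delta> where \<delta>: "\<delta> > 0" "\<And>\<psi>. \<psi> \<in> H \<Longrightarrow> norm_H \<psi> < \<delta> \<Longrightarrow>
      \<bar>energy f \<omega> (\<lambda>x. v x + \<psi> x) - energy f \<omega> v\<bar> \<le> \<epsilon> * norm_H \<psi>" using crit[OF \<epsilon>] by blast
    \<comment> \<open>The first bound keeps the norm of t \<phi> below \<delta>, also if W = 0; the
      second makes the quadratic remainder at most \<epsilon> t.\<close>
    define t where "t = min (\<delta> / (2 * (W + 1))) (\<epsilon> / (\<bar>C\<bar> + 1))"
    have t: "t > 0" using \<delta> \<epsilon> W0 by (auto simp: t_def)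
    have "t \<le> \<delta> / (2 * (W + 1))" by (simp add: t_def)
    then have "t * (2 * (W + 1)) \<le> \<delta>" using W0 by (subst (asm) pos_le_divide_eq) auto
    moreover have "0 \<le> t * W" using t W0 by simp
    ultimately have "t * W < \<delta>" using t by (simp add: algebra_simps)
    then have "norm_H (\<lambda>x. t * \<phi> x) < \<delta>" using t by (simp add: nH)
    from \<delta>(2)[OF tH this] have E: "\<bar>energy f \<omega> (\<lambda>x. v x + t * \<phi> x) - energy f \<omega> v\<bar> \<le> \<epsilon> * (t * W)"
      using t by (simp add: nH)
    have "t * (\<bar>C\<bar> + 1) \<le> \<epsilon>"
    proof -
      have "t \<le> \<epsilon> / (\<bar>C\<bar> + 1)" by (simp add: t_def)
      then show ?thesis by (subst (asm) pos_le_divide_eq) auto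
    qed
    moreover have "C * t \<le> \<bar>C\<bar> * t" using t by (intro mult_right_mono) auto
    moreover have "t * (\<bar>C\<bar> + 1) = \<bar>C\<bar> * t + t" by (simp add: algebra_simps)
    ultimately have "C * t \<le> \<epsilon>" using t by linarith
    then have "C * t * t \<le> \<epsilon> * t" using t by (intro mult_right_mono) auto
    then have "C * t\<^sup>2 \<le> \<epsilon> * t" by (simp add: power2_eq_square mult.assoc)
    then have "\<bar>t * L\<bar> \<le> \<epsilon> * (t * W) + \<epsilon> * t" using E J[of t] by linarith
    then have "t * \<bar>L\<bar> \<le> t * (\<epsilon> * (W + 1))" using t by (simp add: abs_mult algebra_simps)
    then show ?thesis using t by (rule mult_left_le_imp_le)
  qed
  have "\<bar>L\<bar> \<le> 0 + e" if "e > 0" for e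
    using le[of "e / (W + 1)"] W0 that by simp
  then have "\<bar>L\<bar> \<le> 0" by (rule field_le_epsilon)
  then have "L = 0" by simp
  moreover have "(LINT x|lebesgue. dual_h f \<omega> x (v x) * \<phi> x) = L2 + L3"
  proof -
    have "(LINT x|lebesgue. dual_h f \<omega> x (v x) * \<phi> x) = (LINT x|lebesgue. ((norm x)\<^sup>2 - \<omega>) * dual_p f (v x) * \<phi> x + 1 * dual_q f (v x) * \<phi> x)"
      by (simp add: dual_h_def algebra_simps)
    also have "\<dots> = L2 + L3" unfolding L2_def L3_def using i2 i3 by (rule Bochner_Integration.integral_add)
    finally show ?thesis .
  qed
  ultimately show "(LINT x|lebesgue. weak_gradient v x \<bullet> grad \<phi> x) + (LINT x|lebesgue. dual_h f \<omega> x (v x) * \<phi> x) = 0"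
    by (simp add: L_def L1_def G0_def)
qed

text \<open>The second integration by parts: each partial derivative of a product test function is
  again a test function, so the definition of the weak gradient of v applies to it.\<close>

lemma weak_equation_laplacian:
  fixes v :: "'a::euclidean_space \<Rightarrow> real"
  assumes dc: "dual_change f" and v: "solves_semilinear f \<omega> v"
    and g: "\<And>b. b \<in> Basis \<Longrightarrow> smooth (g b)" "\<And>b s. b \<in> Basis \<Longrightarrow> R < \<bar>s\<bar> \<Longrightarrow> g b s = 0"
  shows "(LINT x|lebesgue. v x * (\<Sum>b\<in>Basis. Phi (g(b := deriv (deriv (g b)))) x)) = (LINT x|lebesgue. dual_h f \<omega> x (v x) * Phi g x)"
proof -
  have t: "test_function (Phi g)" by (rule test_function_Phi[OF g])
  note eq = critical_point_imp_weak_equation[OF dc v t]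
  let ?G = "weak_gradient v"
  have lG: "locally_integrable ?G" "locally_integrable v" using eq(2) by (auto simp: has_weak_gradient_def)
  have dz: "deriv (g b) s = 0" if b: "b \<in> Basis" and s: "R < \<bar>s\<bar>" for b s
  proof -
    have op: "open {s::real. R < \<bar>s\<bar>}" by (intro open_Collect_less continuous_intros)
    have "(g b has_real_derivative 0) (at s)"
      by (rule has_field_derivative_transform_within_open[OF DERIV_const op]) (use s g(2)[OF b] in auto)
    then show ?thesis by (rule DERIV_imp_deriv)
  qed
  have gb: "test_function (Phi (g(b := deriv (g b))))" if "b \<in> Basis" for b
    by (rule test_function_Phi[where R=R]) (use g dz smooth_deriv in auto)
  have fd2: "frechet_derivative (Phi (g(b := deriv (g b)))) (at x) b = Phi (g(b := deriv (deriv (g b)))) x" if "b \<in> Basis" for b x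
    using frechet_derivative_Phi[of "g(b := deriv (g b))" b x] g(1) smooth_deriv that by simp
  have fd: "frechet_derivative (Phi g) (at x) b = Phi (g(b := deriv (g b))) x" if "b \<in> Basis" for b x
    using frechet_derivative_Phi[of g b x] g(1) that by simp
  have i1: "integrable lebesgue (\<lambda>x. (?G x \<bullet> b) * Phi (g(b := deriv (g b))) x)" if b: "b \<in> Basis" for b
  proof -
    obtain R2 where R2: "\<And>x. R2 < norm x \<Longrightarrow> Phi (g(b := deriv (g b))) x = 0" using test_function_support[OF gb[OF b]] by metis
    show ?thesis
      by (rule locally_integrable_mult[OF locally_integrable_inner[OF lG(1)] test_function_continuous[OF gb[OF b]] R2])
  qed
  have i2: "integrable lebesgue (\<lambda>x. v x * Phi (g(b := deriv (deriv (g b)))) x)" if b: "b \<in> Basis" for b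
  proof -
    obtain R2 where R2: "\<And>x. R2 < norm x \<Longrightarrow> Phi (g(b := deriv (g b))) x = 0" using test_function_support[OF gb[OF b]] by metis
    show ?thesis unfolding fd2[OF b, symmetric]
      by (rule locally_integrable_mult[OF lG(2) test_function_partial_continuous[OF gb[OF b] b], of R2])
        (simp add: frechet_derivative_outside[where \<phi>="Phi (g(b := deriv (g b)))" and R=R2, OF R2])
  qed
  have "(LINT x|lebesgue. ?G x \<bullet> grad (Phi g) x) = (LINT x|lebesgue. (\<Sum>b\<in>Basis. (?G x \<bullet> b) * Phi (g(b := deriv (g b))) x))"
    by (simp add: grad_def inner_sum_right fd mult.commute)
  also have "\<dots> = (\<Sum>b\<in>Basis. LINT x|lebesgue. (?G x \<bullet> b) * Phi (g(b := deriv (g b))) x)"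
    by (rule Bochner_Integration.integral_sum) (rule i1)
  also have "\<dots> = (\<Sum>b\<in>Basis. - (LINT x|lebesgue. v x * Phi (g(b := deriv (deriv (g b)))) x))"
  proof (rule sum.cong[OF refl])
    fix b :: 'a assume b: "b \<in> Basis"
    have "(LINT x|lebesgue. v x * frechet_derivative (Phi (g(b := deriv (g b)))) (at x) b) = - (LINT x|lebesgue. (?G x \<bullet> b) * Phi (g(b := deriv (g b))) x)"
      using eq(2) gb[OF b] b unfolding has_weak_gradient_def by blast
    then show "(LINT x|lebesgue. (?G x \<bullet> b) * Phi (g(b := deriv (g b))) x) = - (LINT x|lebesgue. v x * Phi (g(b := deriv (deriv (g b)))) x)"
      by (simp add: fd2[OF b])
  qed
  also have "\<dots> = - (LINT x|lebesgue. (\<Sum>b\<in>Basis. v x * Phi (g(b := deriv (deriv (g b)))) x))"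
    by (subst Bochner_Integration.integral_sum) (auto simp: i2 sum_negf)
  finally show ?thesis using eq(1) by (simp add: sum_distrib_left)
qed

section \<open>Testing the equation with Gaussians\<close>

lemma bump_shift_tendsto:
  "(\<lambda>n. bump 0 (s + real n)) \<longlonglongrightarrow> 1" "(\<lambda>n. bump 2 (s + real n)) \<longlonglongrightarrow> 0"
  "(\<lambda>n. bump 3 (s + real n)) \<longlonglongrightarrow> 0" "(\<lambda>n. bump 4 (s + real n)) \<longlonglongrightarrow> 0"
proof -
  obtain m :: nat where m: "real m > - s" using reals_Archimedean2 by blast
  have ev: "\<forall>\<^sub>F n in sequentially. exp (- (1 / (s + real n))) / (s + real n) ^ k = bump k (s + real n)" for k
    using eventually_ge_at_top[of m] by eventually_elim (use m in \<open>auto simp: bump_def\<close>)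
  have h: "(\<lambda>n. exp (- (1 / (s + real n))) / (s + real n) ^ 0) \<longlonglongrightarrow> 1"
    "(\<lambda>n. exp (- (1 / (s + real n))) / (s + real n) ^ 2) \<longlonglongrightarrow> 0"
    "(\<lambda>n. exp (- (1 / (s + real n))) / (s + real n) ^ 3) \<longlonglongrightarrow> 0"
    "(\<lambda>n. exp (- (1 / (s + real n))) / (s + real n) ^ 4) \<longlonglongrightarrow> 0" by real_asymp+
  then show "(\<lambda>n. bump 0 (s + real n)) \<longlonglongrightarrow> 1" "(\<lambda>n. bump 2 (s + real n)) \<longlonglongrightarrow> 0"
  "(\<lambda>n. bump 3 (s + real n)) \<longlonglongrightarrow> 0" "(\<lambda>n. bump 4 (s + real n)) \<longlonglongrightarrow> 0"
    using Lim_transform_eventually[OF h(1) ev] Lim_transform_eventually[OF h(2) ev]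
      Lim_transform_eventually[OF h(3) ev] Lim_transform_eventually[OF h(4) ev] by auto
qed

text \<open>The cutoff is bump 0 (n + s) times bump 0 (n - s). It has no plateau and tends to 1 only
  pointwise, but it and its first two derivatives are bounded uniformly in n, as dominated
  convergence requires.\<close>

lemma cutoff_family:
  obtains ct ct1 ct2 :: "nat \<Rightarrow> real \<Rightarrow> real" and B
  where "\<And>n. smooth (ct n)" "\<And>n s. (ct n has_real_derivative ct1 n s) (at s)"
    "\<And>n s. (ct1 n has_real_derivative ct2 n s) (at s)"
    "\<And>n s. 0 \<le> ct n s" "\<And>n s. ct n s \<le> 1" "\<And>n s. \<bar>ct1 n s\<bar> \<le> B" "\<And>n s. \<bar>ct2 n s\<bar> \<le> B" "1 \<le> B"
    "\<And>s. (\<lambda>n. ct n s) \<longlonglongrightarrow> 1" "\<And>s. (\<lambda>n. ct1 n s) \<longlonglongrightarrow> 0" "\<And>s. (\<lambda>n. ct2 n s) \<longlonglongrightarrow> 0"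
    "\<And>n s. real n < \<bar>s\<bar> \<Longrightarrow> ct n s = 0"
proof -
  define c where "c = (\<lambda>t. bump 4 t - 2 * bump 3 t)"
  have d0: "((\<lambda>s. bump 0 (s + d)) has_real_derivative bump 2 (s + d)) (at s)" for s d
    using DERIV_bump[of 0 "s + d"] by (simp add: DERIV_shift numeral_2_eq_2)
  have neg: "((\<lambda>s. g (- s + d)) has_real_derivative - D) (at s)"
    if "(g has_real_derivative D) (at (- s + d))" for g :: "real \<Rightarrow> real" and D s d
  proof -
    have "((\<lambda>s. - s + d) has_real_derivative - 1) (at s)" by (auto intro!: derivative_eq_intros)
    from DERIV_chain2[of g D "\<lambda>s. - s + d", OF that this] show ?thesis by simp
  qed
  have d0': "((\<lambda>s. bump 0 (- s + d)) has_real_derivative - bump 2 (- s + d)) (at s)" for s d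
    by (rule neg) (use DERIV_bump[of 0 "- s + d"] in \<open>simp add: numeral_2_eq_2\<close>)
  have b2: "(bump 2 has_real_derivative c t) (at t)" for t
    using DERIV_bump[of 2 t] by (simp add: c_def eval_nat_numeral)
  have d2: "((\<lambda>s. bump 2 (s + d)) has_real_derivative c (s + d)) (at s)" for s d
    using b2[of "s + d"] by (simp add: DERIV_shift)
  have d2': "((\<lambda>s. bump 2 (- s + d)) has_real_derivative - c (- s + d)) (at s)" for s d
    by (rule neg) (rule b2)
  define ct where "ct n s = bump 0 (s + real n) * bump 0 (- s + real n)" for n s
  define ct1 where "ct1 n s = bump 2 (s + real n) * bump 0 (- s + real n) + (- bump 2 (- s + real n)) * bump 0 (s + real n)" for n s
  define ct2 where "ct2 n s = (c (s + real n) * bump 0 (- s + real n) + (- bump 2 (- s + real n)) * bump 2 (s + real n))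
     + ((- (- c (- s + real n))) * bump 0 (s + real n) + bump 2 (s + real n) * (- bump 2 (- s + real n)))" for n s
  \<comment> \<open>The bounds m! for \<open>bump m\<close> give 24 + 2 * 6 = 36 for c, which is the
    second derivative of \<open>bump 0\<close>.\<close>
  have bb: "0 \<le> bump 0 t" "bump 0 t \<le> 1" "0 \<le> bump 2 t" "bump 2 t \<le> 2" "\<bar>c t\<bar> \<le> 36" for t
  proof -
    have f: "fact 0 = (1::real)" "fact 2 = (2::real)" "fact 3 = (6::real)" "fact 4 = (24::real)"
      by (simp_all add: fact_numeral)
    note b = bump_nonneg[of 0 t] bump_nonneg[of 2 t] bump_nonneg[of 3 t] bump_nonneg[of 4 t]
      bump_le[of 0 t, unfolded f] bump_le[of 2 t, unfolded f] bump_le[of 3 t, unfolded f] bump_le[of 4 t, unfolded f]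
    show "0 \<le> bump 0 t" "bump 0 t \<le> 1" "0 \<le> bump 2 t" "bump 2 t \<le> 2" using b by auto
    show "\<bar>c t\<bar> \<le> 36" unfolding c_def using b by linarith
  qed
  show ?thesis
  \<comment> \<open>100 is a crude common bound; the four terms of the second derivative add up to
    at most 36 + 4 + 36 + 4.\<close>
  proof (rule that[of ct ct1 ct2 100])
    fix n s
    show "smooth (ct n)"
      using smooth_mult[OF smooth_affine[OF smooth_bump, of 0 1 "real n"] smooth_affine[OF smooth_bump, of 0 "-1" "real n"]]
      by (simp add: ct_def[abs_def])
    show "(ct n has_real_derivative ct1 n s) (at s)"
      unfolding ct_def[abs_def] ct1_def by (rule DERIV_mult[OF d0 d0'])
    show "(ct1 n has_real_derivative ct2 n s) (at s)"
      unfolding ct1_def[abs_def] ct2_def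
      by (intro DERIV_add DERIV_mult d0 d0' d2 DERIV_minus d2')
    show "0 \<le> ct n s" "ct n s \<le> 1" unfolding ct_def using bb by (auto intro!: mult_le_one)
    have m: "\<bar>x * y\<bar> \<le> X * Y" if "\<bar>x\<bar> \<le> X" "\<bar>y\<bar> \<le> Y" for x y X Y :: real
      unfolding abs_mult using that by (intro mult_mono) auto
    have p: "\<bar>bump 2 t * bump 0 u\<bar> \<le> 2 * 1" "\<bar>c t * bump 0 u\<bar> \<le> 36 * 1" "\<bar>bump 2 t * bump 2 u\<bar> \<le> 2 * 2" for t u
      using m[of "bump 2 t" 2 "bump 0 u" 1] m[of "c t" 36 "bump 0 u" 1] m[of "bump 2 t" 2 "bump 2 u" 2] bb[of t] bb[of u] by auto
    show "\<bar>ct1 n s\<bar> \<le> 100" unfolding ct1_def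
      using p(1)[of "s + real n" "- s + real n"] p(1)[of "- s + real n" "s + real n"] by (simp add: abs_le_iff)
    show "\<bar>ct2 n s\<bar> \<le> 100" unfolding ct2_def
      using p(2)[of "s + real n" "- s + real n"] p(2)[of "- s + real n" "s + real n"] p(3)[of "s + real n" "- s + real n"]
      by (simp add: abs_le_iff mult.commute)
    have lc: "(\<lambda>n. c (s + real n)) \<longlonglongrightarrow> 0 - 2 * 0" for s
      unfolding c_def by (intro tendsto_intros bump_shift_tendsto)
    note lim = bump_shift_tendsto lc[unfolded mult_zero_right diff_zero]
    have "(\<lambda>n. ct n s) \<longlonglongrightarrow> 1 * 1" unfolding ct_def by (intro tendsto_mult lim)
    then show "(\<lambda>n. ct n s) \<longlonglongrightarrow> 1" by simp
    have "(\<lambda>n. ct1 n s) \<longlonglongrightarrow> 0 * 1 + (- 0) * 1" unfolding ct1_def by (intro tendsto_mult tendsto_add tendsto_minus lim)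
    then show "(\<lambda>n. ct1 n s) \<longlonglongrightarrow> 0" by simp
    have "(\<lambda>n. ct2 n s) \<longlonglongrightarrow> (0 * 1 + (- 0) * 0) + ((- (- 0)) * 1 + 0 * (- 0))" unfolding ct2_def by (intro tendsto_mult tendsto_add tendsto_minus lim)
    then show "(\<lambda>n. ct2 n s) \<longlonglongrightarrow> 0" by simp
    show "ct n s = 0" if "real n < \<bar>s\<bar>"
    proof -
      have "s + real n \<le> 0 \<or> - s + real n \<le> 0" using that by linarith
      then show ?thesis by (auto simp: ct_def bump_def)
    qed
  qed simp
qed

text \<open>The inequality 2 a b <= a^2 + b^2 separates v^2 from the square of the remaining factor,
  whose polynomial has been absorbed into half of the Gaussian exponent.\<close>

lemma integrable_gauss_poly:
  fixes v F :: "'a::euclidean_space \<Rightarrow> real"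
  assumes [measurable]: "v \<in> borel_measurable borel" "F \<in> borel_measurable borel"
    and v: "integrable lborel (\<lambda>y. (v y)\<^sup>2)" and a: "0 < a"
    and F: "\<And>y. \<bar>F y\<bar> \<le> \<bar>v y\<bar> * (C * ((1 + norm (x - y)) ^ m * exp (- a * (norm (x - y))\<^sup>2)))"
  shows "integrable lborel F"
proof -
  obtain C' where C': "C' > 0" "\<And>s. 0 \<le> s \<Longrightarrow> (1 + s) ^ m * exp (- a * s\<^sup>2) \<le> C' * exp (- (a/2) * s\<^sup>2)"
    using poly_gauss_bound[OF a] by blast
  have "integrable lborel (\<lambda>y. (v y)\<^sup>2 + (\<bar>C\<bar> * C')\<^sup>2 * exp (- a * (norm (x - y))\<^sup>2))"
    by (intro Bochner_Integration.integrable_add v integrable_mult_right integrable_gaussian a)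
  then show ?thesis
  proof (rule Bochner_Integration.integrable_bound)
    show "AE y in lborel. norm (F y) \<le> norm ((v y)\<^sup>2 + (\<bar>C\<bar> * C')\<^sup>2 * exp (- a * (norm (x - y))\<^sup>2))"
    proof (rule AE_I2)
      fix y :: 'a
      let ?s = "norm (x - y)" let ?e = "exp (- (a/2) * ?s\<^sup>2)"
      have e2: "?e * ?e = exp (- a * ?s\<^sup>2)" by (simp add: exp_add[symmetric])
      have "C * ((1 + ?s) ^ m * exp (- a * ?s\<^sup>2)) \<le> \<bar>C\<bar> * ((1 + ?s) ^ m * exp (- a * ?s\<^sup>2))"
        by (intro mult_right_mono mult_nonneg_nonneg zero_le_power) auto
      also have "\<dots> \<le> \<bar>C\<bar> * (C' * ?e)" using C'(2)[of ?s] by (intro mult_left_mono) auto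
      finally have "\<bar>F y\<bar> \<le> \<bar>v y\<bar> * (\<bar>C\<bar> * C' * ?e)"
        using order_trans[OF F mult_left_mono] by (simp add: mult.assoc)
      also have "\<dots> \<le> (v y)\<^sup>2 + (\<bar>C\<bar> * C' * ?e)\<^sup>2"
      proof -
        have "0 \<le> \<bar>v y\<bar> * (\<bar>C\<bar> * C' * ?e)" using C'(1) by simp
        then show ?thesis using sum_squares_bound[of "\<bar>v y\<bar>" "\<bar>C\<bar> * C' * ?e"] unfolding power2_abs by linarith
      qed
      also have "(\<bar>C\<bar> * C' * ?e)\<^sup>2 = (\<bar>C\<bar> * C')\<^sup>2 * exp (- a * ?s\<^sup>2)"
        unfolding e2[symmetric] by (simp add: power2_eq_square)
      finally show "norm (F y) \<le> norm ((v y)\<^sup>2 + (\<bar>C\<bar> * C')\<^sup>2 * exp (- a * ?s\<^sup>2))" by simp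
    qed
  qed simp
qed

lemma dual_h_bound:
  assumes dc: "dual_change f"
  shows "\<bar>dual_h f \<omega> y t\<bar> \<le> ((norm y)\<^sup>2 + \<bar>\<omega>\<bar> + 1) * \<bar>t\<bar>"
proof -
  have "\<bar>dual_h f \<omega> y t\<bar> \<le> \<bar>(norm y)\<^sup>2 - \<omega>\<bar> * \<bar>dual_p f t\<bar> + \<bar>dual_q f t\<bar>"
    unfolding dual_h_def abs_mult[symmetric] by (rule abs_triangle_ineq)
  also have "\<dots> \<le> ((norm y)\<^sup>2 + \<bar>\<omega>\<bar>) * \<bar>t\<bar> + \<bar>t\<bar>"
    using dual_p_abs[OF dc, of t] dual_q_abs[OF dc, of t] abs_triangle_ineq4[of "(norm y)\<^sup>2" \<omega>]
    by (intro add_mono mult_mono) auto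
  finally show ?thesis by (simp add: algebra_simps)
qed

text \<open>From 1 + |y| <= (1 + |x|) (1 + |x - y|): growth in y becomes growth in x - y, which a
  Gaussian centred at x can absorb.\<close>

lemma norm_poly_shift:
  fixes x y :: "'a::real_normed_vector"
  assumes "0 \<le> K"
  shows "(norm y)\<^sup>2 + K \<le> (1 + K) * (1 + norm x)\<^sup>2 * (1 + norm (x - y))\<^sup>2"
proof -
  have "1 + norm y \<le> 1 + norm x + norm (x - y)" using norm_triangle_sub[of y x] by (simp add: norm_minus_commute)
  also have "\<dots> \<le> (1 + norm x) * (1 + norm (x - y))" by (simp add: algebra_simps)
  finally have A: "(1 + norm y)\<^sup>2 \<le> ((1 + norm x) * (1 + norm (x - y)))\<^sup>2" by (intro power_mono) auto
  have "(norm y)\<^sup>2 \<le> (1 + norm y)\<^sup>2" by (intro power_mono) auto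
  moreover have "K * 1 \<le> K * (1 + norm y)\<^sup>2" by (intro mult_left_mono one_le_power assms) auto
  ultimately have "(norm y)\<^sup>2 + K \<le> (1 + K) * (1 + norm y)\<^sup>2" by (simp only: distrib_right mult_1_left mult_1_right)
  also have "\<dots> \<le> (1 + K) * ((1 + norm x) * (1 + norm (x - y)))\<^sup>2"
    using assms by (intro mult_left_mono[OF A]) simp
  finally have "(norm y)\<^sup>2 + K \<le> (1 + K) * ((1 + norm x) * (1 + norm (x - y)))\<^sup>2" .
  then show ?thesis by (simp add: power_mult_distrib mult.assoc)
qed

lemma dual_h_gauss_bound:
  fixes v :: "'a::euclidean_space \<Rightarrow> real"
  assumes dc: "dual_change f"
  shows "\<bar>dual_h f \<omega> y (v y) * exp (- a * (norm (x - y))\<^sup>2)\<bar>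
    \<le> \<bar>v y\<bar> * (((2 + \<bar>\<omega>\<bar>) * (1 + norm x)\<^sup>2) * ((1 + norm (x - y)) ^ 2 * exp (- a * (norm (x - y))\<^sup>2)))"
proof -
  have "\<bar>dual_h f \<omega> y (v y)\<bar> \<le> ((norm y)\<^sup>2 + \<bar>\<omega>\<bar> + 1) * \<bar>v y\<bar>" by (rule dual_h_bound[OF dc])
  also have "\<dots> \<le> ((1 + (\<bar>\<omega>\<bar> + 1)) * (1 + norm x)\<^sup>2 * (1 + norm (x - y))\<^sup>2) * \<bar>v y\<bar>"
    using norm_poly_shift[of "\<bar>\<omega>\<bar> + 1" y x] by (intro mult_right_mono) auto
  finally have "\<bar>dual_h f \<omega> y (v y)\<bar> \<le> ((2 + \<bar>\<omega>\<bar>) * (1 + norm x)\<^sup>2 * (1 + norm (x - y))\<^sup>2) * \<bar>v y\<bar>" by (simp add: add.commute)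
  then have "\<bar>dual_h f \<omega> y (v y)\<bar> * exp (- a * (norm (x - y))\<^sup>2)
     \<le> (((2 + \<bar>\<omega>\<bar>) * (1 + norm x)\<^sup>2 * (1 + norm (x - y))\<^sup>2) * \<bar>v y\<bar>) * exp (- a * (norm (x - y))\<^sup>2)"
    by (rule mult_right_mono) simp
  then show ?thesis by (simp add: abs_mult mult_ac)
qed

lemma dual_h_measurable:
  fixes v :: "'a::euclidean_space \<Rightarrow> real"
  assumes dc: "dual_change f" and [measurable]: "v \<in> borel_measurable borel"
  shows "(\<lambda>y. dual_h f \<omega> y (v y)) \<in> borel_measurable borel"
proof -
  have [measurable]: "dual_p f \<in> borel_measurable borel" "dual_q f \<in> borel_measurable borel"
    using dual_measurable[OF dc] by auto
  show ?thesis unfolding dual_h_def by measurable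
qed

text \<open>The Gaussian centred at x is a product over the coordinates, so cutoff times Gaussian is
  an admissible test function. As the cutoffs tend to 1, the weight on the left becomes the
  Laplacian of the Gaussian.\<close>

lemma gaussian_equation_from_products:
  fixes v :: "'a::euclidean_space \<Rightarrow> real"
  assumes dc: "dual_change f" and vm[measurable]: "v \<in> borel_measurable borel" and v2: "integrable lborel (\<lambda>y. (v y)\<^sup>2)"
    and eq: "\<And>g R. (\<And>b. b \<in> Basis \<Longrightarrow> smooth (g b)) \<Longrightarrow> (\<And>b s. b \<in> Basis \<Longrightarrow> R < \<bar>s\<bar> \<Longrightarrow> g b s = 0) \<Longrightarrow>
      (LINT x|lborel. v x * (\<Sum>b\<in>Basis. Phi (g(b := deriv (deriv (g b)))) x)) = (LINT x|lborel. dual_h f \<omega> x (v x) * Phi g x)"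
    and a: "0 < a"
  shows "(LINT y|lborel. v y * ((4 * a\<^sup>2 * (norm (x - y))\<^sup>2 - 2 * a * real DIM('a)) * exp (- a * (norm (x - y))\<^sup>2)))
    = (LINT y|lborel. dual_h f \<omega> y (v y) * exp (- a * (norm (x - y))\<^sup>2))"
proof -
  obtain ct ct1 ct2 :: "nat \<Rightarrow> real \<Rightarrow> real" and B
  where chi: "\<And>n. smooth (ct n)" "\<And>n s. (ct n has_real_derivative ct1 n s) (at s)"
    "\<And>n s. (ct1 n has_real_derivative ct2 n s) (at s)"
    "\<And>n s. 0 \<le> ct n s" "\<And>n s. ct n s \<le> 1" "\<And>n s. \<bar>ct1 n s\<bar> \<le> B" "\<And>n s. \<bar>ct2 n s\<bar> \<le> B" "1 \<le> B"
    "\<And>s. (\<lambda>n. ct n s) \<longlonglongrightarrow> 1" "\<And>s. (\<lambda>n. ct1 n s) \<longlonglongrightarrow> 0" "\<And>s. (\<lambda>n. ct2 n s) \<longlonglongrightarrow> 0"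
    "\<And>n s. real n < \<bar>s\<bar> \<Longrightarrow> ct n s = 0"
    by (rule cutoff_family, rule that, assumption+)
  define e where "e b s = exp (- a * (s - x \<bullet> b)\<^sup>2)" for b s
  define E where "E y = exp (- a * (norm (x - y))\<^sup>2)" for y
  define gg where "gg n b s = ct n s * e b s" for n b s
  \<comment> \<open>The second derivative of cutoff times Gaussian, divided by the Gaussian. In the
    limit only the last summand survives, and its sum over the coordinates is 4 a^2 |x - y|^2 - 2 a
    N.\<close>
  define \<kappa> where "\<kappa> n b s = ct2 n s + 2 * ct1 n s * (- 2 * a * (s - x \<bullet> b)) + ct n s * (4 * a\<^sup>2 * (s - x \<bullet> b)\<^sup>2 - 2 * a)" for n b s
  have de: "(e b has_real_derivative (- 2 * a * (s - x \<bullet> b)) * e b s) (at s)" for b s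
    unfolding e_def[abs_def] by (rule DERIV_gauss1)
  have dl: "((\<lambda>s. - 2 * a * (s - x \<bullet> b)) has_real_derivative - 2 * a) (at s)" for b s
    by (auto intro!: derivative_eq_intros)
  have d1: "(gg n b has_real_derivative ct1 n s * e b s + ((- 2 * a * (s - x \<bullet> b)) * e b s) * ct n s) (at s)" for n b s
    unfolding gg_def[abs_def] by (rule DERIV_mult[OF chi(2) de])
  have d1': "deriv (gg n b) = (\<lambda>s. ct1 n s * e b s + ((- 2 * a * (s - x \<bullet> b)) * e b s) * ct n s)" for n b
    by (rule ext, rule DERIV_imp_deriv, rule d1)
  have d2': "((\<lambda>s. ct1 n s * e b s + ((- 2 * a * (s - x \<bullet> b)) * e b s) * ct n s) has_real_derivative
      (ct2 n s * e b s + ((- 2 * a * (s - x \<bullet> b)) * e b s) * ct1 n s)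
      + ((- 2 * a * e b s + (- 2 * a * (s - x \<bullet> b)) * e b s * (- 2 * a * (s - x \<bullet> b))) * ct n s + ct1 n s * ((- 2 * a * (s - x \<bullet> b)) * e b s))) (at s)" for n b s
    by (intro DERIV_add DERIV_mult chi(2,3) de dl)
  have d2e: "(ct2 n s * e b s + ((- 2 * a * (s - x \<bullet> b)) * e b s) * ct1 n s)
      + ((- 2 * a * e b s + (- 2 * a * (s - x \<bullet> b)) * e b s * (- 2 * a * (s - x \<bullet> b))) * ct n s + ct1 n s * ((- 2 * a * (s - x \<bullet> b)) * e b s))
      = \<kappa> n b s * e b s" for n b s
    unfolding \<kappa>_def by (simp add: algebra_simps power2_eq_square)
  have d2: "deriv (deriv (gg n b)) = (\<lambda>s. \<kappa> n b s * e b s)" for n b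
    unfolding d1' by (rule ext, rule DERIV_imp_deriv, rule d2'[unfolded d2e])
  have Eprod: "(\<Prod>b\<in>Basis. e b (y \<bullet> b)) = E y" for y
  proof -
    have "(\<Prod>b\<in>Basis. e b (y \<bullet> b)) = exp (\<Sum>b\<in>Basis. - a * (y \<bullet> b - x \<bullet> b)\<^sup>2)"
      unfolding e_def by (simp add: exp_sum)
    also have "(\<Sum>b\<in>Basis. - a * (y \<bullet> b - x \<bullet> b)\<^sup>2) = - a * (norm (x - y))\<^sup>2"
      unfolding power2_norm_eq_inner euclidean_inner[of "x - y" "x - y"]
      by (simp add: sum_distrib_left inner_diff_left power2_eq_square algebra_simps)
    finally show ?thesis by (simp add: E_def)
  qed
  have P0: "Phi (gg n) y = (\<Prod>b\<in>Basis. ct n (y \<bullet> b)) * E y" for n y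
    unfolding Phi_def gg_def prod.distrib Eprod ..
  have P2: "Phi ((gg n)(b := deriv (deriv (gg n b)))) y = \<kappa> n b (y \<bullet> b) * (\<Prod>j\<in>Basis - {b}. ct n (y \<bullet> j)) * E y"
    if b: "b \<in> Basis" for n b y
  proof -
    have "Phi ((gg n)(b := deriv (deriv (gg n b)))) y = (\<kappa> n b (y \<bullet> b) * e b (y \<bullet> b)) * (\<Prod>j\<in>Basis - {b}. ((gg n)(b := deriv (deriv (gg n b)))) j (y \<bullet> j))"
      unfolding Phi_def using b by (subst prod.remove[of _ b]) (auto simp: d2)
    also have "(\<Prod>j\<in>Basis - {b}. ((gg n)(b := deriv (deriv (gg n b)))) j (y \<bullet> j)) = (\<Prod>j\<in>Basis - {b}. ct n (y \<bullet> j)) * (\<Prod>j\<in>Basis - {b}. e j (y \<bullet> j))"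
      unfolding prod.distrib[symmetric] by (rule prod.cong) (auto simp: gg_def)
    also have "(\<kappa> n b (y \<bullet> b) * e b (y \<bullet> b)) * ((\<Prod>j\<in>Basis - {b}. ct n (y \<bullet> j)) * (\<Prod>j\<in>Basis - {b}. e j (y \<bullet> j)))
      = \<kappa> n b (y \<bullet> b) * (\<Prod>j\<in>Basis - {b}. ct n (y \<bullet> j)) * (e b (y \<bullet> b) * (\<Prod>j\<in>Basis - {b}. e j (y \<bullet> j)))" by (simp only: mult_ac)
    also have "e b (y \<bullet> b) * (\<Prod>j\<in>Basis - {b}. e j (y \<bullet> j)) = E y"
      unfolding Eprod[symmetric] using b by (subst prod.remove[of Basis b]) auto
    finally show ?thesis .
  qed
  have gs: "smooth (gg n b)" for n b
    unfolding gg_def[abs_def] e_def by (intro smooth_mult chi(1) smooth_gauss)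
  have gz: "gg n b s = 0" if "real n < \<bar>s\<bar>" for n b s using chi(12)[OF that] by (simp add: gg_def)
  have main: "(LINT y|lborel. v y * (\<Sum>b\<in>Basis. Phi ((gg n)(b := deriv (deriv (gg n b)))) y)) = (LINT y|lborel. dual_h f \<omega> y (v y) * Phi (gg n) y)" for n
    by (rule eq[where R="real n"]) (use gs gz in auto)
  have Em[measurable]: "E \<in> borel_measurable borel" unfolding E_def[abs_def] by measurable
  have pm[measurable]: "Phi (gg n) \<in> borel_measurable borel" "Phi ((gg n)(b := deriv (deriv (gg n b)))) \<in> borel_measurable borel" if "b \<in> Basis" for n b
  proof -
    show "Phi (gg n) \<in> borel_measurable borel"
      using C_k_Phi[of "gg n" 0] gs by (auto intro: borel_measurable_continuous_onI)
    show "Phi ((gg n)(b := deriv (deriv (gg n b)))) \<in> borel_measurable borel"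
      using C_k_Phi[of "(gg n)(b := deriv (deriv (gg n b)))" 0] gs smooth_deriv by (auto intro: borel_measurable_continuous_onI)
  qed
  have prod01: "0 \<le> (\<Prod>j\<in>A. ct n (y \<bullet> j))" "(\<Prod>j\<in>A. ct n (y \<bullet> j)) \<le> 1" for A n and y :: 'a
    using chi(4,5) by (auto intro!: prod_nonneg prod_le_1)
  have hm: "(\<lambda>y. dual_h f \<omega> y (v y)) \<in> borel_measurable borel" by (rule dual_h_measurable[OF dc vm])
  have lim1: "(\<lambda>n. LINT y|lborel. dual_h f \<omega> y (v y) * Phi (gg n) y) \<longlonglongrightarrow> (LINT y|lborel. dual_h f \<omega> y (v y) * E y)"
  proof (rule integral_dominated_convergence[where w="\<lambda>y. \<bar>dual_h f \<omega> y (v y) * E y\<bar>"])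
    show "integrable lborel (\<lambda>y. \<bar>dual_h f \<omega> y (v y) * E y\<bar>)"
      proof (rule integrable_abs, rule integrable_gauss_poly[OF vm _ v2 a])
      show "(\<lambda>y. dual_h f \<omega> y (v y) * E y) \<in> borel_measurable borel" by (rule borel_measurable_times[OF hm Em])
      show "\<bar>dual_h f \<omega> y (v y) * E y\<bar> \<le> \<bar>v y\<bar> * (((2 + \<bar>\<omega>\<bar>) * (1 + norm x)\<^sup>2) * ((1 + norm (x - y)) ^ 2 * exp (- a * (norm (x - y))\<^sup>2)))" for y
        unfolding E_def by (rule dual_h_gauss_bound[OF dc])
    qed
    show "AE y in lborel. (\<lambda>n. dual_h f \<omega> y (v y) * Phi (gg n) y) \<longlonglongrightarrow> dual_h f \<omega> y (v y) * E y"
    proof (rule AE_I2)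
      fix y :: 'a
      have "(\<lambda>n. dual_h f \<omega> y (v y) * ((\<Prod>b\<in>Basis. ct n (y \<bullet> b)) * E y)) \<longlonglongrightarrow> dual_h f \<omega> y (v y) * ((\<Prod>b\<in>(Basis::'a set). 1) * E y)"
        by (intro tendsto_mult tendsto_prod tendsto_const chi(9))
      then show "(\<lambda>n. dual_h f \<omega> y (v y) * Phi (gg n) y) \<longlonglongrightarrow> dual_h f \<omega> y (v y) * E y" by (simp add: P0)
    qed
    show "AE y in lborel. norm (dual_h f \<omega> y (v y) * Phi (gg n) y) \<le> \<bar>dual_h f \<omega> y (v y) * E y\<bar>" for n
    proof (rule AE_I2)
      fix y :: 'a
      have "\<bar>\<Prod>b\<in>Basis. ct n (y \<bullet> b)\<bar> \<le> 1" using prod01[where A=Basis and n=n and y=y] by simp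
      then have "\<bar>\<Prod>b\<in>Basis. ct n (y \<bullet> b)\<bar> * \<bar>dual_h f \<omega> y (v y) * E y\<bar> \<le> 1 * \<bar>dual_h f \<omega> y (v y) * E y\<bar>"
        by (rule mult_right_mono) simp
      then show "norm (dual_h f \<omega> y (v y) * Phi (gg n) y) \<le> \<bar>dual_h f \<omega> y (v y) * E y\<bar>"
        by (simp add: P0 abs_mult mult_ac)
    qed
  next
    show "(\<lambda>y. dual_h f \<omega> y (v y) * Phi (gg n) y) \<in> borel_measurable lborel" for n
      using borel_measurable_times[OF hm pm(1)[OF SOME_Basis]] by simp
    show "(\<lambda>y. dual_h f \<omega> y (v y) * E y) \<in> borel_measurable lborel"
      using borel_measurable_times[OF hm Em] by simp
  qed
  \<comment> \<open>The sum of the bounds B, 4 a B and (4 a^2 + 2 a) B of the three summands of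
    \<kappa>, each to be multiplied by (1 + |x - y|)^2.\<close>
  define K where "K = B * (1 + 6 * a + 4 * a\<^sup>2)"
  have \<kappa>b: "\<bar>\<kappa> n b (y \<bullet> b)\<bar> \<le> K * (1 + norm (x - y))\<^sup>2" if b: "b \<in> Basis" for n b y
  proof -
    define r where "r = y \<bullet> b - x \<bullet> b"
    let ?s = "norm (x - y)"
    have r: "\<bar>r\<bar> \<le> ?s" using Basis_le_norm[OF b, of "x - y"] by (simp add: r_def inner_diff_left abs_minus_commute)
    have r2: "r\<^sup>2 \<le> ?s\<^sup>2" using power_mono[OF r, of 2] by simp
    have s1: "1 \<le> (1 + ?s)\<^sup>2" "?s \<le> (1 + ?s)\<^sup>2" "?s\<^sup>2 \<le> (1 + ?s)\<^sup>2"
      by (auto simp: power2_eq_square algebra_simps)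
    have B0: "0 \<le> B" using chi(8) by simp
    have t1: "\<bar>ct2 n (y \<bullet> b)\<bar> \<le> B * (1 + ?s)\<^sup>2" using chi(7)[of n "y \<bullet> b"] mult_left_mono[OF s1(1) B0] by simp
    have "\<bar>2 * ct1 n (y \<bullet> b) * (- 2 * a * r)\<bar> = (4 * a) * (\<bar>ct1 n (y \<bullet> b)\<bar> * \<bar>r\<bar>)" using a by (simp add: abs_mult)
    also have "\<dots> \<le> (4 * a) * (B * (1 + ?s)\<^sup>2)"
      using chi(6)[of n "y \<bullet> b"] r s1(2) a B0 by (intro mult_left_mono mult_mono) auto
    finally have t2: "\<bar>2 * ct1 n (y \<bullet> b) * (- 2 * a * r)\<bar> \<le> (4 * a) * (B * (1 + ?s)\<^sup>2)" .
    have "\<bar>4 * a\<^sup>2 * r\<^sup>2 - 2 * a\<bar> \<le> 4 * a\<^sup>2 * r\<^sup>2 + 2 * a" using a by (simp add: abs_le_iff)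
    also have "\<dots> \<le> 4 * a\<^sup>2 * (1 + ?s)\<^sup>2 + 2 * a * (1 + ?s)\<^sup>2"
      using order_trans[OF r2 s1(3)] s1(1) a by (intro add_mono mult_left_mono) (auto simp: mult_le_cancel_left1)
    finally have "\<bar>4 * a\<^sup>2 * r\<^sup>2 - 2 * a\<bar> \<le> (4 * a\<^sup>2 + 2 * a) * (1 + ?s)\<^sup>2" by (simp add: distrib_right)
    then have "\<bar>ct n (y \<bullet> b)\<bar> * \<bar>4 * a\<^sup>2 * r\<^sup>2 - 2 * a\<bar> \<le> B * ((4 * a\<^sup>2 + 2 * a) * (1 + ?s)\<^sup>2)"
      using chi(4,5)[of n "y \<bullet> b"] chi(8) by (intro mult_mono) auto
    then have t3: "\<bar>ct n (y \<bullet> b) * (4 * a\<^sup>2 * r\<^sup>2 - 2 * a)\<bar> \<le> B * ((4 * a\<^sup>2 + 2 * a) * (1 + ?s)\<^sup>2)" by (simp add: abs_mult)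
    have "\<bar>\<kappa> n b (y \<bullet> b)\<bar> \<le> \<bar>ct2 n (y \<bullet> b)\<bar> + \<bar>2 * ct1 n (y \<bullet> b) * (- 2 * a * r)\<bar> + \<bar>ct n (y \<bullet> b) * (4 * a\<^sup>2 * r\<^sup>2 - 2 * a)\<bar>"
      unfolding \<kappa>_def r_def[symmetric] by linarith
    also have "\<dots> \<le> B * (1 + ?s)\<^sup>2 + (4 * a) * (B * (1 + ?s)\<^sup>2) + B * ((4 * a\<^sup>2 + 2 * a) * (1 + ?s)\<^sup>2)"
      using t1 t2 t3 by linarith
    also have "\<dots> = K * (1 + ?s)\<^sup>2" unfolding K_def by (simp add: algebra_simps)
    finally show ?thesis .
  qed
  let ?N = "real DIM('a)"
  have lim2: "(\<lambda>n. LINT y|lborel. v y * (\<Sum>b\<in>Basis. Phi ((gg n)(b := deriv (deriv (gg n b)))) y))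
     \<longlonglongrightarrow> (LINT y|lborel. v y * ((4 * a\<^sup>2 * (norm (x - y))\<^sup>2 - 2 * a * ?N) * E y))"
  proof (rule integral_dominated_convergence[where w="\<lambda>y. \<bar>v y\<bar> * ((?N * K) * ((1 + norm (x - y)) ^ 2 * E y))"])
    have K0: "0 \<le> K" using chi(8) a by (simp add: K_def)
    show "integrable lborel (\<lambda>y. \<bar>v y\<bar> * ((?N * K) * ((1 + norm (x - y)) ^ 2 * E y)))"
      by (rule integrable_gauss_poly[OF vm _ v2 a, where C="?N * K" and m=2 and x=x]) (use K0 in \<open>auto simp: E_def abs_mult\<close>)
    show "AE y in lborel. (\<lambda>n. v y * (\<Sum>b\<in>Basis. Phi ((gg n)(b := deriv (deriv (gg n b)))) y)) \<longlonglongrightarrow> v y * ((4 * a\<^sup>2 * (norm (x - y))\<^sup>2 - 2 * a * ?N) * E y)"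
    proof (rule AE_I2)
      fix y :: 'a
      have "(\<lambda>n. v y * (\<Sum>b\<in>Basis. \<kappa> n b (y \<bullet> b) * (\<Prod>j\<in>Basis - {b}. ct n (y \<bullet> j)) * E y)) \<longlonglongrightarrow>
         v y * (\<Sum>b\<in>Basis. (0 + 2 * 0 * (- 2 * a * (y \<bullet> b - x \<bullet> b)) + 1 * (4 * a\<^sup>2 * (y \<bullet> b - x \<bullet> b)\<^sup>2 - 2 * a)) * (\<Prod>j\<in>Basis - {b}. 1) * E y)"
        unfolding \<kappa>_def by (intro tendsto_mult tendsto_sum tendsto_add tendsto_prod tendsto_const chi)
      also have "(\<Sum>b\<in>Basis. (0 + 2 * 0 * (- 2 * a * (y \<bullet> b - x \<bullet> b)) + 1 * (4 * a\<^sup>2 * (y \<bullet> b - x \<bullet> b)\<^sup>2 - 2 * a)) * (\<Prod>j\<in>Basis - {b}. 1) * E y)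
         = (\<Sum>b\<in>Basis. 4 * a\<^sup>2 * (y \<bullet> b - x \<bullet> b)\<^sup>2 - 2 * a) * E y"
        by (simp add: sum_distrib_right)
      also have "(\<Sum>b\<in>Basis. 4 * a\<^sup>2 * (y \<bullet> b - x \<bullet> b)\<^sup>2 - 2 * a) = 4 * a\<^sup>2 * (\<Sum>b\<in>Basis. (y \<bullet> b - x \<bullet> b)\<^sup>2) - 2 * a * ?N"
        by (simp add: sum_subtractf sum_distrib_left)
      also have "(\<Sum>b\<in>Basis. (y \<bullet> b - x \<bullet> b)\<^sup>2) = (norm (x - y))\<^sup>2"
        unfolding power2_norm_eq_inner euclidean_inner[of "x - y" "x - y"]
        by (simp add: inner_diff_left power2_eq_square algebra_simps)
      finally show "(\<lambda>n. v y * (\<Sum>b\<in>Basis. Phi ((gg n)(b := deriv (deriv (gg n b)))) y)) \<longlonglongrightarrow> v y * ((4 * a\<^sup>2 * (norm (x - y))\<^sup>2 - 2 * a * ?N) * E y)"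
        by (simp add: P2)
    qed
    show "AE y in lborel. norm (v y * (\<Sum>b\<in>Basis. Phi ((gg n)(b := deriv (deriv (gg n b)))) y)) \<le> \<bar>v y\<bar> * ((?N * K) * ((1 + norm (x - y)) ^ 2 * E y))" for n
    proof (rule AE_I2)
      fix y :: 'a
      have "\<bar>\<Sum>b\<in>Basis. Phi ((gg n)(b := deriv (deriv (gg n b)))) y\<bar> \<le> (\<Sum>b\<in>(Basis::'a set). K * (1 + norm (x - y))\<^sup>2 * E y)"
      proof (rule order_trans[OF sum_abs sum_mono])
        fix b :: 'a assume b: "b \<in> Basis"
        have E0: "0 \<le> E y" by (simp add: E_def)
        have "\<bar>\<kappa> n b (y \<bullet> b)\<bar> * \<bar>\<Prod>j\<in>Basis - {b}. ct n (y \<bullet> j)\<bar> \<le> (K * (1 + norm (x - y))\<^sup>2) * 1"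
          using \<kappa>b[OF b, of n y] prod01[where A="Basis - {b}" and n=n and y=y] K0 by (intro mult_mono) auto
        then have "(\<bar>\<kappa> n b (y \<bullet> b)\<bar> * \<bar>\<Prod>j\<in>Basis - {b}. ct n (y \<bullet> j)\<bar>) * E y \<le> ((K * (1 + norm (x - y))\<^sup>2) * 1) * E y"
          using E0 by (rule mult_right_mono)
        then show "\<bar>Phi ((gg n)(b := deriv (deriv (gg n b)))) y\<bar> \<le> K * (1 + norm (x - y))\<^sup>2 * E y"
          unfolding P2[OF b] abs_mult using E0 by simp
      qed
      also have "\<dots> = (?N * K) * ((1 + norm (x - y)) ^ 2 * E y)" by simp
      finally show "norm (v y * (\<Sum>b\<in>Basis. Phi ((gg n)(b := deriv (deriv (gg n b)))) y)) \<le> \<bar>v y\<bar> * ((?N * K) * ((1 + norm (x - y)) ^ 2 * E y))"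
        by (simp add: abs_mult mult_left_mono)
    qed
  next
    show "(\<lambda>y. v y * (\<Sum>b\<in>Basis. Phi ((gg n)(b := deriv (deriv (gg n b)))) y)) \<in> borel_measurable lborel" for n
      using pm(2)[of _ n] by (auto intro!: borel_measurable_times borel_measurable_sum)
    show "(\<lambda>y. v y * ((4 * a\<^sup>2 * (norm (x - y))\<^sup>2 - 2 * a * ?N) * E y)) \<in> borel_measurable lborel"
      by measurable
  qed
  show ?thesis
    using LIMSEQ_unique[OF lim1 lim2[unfolded main]] by (simp add: E_def)
qed

section \<open>Gaussian mollification\<close>

text \<open>This is pi^(N/2); the type argument fixes the dimension N.\<close>

definition gauss_mass :: "'a::euclidean_space itself \<Rightarrow> real" where
  "gauss_mass _ = (LINT z|lborel. exp (- (norm (z::'a))\<^sup>2))"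

text \<open>Mollification with a Gaussian of width 1 / s, left unnormalised: as s grows it
  approximates \<open>gauss_mass\<close> times k.\<close>

definition moll :: "('a::euclidean_space \<Rightarrow> real) \<Rightarrow> real \<Rightarrow> 'a \<Rightarrow> real" where
  "moll k s x = s ^ DIM('a) * (LINT y|lborel. k y * exp (- s\<^sup>2 * (norm (x - y))\<^sup>2))"

lemma integrable_gauss0: "integrable lborel (\<lambda>z::'a::euclidean_space. exp (- (norm z)\<^sup>2))"
  using integrable_gaussian[of 1 "0::'a"] by simp

lemma gauss_mass_pos: "0 < gauss_mass TYPE('a::euclidean_space)"
proof -
  have "gauss_mass TYPE('a) \<noteq> 0"
  proof
    assume "gauss_mass TYPE('a) = 0"
    then have "AE z::'a in lborel. exp (- (norm z)\<^sup>2) = 0"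
      unfolding gauss_mass_def using integral_nonneg_eq_0_iff_AE[OF integrable_gauss0[where 'a='a]] by simp
    then have "AE z::'a in lborel. False" by simp
    then obtain N :: "'a set" where N: "{z \<in> space lborel. \<not> False} \<subseteq> N" "emeasure lborel N = 0"
      by (rule AE_E)
    then have "N = UNIV" by auto
    then show False using N(2) by simp
  qed
  moreover have "0 \<le> gauss_mass TYPE('a)" unfolding gauss_mass_def by (intro Bochner_Integration.integral_nonneg) simp
  ultimately show ?thesis by simp
qed

lemma moll_affine:
  fixes k :: "'a::euclidean_space \<Rightarrow> real"
  assumes [measurable]: "k \<in> borel_measurable borel" and s: "0 < s"
  shows "moll k s x = (LINT z|lborel. k (x + (1 / s) *\<^sub>R z) * exp (- (norm z)\<^sup>2))"
proof -
  have "(LINT y|lborel. k y * exp (- s\<^sup>2 * (norm (x - y))\<^sup>2))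
    = \<bar>1 / s\<bar> ^ DIM('a) * (LINT z|lborel. k (x + (1 / s) *\<^sub>R z) * exp (- s\<^sup>2 * (norm (x - (x + (1 / s) *\<^sub>R z)))\<^sup>2))"
    by (rule integrable_affine_euclidean(2)) (use s in auto)
  moreover have "- s\<^sup>2 * (norm (x - (x + (1 / s) *\<^sub>R z)))\<^sup>2 = - (norm z)\<^sup>2" for z :: 'a
    using s by (simp add: power_mult_distrib power_divide)
  ultimately show ?thesis using s by (simp add: moll_def power_one_over)
qed

text \<open>In the variable z = s (y - x) the total mass is free of s, while the second moment is of
  order s^-2; the latter makes localisation errors vanish.\<close>

lemma moll_gauss_moments:
  fixes x :: "'a::euclidean_space"
  assumes s: "0 < s"
  shows "s ^ DIM('a) * (LINT y|lborel. exp (- s\<^sup>2 * (norm (x - y))\<^sup>2)) = gauss_mass TYPE('a)"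
    and "s ^ DIM('a) * (LINT y|lborel. (norm (x - y))\<^sup>2 * exp (- s\<^sup>2 * (norm (x - y))\<^sup>2))
      = (LINT z|lborel. (norm (z::'a))\<^sup>2 * exp (- (norm z)\<^sup>2)) / s\<^sup>2"
proof -
  show "s ^ DIM('a) * (LINT y|lborel. exp (- s\<^sup>2 * (norm (x - y))\<^sup>2)) = gauss_mass TYPE('a)"
    using moll_affine[of "\<lambda>_. 1" s x] s by (simp add: moll_def gauss_mass_def)
  have "(\<lambda>y. (norm (x - y))\<^sup>2) \<in> borel_measurable borel" by measurable
  from moll_affine[OF this s, of x]
  show "s ^ DIM('a) * (LINT y|lborel. (norm (x - y))\<^sup>2 * exp (- s\<^sup>2 * (norm (x - y))\<^sup>2))
      = (LINT z|lborel. (norm (z::'a))\<^sup>2 * exp (- (norm z)\<^sup>2)) / s\<^sup>2"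
    using s by (simp add: moll_def power_divide)
qed

lemma integrable_gauss_moment2:
  fixes x :: "'a::euclidean_space"
  assumes s: "0 < s"
  shows "integrable lborel (\<lambda>y. (norm (x - y))\<^sup>2 * exp (- s\<^sup>2 * (norm (x - y))\<^sup>2))"
proof -
  have s2: "0 < s\<^sup>2" using s by simp
  obtain C where C: "C > 0" "\<And>r. 0 \<le> r \<Longrightarrow> (1 + r) ^ 2 * exp (- s\<^sup>2 * r\<^sup>2) \<le> C * exp (- (s\<^sup>2/2) * r\<^sup>2)"
    using poly_gauss_bound[OF s2] by blast
  have "integrable lborel (\<lambda>y. C * exp (- (s\<^sup>2/2) * (norm (x - y))\<^sup>2))"
    using s2 by (intro integrable_mult_right integrable_gaussian) simp
  then show ?thesis
  proof (rule Bochner_Integration.integrable_bound)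
    show "AE y in lborel. norm ((norm (x - y))\<^sup>2 * exp (- s\<^sup>2 * (norm (x - y))\<^sup>2)) \<le> norm (C * exp (- (s\<^sup>2/2) * (norm (x - y))\<^sup>2))"
    proof (rule AE_I2)
      fix y :: 'a
      have "(norm (x - y))\<^sup>2 * exp (- s\<^sup>2 * (norm (x - y))\<^sup>2) \<le> (1 + norm (x - y))\<^sup>2 * exp (- s\<^sup>2 * (norm (x - y))\<^sup>2)"
        by (intro mult_right_mono power_mono) auto
      also have "\<dots> \<le> C * exp (- (s\<^sup>2/2) * (norm (x - y))\<^sup>2)" by (rule C(2)) simp
      finally show "norm ((norm (x - y))\<^sup>2 * exp (- s\<^sup>2 * (norm (x - y))\<^sup>2)) \<le> norm (C * exp (- (s\<^sup>2/2) * (norm (x - y))\<^sup>2))"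
        using C(1) by (simp add: abs_mult)
    qed
  qed simp
qed

text \<open>By Fubini the box integral of the mollification is a Gaussian average of A(h), the
  integral over the box of k translated by h = z / s. A is bounded and continuous at 0, so dominated
  convergence applies. This weak convergence suffices because inequalities are recovered from box
  integrals.\<close>

lemma box_integral_moll_tendsto:
  fixes k :: "'a::euclidean_space \<Rightarrow> real"
  assumes [measurable]: "k \<in> borel_measurable borel" and k2: "integrable lborel (\<lambda>y. (k y)\<^sup>2)"
  shows "(\<lambda>n. LINT x:box l u|lborel. moll k (real (Suc n)) x) \<longlonglongrightarrow> gauss_mass TYPE('a) * (LINT x:box l u|lborel. k x)"
    and "\<And>n. set_integrable lborel (box l u) (moll k (real (Suc n)))"
proof -
  \<comment> \<open>A bound for every A(h): in the box |k| <= 1 + k^2, and the integral of k^2 is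
    translation invariant.\<close>
  define P where "P = (LINT x|lborel. indicat_real (box l u) x) + (LINT y|lborel. (k y)\<^sup>2)"
  define A where "A h = (LINT x|lborel. indicat_real (box l u) x * k (x + h))" for h
  have ib: "integrable lborel (indicat_real (box l u))"
    using emeasure_lborel_box_finite[of l u] by (simp add: integrable_indicator_iff)
  have k2h: "integrable lborel (\<lambda>x. (k (x + h))\<^sup>2)" "(LINT x|lborel. (k (x + h))\<^sup>2) = (LINT x|lborel. (k x)\<^sup>2)" for h
    using integrable_affine_euclidean[of 1 "\<lambda>y. (k y)\<^sup>2" h] k2 by (auto simp: add.commute)
  have ptw: "\<bar>indicat_real (box l u) x * k (x + h)\<bar> \<le> indicat_real (box l u) x + (k (x + h))\<^sup>2" for x h
  proof -
    have "2 * \<bar>k (x + h)\<bar> \<le> 1 + (k (x + h))\<^sup>2" using sum_squares_bound[of 1 "\<bar>k (x + h)\<bar>"] by simp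
    then have "\<bar>k (x + h)\<bar> \<le> 1 + (k (x + h))\<^sup>2" by simp
    then show ?thesis by (auto split: split_indicator)
  qed
  have iA: "integrable lborel (\<lambda>x. indicat_real (box l u) x * k (x + h))" for h
    by (rule Bochner_Integration.integrable_bound[OF Bochner_Integration.integrable_add[OF ib k2h(1)[of h]]])
      (use ptw[of _ h] in \<open>auto intro!: AE_I2 order_trans[OF _ abs_ge_self]\<close>)
  have absA: "(LINT x|lborel. \<bar>indicat_real (box l u) x * k (x + h)\<bar>) \<le> P" for h
  proof -
    have "(LINT x|lborel. \<bar>indicat_real (box l u) x * k (x + h)\<bar>) \<le> (LINT x|lborel. indicat_real (box l u) x + (k (x + h))\<^sup>2)"
      by (rule integral_mono) (use iA[of h] ib k2h ptw in auto)
    also have "\<dots> = P" unfolding P_def using ib k2h[of h] by simp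
    finally show ?thesis .
  qed
  have A_le: "\<bar>A h\<bar> \<le> P" for h
    unfolding A_def using absA[of h] integral_abs_bound[of lborel "\<lambda>x. indicat_real (box l u) x * k (x + h)"] by linarith
  have AE_frontier: "AE y in lborel. y \<notin> cbox l u - box l u" by (rule AE_not_in[OF null_sets_cbox_Diff_box])
  have A_lim: "(\<lambda>n. A (h n)) \<longlonglongrightarrow> A 0" if h: "h \<longlonglongrightarrow> 0" "\<And>n. norm (h n) \<le> r" for h r
  proof -
    obtain B where B: "\<And>x. x \<in> box l u \<Longrightarrow> norm x \<le> B" using bounded_box[of l u] by (auto simp: bounded_iff)
    \<comment> \<open>The translation is moved from k, which may be discontinuous everywhere, to the
      indicator of the box, which is continuous off the frontier.\<close>
    have shift: "A h' = (LINT y|lborel. indicat_real (box l u) (y - h') * k y)" for h'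
      unfolding A_def using integrable_affine_euclidean(2)[of 1 "\<lambda>y. indicat_real (box l u) (y - h') * k y" h']
      by (simp add: add.commute)
    have "(\<lambda>n. LINT y|lborel. indicat_real (box l u) (y - h n) * k y) \<longlonglongrightarrow> (LINT y|lborel. indicat_real (box l u) (y - 0) * k y)"
    proof (rule integral_dominated_convergence[where w="\<lambda>y. indicat_real (cball 0 (B + r)) y + (k y)\<^sup>2"])
      show "integrable lborel (\<lambda>y. indicat_real (cball 0 (B + r)) y + (k y)\<^sup>2)"
        using emeasure_lborel_cball_finite[of 0 "B + r"] k2
        by (intro Bochner_Integration.integrable_add) (auto simp: integrable_indicator_iff)
      show "AE y in lborel. (\<lambda>n. indicat_real (box l u) (y - h n) * k y) \<longlonglongrightarrow> indicat_real (box l u) (y - 0) * k y"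
        using AE_frontier
      proof eventually_elim
        case (elim y)
        have yl: "(\<lambda>n. y - h n) \<longlonglongrightarrow> y" using tendsto_diff[OF tendsto_const h(1)] by simp
        consider "y \<in> box l u" | "y \<in> - cbox l u" using elim by blast
        then have "\<forall>\<^sub>F n in sequentially. indicat_real (box l u) (y - h n) = indicat_real (box l u) y"
        proof cases
          case 1
          have "\<forall>\<^sub>F n in sequentially. y - h n \<in> box l u" by (rule topological_tendstoD[OF yl open_box 1])
          then show ?thesis by eventually_elim (use 1 in simp)
        next
          case 2
          have "\<forall>\<^sub>F n in sequentially. y - h n \<in> - cbox l u"
            by (rule topological_tendstoD[OF yl _ 2]) (simp add: closed_cbox open_Compl)
          then show ?thesis by eventually_elim (use 2 box_subset_cbox[of l u] in \<open>auto simp: indicator_def\<close>)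
        qed
        then have "(\<lambda>n. indicat_real (box l u) (y - h n)) \<longlonglongrightarrow> indicat_real (box l u) y" by (rule tendsto_eventually)
        then show ?case by (intro tendsto_mult tendsto_const) simp
      qed
      show "AE y in lborel. norm (indicat_real (box l u) (y - h n) * k y) \<le> indicat_real (cball 0 (B + r)) y + (k y)\<^sup>2" for n
      proof (rule AE_I2)
        fix y
        have "y \<in> cball 0 (B + r)" if "y - h n \<in> box l u"
        proof -
          have "norm y \<le> norm (y - h n) + norm (h n)" by (metis norm_triangle_sub add.commute)
          then show ?thesis using B[OF that] h(2)[of n] by simp
        qed
        then show "norm (indicat_real (box l u) (y - h n) * k y) \<le> indicat_real (cball 0 (B + r)) y + (k y)\<^sup>2"
          using ptw[of "y - h n" "h n"] by (auto split: split_indicator split_indicator_asm)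
      qed
    qed auto
    then show ?thesis unfolding shift .
  qed
  \<comment> \<open>For fixed z the integral in x of the absolute value is at most P times the
    Gaussian, which is integrable in z.\<close>
  have prod_int: "integrable (lborel \<Otimes>\<^sub>M lborel) (\<lambda>(z, x). exp (- (norm z)\<^sup>2) * (indicat_real (box l u) x * k (x + c *\<^sub>R z)))" for c :: real
  proof (rule lborel_pair.Fubini_integrable)
    show "(\<lambda>(z, x). exp (- (norm z)\<^sup>2) * (indicat_real (box l u) x * k (x + c *\<^sub>R z))) \<in> borel_measurable (lborel \<Otimes>\<^sub>M lborel)"
      by measurable
    show "integrable lborel (\<lambda>z. LINT x|lborel. norm (case (z, x) of (z, x) \<Rightarrow> exp (- (norm z)\<^sup>2) * (indicat_real (box l u) x * k (x + c *\<^sub>R z))))"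
    proof (rule Bochner_Integration.integrable_bound[OF integrable_mult_right[OF integrable_gauss0, of P]])
      show "AE z in lborel. norm (LINT x|lborel. norm (case (z, x) of (z, x) \<Rightarrow> exp (- (norm z)\<^sup>2) * (indicat_real (box l u) x * k (x + c *\<^sub>R z)))) \<le> norm (P * exp (- (norm z)\<^sup>2))"
      proof (rule AE_I2)
        fix z :: 'a
        have "(LINT x|lborel. norm (case (z, x) of (z, x) \<Rightarrow> exp (- (norm z)\<^sup>2) * (indicat_real (box l u) x * k (x + c *\<^sub>R z))))
          = exp (- (norm z)\<^sup>2) * (LINT x|lborel. \<bar>indicat_real (box l u) x * k (x + c *\<^sub>R z)\<bar>)"
          by (simp add: abs_mult)
        moreover have "0 \<le> (LINT x|lborel. \<bar>indicat_real (box l u) x * k (x + c *\<^sub>R z)\<bar>)" by (intro Bochner_Integration.integral_nonneg) simp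
        ultimately show "norm (LINT x|lborel. norm (case (z, x) of (z, x) \<Rightarrow> exp (- (norm z)\<^sup>2) * (indicat_real (box l u) x * k (x + c *\<^sub>R z)))) \<le> norm (P * exp (- (norm z)\<^sup>2))"
          using absA[of "c *\<^sub>R z"] by (simp add: abs_mult mult.commute)
      qed
    qed measurable
    show "AE z in lborel. integrable lborel (\<lambda>x. case (z, x) of (z, x) \<Rightarrow> exp (- (norm z)\<^sup>2) * (indicat_real (box l u) x * k (x + c *\<^sub>R z)))"
      using iA by auto
  qed
  have inner: "(LINT z|lborel. exp (- (norm z)\<^sup>2) * (indicat_real (box l u) x * k (x + (1 / s) *\<^sub>R z))) = indicat_real (box l u) x * moll k s x" if "s > 0" for s x
    unfolding moll_affine[OF assms(1) that] integral_mult_right_zero[symmetric] by (rule Bochner_Integration.integral_cong) (simp_all add: mult_ac)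
  show "set_integrable lborel (box l u) (moll k (real (Suc n)))" for n
  proof -
    have "integrable lborel (\<lambda>x. LINT z|lborel. exp (- (norm z)\<^sup>2) * (indicat_real (box l u) x * k (x + (1 / real (Suc n)) *\<^sub>R z)))"
      using lborel_pair.integrable_snd[OF prod_int[of "1 / real (Suc n)"]] by simp
    moreover have "(LINT z|lborel. exp (- (norm z)\<^sup>2) * (indicat_real (box l u) x * k (x + (1 / real (Suc n)) *\<^sub>R z))) = indicat_real (box l u) x * moll k (real (Suc n)) x" for x
      by (rule inner) simp
    ultimately show ?thesis by (simp add: set_integrable_def)
  qed
  have eq: "(LINT x:box l u|lborel. moll k (real (Suc n)) x) = (LINT z|lborel. exp (- (norm z)\<^sup>2) * A ((1 / real (Suc n)) *\<^sub>R z))" for n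
  proof -
    have "(LINT x:box l u|lborel. moll k (real (Suc n)) x) = (LINT x|lborel. LINT z|lborel. exp (- (norm z)\<^sup>2) * (indicat_real (box l u) x * k (x + (1 / real (Suc n)) *\<^sub>R z)))"
      unfolding set_lebesgue_integral_def by (rule Bochner_Integration.integral_cong) (simp_all only: inner[of "real (Suc n)"] of_nat_0_less_iff zero_less_Suc real_scaleR_def)
    also have "\<dots> = (LINT z|lborel. LINT x|lborel. exp (- (norm z)\<^sup>2) * (indicat_real (box l u) x * k (x + (1 / real (Suc n)) *\<^sub>R z)))"
      by (rule lborel_pair.Fubini_integral[OF prod_int])
    also have "\<dots> = (LINT z|lborel. exp (- (norm z)\<^sup>2) * A ((1 / real (Suc n)) *\<^sub>R z))" unfolding A_def by simp
    finally show ?thesis .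
  qed
  have Am: "A \<in> borel_measurable borel"
    unfolding A_def by measurable
  have "(\<lambda>n. LINT z|lborel. exp (- (norm (z::'a))\<^sup>2) * A ((1 / real (Suc n)) *\<^sub>R z)) \<longlonglongrightarrow> (LINT z|lborel. exp (- (norm (z::'a))\<^sup>2) * A 0)"
  proof (rule integral_dominated_convergence[where w="\<lambda>z. P * exp (- (norm z)\<^sup>2)"])
    show "integrable lborel (\<lambda>z::'a. P * exp (- (norm z)\<^sup>2))" by (rule integrable_mult_right[OF integrable_gauss0])
    show "AE z in lborel. (\<lambda>n. exp (- (norm (z::'a))\<^sup>2) * A ((1 / real (Suc n)) *\<^sub>R z)) \<longlonglongrightarrow> exp (- (norm z)\<^sup>2) * A 0"
    proof (rule AE_I2)
      fix z :: 'a
      have "(\<lambda>n. 1 / real (Suc n)) \<longlonglongrightarrow> 0" using LIMSEQ_inverse_real_of_nat by (simp add: inverse_eq_divide)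
      then have "(\<lambda>n. (1 / real (Suc n)) *\<^sub>R z) \<longlonglongrightarrow> 0 *\<^sub>R z" by (intro tendsto_scaleR tendsto_const)
      then have "(\<lambda>n. A ((1 / real (Suc n)) *\<^sub>R z)) \<longlonglongrightarrow> A 0"
        by (intro A_lim[where r="norm z"]) (auto simp: divide_le_eq mult_le_cancel_left1)
      then show "(\<lambda>n. exp (- (norm z)\<^sup>2) * A ((1 / real (Suc n)) *\<^sub>R z)) \<longlonglongrightarrow> exp (- (norm z)\<^sup>2) * A 0"
        by (intro tendsto_mult tendsto_const)
    qed
    show "AE z in lborel. norm (exp (- (norm (z::'a))\<^sup>2) * A ((1 / real (Suc n)) *\<^sub>R z)) \<le> P * exp (- (norm z)\<^sup>2)" for n
    proof (rule AE_I2)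
      fix z :: 'a
      show "norm (exp (- (norm (z::'a))\<^sup>2) * A ((1 / real (Suc n)) *\<^sub>R z)) \<le> P * exp (- (norm z)\<^sup>2)"
        using mult_right_mono[OF A_le[of "(1 / real (Suc n)) *\<^sub>R z"], of "exp (- (norm z)\<^sup>2)"]
        by (simp add: abs_mult mult.commute)
    qed
    show "(\<lambda>z::'a. exp (- (norm z)\<^sup>2) * A ((1 / real (Suc n)) *\<^sub>R z)) \<in> borel_measurable lborel" for n
      using Am by measurable
  qed auto
  moreover have "(LINT z|lborel. exp (- (norm (z::'a))\<^sup>2) * A 0) = gauss_mass TYPE('a) * (LINT x:box l u|lborel. k x)"
    by (simp add: gauss_mass_def A_def set_lebesgue_integral_def)
  ultimately show "(\<lambda>n. LINT x:box l u|lborel. moll k (real (Suc n)) x) \<longlonglongrightarrow> gauss_mass TYPE('a) * (LINT x:box l u|lborel. k x)"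
    unfolding eq by simp
qed

text \<open>The pointwise bounds are integrated over boxes, where the mollifications converge; the
  bound almost everywhere is then read off from the box integrals.\<close>

lemma moll_limit_AE_le:
  fixes k g :: "'a::euclidean_space \<Rightarrow> real"
  assumes km[measurable]: "k \<in> borel_measurable borel" and k2: "integrable lborel (\<lambda>y. (k y)\<^sup>2)"
    and U: "open U" and [measurable]: "g \<in> borel_measurable borel" and G: "\<And>x. x \<in> U \<Longrightarrow> \<bar>g x\<bar> \<le> G"
    and le: "\<forall>\<^sub>F n in sequentially. \<forall>x\<in>U. moll k (real (Suc n)) x \<le> g x"
  shows "AE x in lborel. x \<in> U \<longrightarrow> gauss_mass TYPE('a) * k x \<le> g x"
proof -
  have [measurable]: "U \<in> sets borel" using U by simp
  let ?Z = "gauss_mass TYPE('a)"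
  \<comment> \<open>Set to 0 outside U, because g is controlled on U only while integrability over
    all boxes is required.\<close>
  define F where "F x = indicat_real U x * (?Z * k x - g x)" for x
  have ibox: "set_integrable lborel S k" if "S \<subseteq> cbox a b" "S \<in> sets borel" for S a b
  proof -
    have [measurable]: "S \<in> sets borel" by fact
    have "integrable lborel (\<lambda>x. indicat_real (cbox a b) x + (k x)\<^sup>2)"
      using emeasure_lborel_cbox_finite[of a b] k2 by (intro Bochner_Integration.integrable_add) (auto simp: integrable_indicator_iff)
    then show ?thesis unfolding set_integrable_def
    proof (rule Bochner_Integration.integrable_bound)
      show "AE x in lborel. norm (indicat_real S x *\<^sub>R k x) \<le> norm (indicat_real (cbox a b) x + (k x)\<^sup>2)"
      proof (rule AE_I2)
        fix x
        have "\<bar>k x\<bar> \<le> 1 + (k x)\<^sup>2" using sum_squares_bound[of 1 "\<bar>k x\<bar>"] by simp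
        then show "norm (indicat_real S x *\<^sub>R k x) \<le> norm (indicat_real (cbox a b) x + (k x)\<^sup>2)"
          using that(1) by (auto split: split_indicator)
      qed
    qed simp
  qed
  have igU: "set_integrable lborel S g" if "S \<subseteq> cbox a b" "S \<in> sets borel" "S \<subseteq> U" for S a b
  proof -
    have [measurable]: "S \<in> sets borel" by fact
    have "integrable lborel (\<lambda>x. \<bar>G\<bar> * indicat_real (cbox a b) x)"
      using emeasure_lborel_cbox_finite[of a b] by (intro integrable_mult_right) (auto simp: integrable_indicator_iff)
    then show ?thesis unfolding set_integrable_def
    proof (rule Bochner_Integration.integrable_bound)
      show "AE x in lborel. norm (indicat_real S x *\<^sub>R g x) \<le> norm (\<bar>G\<bar> * indicat_real (cbox a b) x)"
        using that(1,3) G by (force split: split_indicator)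
    qed simp
  qed
  have "AE x in lborel. x \<in> U \<longrightarrow> F x \<le> 0"
  proof (rule AE_le_zero_of_box_integrals[OF _ U])
    show "F \<in> borel_measurable borel" unfolding F_def by measurable
    show "set_integrable lborel (cbox a b) F" for a b
    proof -
      have "set_integrable lborel (U \<inter> cbox a b) (\<lambda>x. ?Z * k x - g x)"
        using ibox[of "U \<inter> cbox a b" a b] igU[of "U \<inter> cbox a b" a b] by (intro set_integral_diff set_integrable_mult_right) auto
      moreover have "(\<lambda>x. indicat_real (U \<inter> cbox a b) x *\<^sub>R (?Z * k x - g x)) = (\<lambda>x. indicat_real (cbox a b) x *\<^sub>R F x)"
        by (auto simp: F_def split: split_indicator)
      ultimately show ?thesis by (simp only: set_integrable_def)
    qed
    show "(LINT x:box a b|lborel. F x) \<le> 0" if ab: "cbox a b \<subseteq> U" for a b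
    proof -
      have sub: "box a b \<subseteq> cbox a b" "box a b \<subseteq> U" using ab box_subset_cbox[of a b] by auto
      have "?Z * (LINT x:box a b|lborel. k x) \<le> (LINT x:box a b|lborel. g x)"
      proof (rule LIMSEQ_le_const2[OF box_integral_moll_tendsto(1)[OF km k2]])
        obtain N where N: "\<And>n. n \<ge> N \<Longrightarrow> \<forall>x\<in>U. moll k (real (Suc n)) x \<le> g x" using le by (auto simp: eventually_sequentially)
        have "(LINT x:box a b|lborel. moll k (real (Suc n)) x) \<le> (LINT x:box a b|lborel. g x)" if "n \<ge> N" for n
          by (rule set_integral_mono[OF box_integral_moll_tendsto(2)[OF km k2]]) (use igU[OF sub(1) _ sub(2)] N[OF that] sub in auto)
        then show "\<exists>N. \<forall>n\<ge>N. (LINT x:box a b|lborel. moll k (real (Suc n)) x) \<le> (LINT x:box a b|lborel. g x)" by blast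
      qed
      moreover have "(LINT x:box a b|lborel. F x) = (LINT x:box a b|lborel. ?Z * k x - g x)"
        by (rule set_lebesgue_integral_cong) (use sub in \<open>auto simp: F_def\<close>)
      moreover have "\<dots> = (LINT x:box a b|lborel. ?Z * k x) - (LINT x:box a b|lborel. g x)"
        using ibox[OF sub(1)] igU[OF sub(1) _ sub(2)] by (intro set_integral_diff set_integrable_mult_right) auto
      moreover have "(LINT x:box a b|lborel. ?Z * k x) = ?Z * (LINT x:box a b|lborel. k x)" by simp
      ultimately show ?thesis by simp
    qed
  qed
  then show ?thesis by eventually_elim (auto simp: F_def split: split_indicator_asm)
qed


section \<open>The maximum principle\<close>

text \<open>Only second derivatives along the coordinate axes are needed, so no differentiability in
  several variables is asked for.\<close>

definition has_laplacian :: "('a::euclidean_space \<Rightarrow> real) \<Rightarrow> real \<Rightarrow> 'a \<Rightarrow> bool" where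
  "has_laplacian F L x \<longleftrightarrow> (\<exists>g' D. (\<Sum>b\<in>Basis. D b) = L \<and>
     (\<forall>b\<in>Basis. (\<forall>\<^sub>F t in nhds 0. ((\<lambda>s. F (x + s *\<^sub>R b)) has_real_derivative g' b t) (at t)) \<and>
        (g' b has_real_derivative D b) (at 0)))"

lemma has_laplacian_diff:
  assumes "has_laplacian F L x" "has_laplacian G M x"
  shows "has_laplacian (\<lambda>x. F x - G x) (L - M) x"
proof -
  obtain f' D where f: "(\<Sum>b\<in>Basis. D b) = L"
    "\<And>b. b \<in> Basis \<Longrightarrow> (\<forall>\<^sub>F t in nhds 0. ((\<lambda>s. F (x + s *\<^sub>R b)) has_real_derivative f' b t) (at t)) \<and> (f' b has_real_derivative D b) (at 0)"
    using assms(1) unfolding has_laplacian_def by blast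
  obtain g' E where g: "(\<Sum>b\<in>Basis. E b) = M"
    "\<And>b. b \<in> Basis \<Longrightarrow> (\<forall>\<^sub>F t in nhds 0. ((\<lambda>s. G (x + s *\<^sub>R b)) has_real_derivative g' b t) (at t)) \<and> (g' b has_real_derivative E b) (at 0)"
    using assms(2) unfolding has_laplacian_def by blast
  show ?thesis unfolding has_laplacian_def
  proof (intro exI[of _ "\<lambda>b t. f' b t - g' b t"] exI[of _ "\<lambda>b. D b - E b"] conjI ballI)
    show "(\<Sum>b\<in>Basis. D b - E b) = L - M" using f(1) g(1) by (simp add: sum_subtractf)
    fix b :: 'a assume b: "b \<in> Basis"
    show "\<forall>\<^sub>F t in nhds 0. ((\<lambda>s. F (x + s *\<^sub>R b) - G (x + s *\<^sub>R b)) has_real_derivative f' b t - g' b t) (at t)"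
      using f(2)[OF b, THEN conjunct1] g(2)[OF b, THEN conjunct1] by eventually_elim (rule DERIV_diff)
    show "((\<lambda>t. f' b t - g' b t) has_real_derivative D b - E b) (at 0)"
      using f(2)[OF b] g(2)[OF b] by (intro DERIV_diff) auto
  qed
qed

lemma has_laplacian_cmult:
  assumes "has_laplacian F L x"
  shows "has_laplacian (\<lambda>x. c * F x) (c * L) x"
proof -
  obtain f' D where f: "(\<Sum>b\<in>Basis. D b) = L"
    "\<And>b. b \<in> Basis \<Longrightarrow> (\<forall>\<^sub>F t in nhds 0. ((\<lambda>s. F (x + s *\<^sub>R b)) has_real_derivative f' b t) (at t)) \<and> (f' b has_real_derivative D b) (at 0)"
    using assms unfolding has_laplacian_def by blast
  show ?thesis unfolding has_laplacian_def
  proof (intro exI[of _ "\<lambda>b t. c * f' b t"] exI[of _ "\<lambda>b. c * D b"] conjI ballI)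
    show "(\<Sum>b\<in>Basis. c * D b) = c * L" using f(1) by (simp add: sum_distrib_left[symmetric])
    fix b :: 'a assume b: "b \<in> Basis"
    show "\<forall>\<^sub>F t in nhds 0. ((\<lambda>s. c * F (x + s *\<^sub>R b)) has_real_derivative c * f' b t) (at t)"
      using f(2)[OF b, THEN conjunct1] by eventually_elim (rule DERIV_cmult)
    show "((\<lambda>t. c * f' b t) has_real_derivative c * D b) (at 0)"
      using f(2)[OF b] by (intro DERIV_cmult) auto
  qed
qed

text \<open>Otherwise g' vanishes at 0 and is positive just to the right of it, so that g exceeds
  its value at 0 by the mean value theorem.\<close>

lemma second_derivative_local_max:
  fixes g g' :: "real \<Rightarrow> real"
  assumes d: "\<forall>\<^sub>F t in nhds 0. (g has_real_derivative g' t) (at t)" and D: "(g' has_real_derivative D) (at 0)"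
    and m: "\<forall>\<^sub>F t in nhds 0. g t \<le> g 0"
  shows "D \<le> 0"
proof (rule ccontr)
  assume "\<not> D \<le> 0"
  then have D0: "D > 0" by simp
  obtain e1 where e1: "e1 > 0" "\<And>t. dist t 0 < e1 \<Longrightarrow> (g has_real_derivative g' t) (at t)"
    using d unfolding eventually_nhds_metric by blast
  obtain e2 where e2: "e2 > 0" "\<And>t. dist t 0 < e2 \<Longrightarrow> g t \<le> g 0"
    using m unfolding eventually_nhds_metric by blast
  have g0: "g' 0 = 0"
    by (rule DERIV_local_max[of g "g' 0" 0 e2]) (use e1 e2 in auto)
  obtain e3 where e3: "e3 > 0" "\<And>h. 0 < h \<Longrightarrow> h < e3 \<Longrightarrow> g' 0 < g' (0 + h)"
    using DERIV_pos_inc_right[OF D D0] by auto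
  define t where "t = min e1 (min e2 e3) / 2"
  have t: "0 < t" "t < e1" "t < e2" "t < e3" using e1 e2 e3 by (auto simp: t_def)
  have "\<exists>z. 0 < z \<and> z < t \<and> g t - g 0 = (t - 0) * g' z"
    by (rule MVT2[OF t(1)]) (use e1(2) t in auto)
  then obtain z where z: "0 < z" "z < t" "g t - g 0 = t * g' z" by auto
  have "0 < g' z" using e3(2)[of z] z t g0 by simp
  then have "0 < g t - g 0" using z t by simp
  then show False using e2(2)[of t] t by simp
qed

text \<open>A maximum above \<eta> is attained in the interior, where every second derivative along
  an axis is at most 0. Hence positivity of the Laplacian is asked for only where F exceeds
  \<eta>.\<close>

lemma maximum_principle_annulus:
  fixes F :: "'a::euclidean_space \<Rightarrow> real"
  assumes c: "continuous_on {x. R \<le> norm x \<and> norm x \<le> M} F"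
    and bd: "\<And>x. norm x = R \<or> norm x = M \<Longrightarrow> F x \<le> \<eta>"
    and lap: "\<And>x. R < norm x \<Longrightarrow> norm x < M \<Longrightarrow> \<eta> < F x \<Longrightarrow> \<exists>L>0. has_laplacian F L x"
    and x: "R \<le> norm x" "norm x \<le> M"
  shows "F x \<le> \<eta>"
proof (rule ccontr)
  assume neg: "\<not> F x \<le> \<eta>"
  let ?D = "{x::'a. R \<le> norm x \<and> norm x \<le> M}"
  have "compact ?D"
  proof -
    have "closed ?D" by (intro closed_Collect_conj closed_Collect_le continuous_intros)
    moreover have "bounded ?D" by (rule bounded_subset[OF bounded_cball[of 0 M]]) auto
    ultimately show ?thesis by (simp add: compact_eq_bounded_closed)
  qed
  then obtain p where p: "p \<in> ?D" "\<And>y. y \<in> ?D \<Longrightarrow> F y \<le> F p"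
    using continuous_attains_sup[of ?D F] c x by blast
  have Fp: "\<eta> < F p" using p(2)[of x] x neg by simp
  have pi: "R < norm p" "norm p < M" using bd[of p] p(1) Fp by (auto simp: less_le)
  obtain L where L: "L > 0" "has_laplacian F L p" using lap[OF pi Fp] by blast
  obtain g' D where g: "(\<Sum>b\<in>Basis. D b) = L"
    "\<And>b. b \<in> Basis \<Longrightarrow> (\<forall>\<^sub>F t in nhds 0. ((\<lambda>s. F (p + s *\<^sub>R b)) has_real_derivative g' b t) (at t)) \<and> (g' b has_real_derivative D b) (at 0)"
    using L(2) unfolding has_laplacian_def by blast
  have "D b \<le> 0" if b: "b \<in> Basis" for b
  proof (rule second_derivative_local_max)
    show "\<forall>\<^sub>F t in nhds 0. ((\<lambda>s. F (p + s *\<^sub>R b)) has_real_derivative g' b t) (at t)" "(g' b has_real_derivative D b) (at 0)"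
      using g(2)[OF b] by auto
    have op: "open {x::'a. R < norm x \<and> norm x < M}" by (intro open_Collect_conj open_Collect_less continuous_intros)
    have "((\<lambda>t. p + t *\<^sub>R b) \<longlongrightarrow> p + 0 *\<^sub>R b) (nhds 0)" by (intro tendsto_intros filterlim_ident)
    then have "((\<lambda>t. p + t *\<^sub>R b) \<longlongrightarrow> p) (nhds 0)" by simp
    from topological_tendstoD[OF this op] have "\<forall>\<^sub>F t in nhds 0. p + t *\<^sub>R b \<in> {x. R < norm x \<and> norm x < M}"
      using pi by simp
    then show "\<forall>\<^sub>F t in nhds 0. F (p + t *\<^sub>R b) \<le> F (p + 0 *\<^sub>R b)"
      by eventually_elim (use p(2) in auto)
  qed
  then have "L \<le> 0" using g(1) by (metis sum_nonpos)
  then show False using L(1) by simp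
qed

section \<open>Differential inequalities for mollifications and comparison outside a ball\<close>

lemma norm_shift_sq:
  fixes z b :: "'a::real_inner"
  assumes "norm b = 1"
  shows "(norm (z + t *\<^sub>R b))\<^sup>2 = (norm z)\<^sup>2 + 2 * t * (z \<bullet> b) + t\<^sup>2"
  unfolding power2_norm_eq_inner using assms
  by (simp add: inner_add_left inner_add_right inner_commute power2_eq_square norm_eq_1 algebra_simps)

lemma norm_shift_lower:
  fixes z w :: "'a::real_inner"
  shows "(norm z)\<^sup>2 / 2 - (norm w)\<^sup>2 \<le> (norm (z + w))\<^sup>2"
proof -
  have "norm z \<le> norm (z + w) + norm w" by (metis add_diff_cancel_right' norm_triangle_ineq4)
  then have "(norm z)\<^sup>2 \<le> (norm (z + w) + norm w)\<^sup>2" by (intro power_mono) auto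
  also have "\<dots> \<le> 2 * (norm (z + w))\<^sup>2 + 2 * (norm w)\<^sup>2"
    using sum_squares_bound[of "norm (z + w)" "norm w"] by (simp add: power2_sum)
  finally show ?thesis by simp
qed

text \<open>Half of the exponent is given up to move the centre by at most r; this is the domination
  used for continuity and for derivatives of mollifications.\<close>

lemma exp_gauss_shift:
  fixes z w :: "'a::real_inner"
  assumes "0 \<le> a" "norm w \<le> r"
  shows "exp (- a * (norm (z + w))\<^sup>2) \<le> exp (a * r\<^sup>2) * exp (- (a / 2) * (norm z)\<^sup>2)"
proof -
  have "(norm w)\<^sup>2 \<le> r\<^sup>2" using assms by (intro power_mono) auto
  then have "(norm z)\<^sup>2 / 2 - r\<^sup>2 \<le> (norm (z + w))\<^sup>2" using norm_shift_lower[of z w] by simp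
  from mult_left_mono[OF this assms(1)] show ?thesis
    by (simp add: exp_add[symmetric] algebra_simps)
qed

lemma moll_continuous:
  fixes k :: "'a::euclidean_space \<Rightarrow> real"
  assumes [measurable]: "k \<in> borel_measurable borel" and k2: "integrable lborel (\<lambda>y. (k y)\<^sup>2)" and s: "0 < s"
  shows "continuous_on A (moll k s)"
proof -
  have "isCont (\<lambda>x. LINT y|lborel. k y * exp (- s\<^sup>2 * (norm (x - y))\<^sup>2)) x" for x
  proof (rule isCont_integral[where \<delta>=1 and D="\<lambda>y. \<bar>k y\<bar> * (exp (s\<^sup>2 * 1\<^sup>2) * exp (- (s\<^sup>2 / 2) * (norm (x - y))\<^sup>2))"])
    show "isCont (\<lambda>x. k y * exp (- s\<^sup>2 * (norm (x - y))\<^sup>2)) x" for y by (intro continuous_intros)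
    show "integrable lborel (\<lambda>y. \<bar>k y\<bar> * (exp (s\<^sup>2 * 1\<^sup>2) * exp (- (s\<^sup>2 / 2) * (norm (x - y))\<^sup>2)))"
      by (rule integrable_gauss_poly[OF assms(1) _ k2, where a="s\<^sup>2 / 2" and m=0 and C="exp (s\<^sup>2 * 1\<^sup>2)" and x=x])
        (use s in \<open>auto simp: abs_mult\<close>)
    fix x' y assume "dist x' x < 1"
    then have "norm (x' - x) \<le> 1" by (simp add: dist_norm)
    from exp_gauss_shift[OF _ this, of "s\<^sup>2" "x - y"]
    have "exp (- s\<^sup>2 * (norm (x' - y))\<^sup>2) \<le> exp (s\<^sup>2 * 1\<^sup>2) * exp (- (s\<^sup>2 / 2) * (norm (x - y))\<^sup>2)" by simp
    from mult_left_mono[OF this abs_ge_zero[of "k y"]]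
    show "\<bar>k y * exp (- s\<^sup>2 * (norm (x' - y))\<^sup>2)\<bar> \<le> \<bar>k y\<bar> * (exp (s\<^sup>2 * 1\<^sup>2) * exp (- (s\<^sup>2 / 2) * (norm (x - y))\<^sup>2))"
      by (simp add: abs_mult)
  qed auto
  then show ?thesis unfolding moll_def[abs_def] by (auto intro!: continuous_at_imp_continuous_on continuous_intros)
qed

text \<open>Two differentiations under the integral along each axis. The dominating functions are
  valid for |t| < 2 so as to cover unit neighbourhoods of all t with |t| < 1: the first derivative
  has to be known near 0, not only at 0.\<close>

lemma moll_has_laplacian:
  fixes k :: "'a::euclidean_space \<Rightarrow> real"
  assumes km[measurable]: "k \<in> borel_measurable borel" and k2: "integrable lborel (\<lambda>y. (k y)\<^sup>2)" and s: "0 < s"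
  shows "has_laplacian (moll k s) (s ^ DIM('a) * (LINT y|lborel. k y * ((4 * (s\<^sup>2)\<^sup>2 * (norm (x - y))\<^sup>2 - 2 * s\<^sup>2 * real DIM('a)) * exp (- s\<^sup>2 * (norm (x - y))\<^sup>2)))) x"
proof -
  define a where "a = s\<^sup>2"
  have a: "0 < a" using s by (simp add: a_def)
  define e where "e b t y = exp (- a * (norm (x + t *\<^sub>R b - y))\<^sup>2)" for b t y
  define r where "r b t y = (x - y) \<bullet> b + t" for b t y
  define k1 where "k1 b t y = k y * ((- 2 * a * r b t y) * e b t y)" for b t y
  define k2' where "k2' b t y = k y * ((4 * a\<^sup>2 * (r b t y)\<^sup>2 - 2 * a) * e b t y)" for b t y
  have em[measurable]: "e b t \<in> borel_measurable borel" "r b t \<in> borel_measurable borel" for b t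
    unfolding e_def r_def by measurable
  have ebd: "e b t y \<le> exp (4 * a) * exp (- (a / 2) * (norm (x - y))\<^sup>2)" if "b \<in> Basis" "\<bar>t\<bar> < 2" for b t y
    using exp_gauss_shift[of a "t *\<^sub>R b" 2 "x - y"] a that by (simp add: e_def algebra_simps)
  have e0: "0 \<le> e b t y" for b t y by (simp add: e_def)
  have rbd: "\<bar>r b t y\<bar> \<le> 2 * (1 + norm (x - y))" if "b \<in> Basis" "\<bar>t\<bar> < 2" for b t y
  proof -
    have "\<bar>r b t y\<bar> \<le> \<bar>(x - y) \<bullet> b\<bar> + \<bar>t\<bar>" unfolding r_def by (rule abs_triangle_ineq)
    also have "\<dots> \<le> norm (x - y) + 2" using that by (intro add_mono Basis_le_norm) auto
    also have "\<dots> \<le> 2 * (1 + norm (x - y))" by simp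
    finally show ?thesis .
  qed
  have rd: "((\<lambda>t. r b t y) has_real_derivative 1) (at t)" for b t y
    unfolding r_def by (auto intro!: derivative_eq_intros)
  have ed: "((\<lambda>t. e b t y) has_real_derivative (- 2 * a * r b t y) * e b t y) (at t)" if b: "b \<in> Basis" for b t y
  proof -
    have nb: "norm b = 1" using b by simp
    have e': "e b t y = exp (- a * ((norm (x - y))\<^sup>2 + 2 * t * ((x - y) \<bullet> b) + t\<^sup>2))" for t
    proof -
      have sh: "x + t *\<^sub>R b - y = (x - y) + t *\<^sub>R b" by simp
      show ?thesis unfolding e_def sh norm_shift_sq[OF nb] by (rule refl)
    qed
    show ?thesis unfolding e' r_def by (auto intro!: derivative_eq_intros simp: algebra_simps)
  qed
  have k0d: "((\<lambda>t. k y * e b t y) has_real_derivative k1 b t y) (at t)" if "b \<in> Basis" for b t y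
    unfolding k1_def by (rule DERIV_cmult[OF ed[OF that]])
  have k1d: "((\<lambda>t. k1 b t y) has_real_derivative k2' b t y) (at t)" if b: "b \<in> Basis" for b t y
  proof -
    have D: "((\<lambda>t. (- 2 * a * r b t y) * e b t y) has_real_derivative
       (- 2 * a * 1) * e b t y + ((- 2 * a * r b t y) * e b t y) * (- 2 * a * r b t y)) (at t)"
      by (rule DERIV_mult[OF DERIV_cmult[OF rd] ed[OF b]])
    have E: "(- 2 * a * 1) * e b t y + ((- 2 * a * r b t y) * e b t y) * (- 2 * a * r b t y) = (4 * a\<^sup>2 * (r b t y)\<^sup>2 - 2 * a) * e b t y"
      by (simp add: algebra_simps power2_eq_square)
    show ?thesis unfolding k1_def k2'_def E[symmetric] by (rule DERIV_cmult[OF D])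
  qed
  have k1b: "\<bar>k1 b t y\<bar> \<le> \<bar>k y\<bar> * ((4 * a * exp (4 * a)) * ((1 + norm (x - y)) ^ 1 * exp (- (a / 2) * (norm (x - y))\<^sup>2)))" if "b \<in> Basis" "\<bar>t\<bar> < 2" for b t y
  proof -
    have "\<bar>(- 2 * a * r b t y) * e b t y\<bar> = (2 * a * \<bar>r b t y\<bar>) * e b t y" using a e0[of b t y] by (simp add: abs_mult)
    also have "\<dots> \<le> (2 * a * (2 * (1 + norm (x - y)))) * (exp (4 * a) * exp (- (a / 2) * (norm (x - y))\<^sup>2))"
      using a rbd[OF that] ebd[OF that] e0 by (intro mult_mono mult_left_mono) auto
    finally have "\<bar>(- 2 * a * r b t y) * e b t y\<bar> \<le> (4 * a * exp (4 * a)) * ((1 + norm (x - y)) ^ 1 * exp (- (a / 2) * (norm (x - y))\<^sup>2))"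
      by (simp add: algebra_simps)
    from mult_left_mono[OF this abs_ge_zero[of "k y"]] show ?thesis by (simp only: k1_def abs_mult)
  qed
  have k2b: "\<bar>k2' b t y\<bar> \<le> \<bar>k y\<bar> * (((16 * a\<^sup>2 + 2 * a) * exp (4 * a)) * ((1 + norm (x - y)) ^ 2 * exp (- (a / 2) * (norm (x - y))\<^sup>2)))" if "b \<in> Basis" "\<bar>t\<bar> < 2" for b t y
  proof -
    have "(r b t y)\<^sup>2 \<le> (2 * (1 + norm (x - y)))\<^sup>2" using power_mono[OF rbd[OF that, of y], of 2] by simp
    then have "4 * a\<^sup>2 * (r b t y)\<^sup>2 \<le> 4 * a\<^sup>2 * (2 * (1 + norm (x - y)))\<^sup>2" by (intro mult_left_mono) auto
    moreover have "2 * a * 1 \<le> 2 * a * (1 + norm (x - y))\<^sup>2" using a by (intro mult_left_mono one_le_power) auto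
    moreover have "\<bar>4 * a\<^sup>2 * (r b t y)\<^sup>2 - 2 * a\<bar> \<le> 4 * a\<^sup>2 * (r b t y)\<^sup>2 + 2 * a" using a by (simp add: abs_le_iff)
    moreover have "4 * a\<^sup>2 * (2 * (1 + norm (x - y)))\<^sup>2 = 16 * a\<^sup>2 * (1 + norm (x - y))\<^sup>2" by (simp only: power_mult_distrib) simp
    ultimately have "\<bar>4 * a\<^sup>2 * (r b t y)\<^sup>2 - 2 * a\<bar> \<le> (16 * a\<^sup>2 + 2 * a) * (1 + norm (x - y))\<^sup>2"
      unfolding distrib_right by linarith
    then have "\<bar>4 * a\<^sup>2 * (r b t y)\<^sup>2 - 2 * a\<bar> * e b t y \<le> ((16 * a\<^sup>2 + 2 * a) * (1 + norm (x - y))\<^sup>2) * (exp (4 * a) * exp (- (a / 2) * (norm (x - y))\<^sup>2))"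
      using ebd[OF that] e0 a by (intro mult_mono) auto
    then have "\<bar>(4 * a\<^sup>2 * (r b t y)\<^sup>2 - 2 * a) * e b t y\<bar> \<le> ((16 * a\<^sup>2 + 2 * a) * exp (4 * a)) * ((1 + norm (x - y)) ^ 2 * exp (- (a / 2) * (norm (x - y))\<^sup>2))"
      unfolding abs_mult abs_of_nonneg[OF e0] by (simp only: mult_ac)
    from mult_left_mono[OF this abs_ge_zero[of "k y"]] show ?thesis by (simp only: k2'_def abs_mult)
  qed
  have a2: "0 < a / 2" using a by simp
  have ib1: "integrable lborel (\<lambda>y. \<bar>k y\<bar> * ((4 * a * exp (4 * a)) * ((1 + norm (x - y)) ^ 1 * exp (- (a / 2) * (norm (x - y))\<^sup>2))))"
    by (rule integrable_gauss_poly[OF km _ k2 a2, where m=1 and x=x and C="4 * a * exp (4 * a)"]) (use a in \<open>auto simp: abs_mult\<close>)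
  have ib2: "integrable lborel (\<lambda>y. \<bar>k y\<bar> * (((16 * a\<^sup>2 + 2 * a) * exp (4 * a)) * ((1 + norm (x - y)) ^ 2 * exp (- (a / 2) * (norm (x - y))\<^sup>2))))"
    by (rule integrable_gauss_poly[OF km _ k2 a2, where m=2 and x=x and C="(16 * a\<^sup>2 + 2 * a) * exp (4 * a)"]) (use a in \<open>auto simp: abs_mult\<close>)
  have m0: "(\<lambda>y. k y * e b t y) \<in> borel_measurable lborel" "k1 b t \<in> borel_measurable lborel" "k2' b t \<in> borel_measurable lborel" for b t
    unfolding k1_def k2'_def by measurable
  have i0: "integrable lborel (\<lambda>y. k y * e b t y)" if "b \<in> Basis" "\<bar>t\<bar> < 2" for b t
  proof (rule integrable_gauss_poly[OF km _ k2 a2, where m=0 and x=x and C="exp (4 * a)"])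
    show "\<bar>k y * e b t y\<bar> \<le> \<bar>k y\<bar> * (exp (4 * a) * ((1 + norm (x - y)) ^ 0 * exp (- (a / 2) * (norm (x - y))\<^sup>2)))" for y
      using mult_left_mono[OF ebd[OF that, of y] abs_ge_zero[of "k y"]] e0[of b t y] by (simp add: abs_mult)
  qed (use m0 in auto)
  have D1: "((\<lambda>t. LINT y|lborel. k y * e b t y) has_real_derivative (LINT y|lborel. k1 b t0 y)) (at t0)" if b: "b \<in> Basis" and t0: "\<bar>t0\<bar> < 1" for b t0
  proof (rule has_real_derivative_integral[where \<delta>=1, OF _ k0d[OF b] m0(1) m0(2) i0[OF b] _ ib1])
    show "\<bar>k1 b t y\<bar> \<le> \<bar>k y\<bar> * ((4 * a * exp (4 * a)) * ((1 + norm (x - y)) ^ 1 * exp (- (a / 2) * (norm (x - y))\<^sup>2)))" if "\<bar>t - t0\<bar> < 1" for t y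
      by (rule k1b[OF b]) (use that t0 in auto)
  qed (use t0 in auto)
  have i1: "integrable lborel (k1 b 0)" if b: "b \<in> Basis" for b
    by (rule Bochner_Integration.integrable_bound[OF ib1]) (use k1b[OF b, of 0] m0 a in \<open>auto intro!: AE_I2\<close>)
  have D2: "((\<lambda>t. LINT y|lborel. k1 b t y) has_real_derivative (LINT y|lborel. k2' b 0 y)) (at 0)" if b: "b \<in> Basis" for b
  proof (rule has_real_derivative_integral[where \<delta>=1, OF _ k1d[OF b] m0(2) m0(3) i1[OF b] _ ib2])
    show "\<bar>k2' b t y\<bar> \<le> \<bar>k y\<bar> * (((16 * a\<^sup>2 + 2 * a) * exp (4 * a)) * ((1 + norm (x - y)) ^ 2 * exp (- (a / 2) * (norm (x - y))\<^sup>2)))" if "\<bar>t - 0\<bar> < 1" for t y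
      by (rule k2b[OF b]) (use that in auto)
  qed auto
  have i2: "integrable lborel (k2' b 0)" if b: "b \<in> Basis" for b
    by (rule Bochner_Integration.integrable_bound[OF ib2]) (use k2b[OF b, of 0] m0 a in \<open>auto intro!: AE_I2\<close>)
  have "(\<Sum>b\<in>Basis. LINT y|lborel. k2' b 0 y) = (LINT y|lborel. (\<Sum>b\<in>Basis. k2' b 0 y))"
    by (rule Bochner_Integration.integral_sum[symmetric]) (rule i2)
  also have "\<dots> = (LINT y|lborel. k y * ((4 * a\<^sup>2 * (norm (x - y))\<^sup>2 - 2 * a * real DIM('a)) * exp (- a * (norm (x - y))\<^sup>2)))"
  proof (rule Bochner_Integration.integral_cong[OF refl])
    fix y :: 'a
    have "(\<Sum>b\<in>Basis. k2' b 0 y) = (\<Sum>b\<in>Basis. (4 * a\<^sup>2 * ((x - y) \<bullet> b)\<^sup>2 - 2 * a)) * (k y * exp (- a * (norm (x - y))\<^sup>2))"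
      unfolding k2'_def r_def e_def sum_distrib_right by (rule sum.cong) auto
    also have "(\<Sum>b\<in>Basis. (4 * a\<^sup>2 * ((x - y) \<bullet> b)\<^sup>2 - 2 * a)) = 4 * a\<^sup>2 * (\<Sum>b\<in>Basis. ((x - y) \<bullet> b)\<^sup>2) - 2 * a * real DIM('a)"
      by (simp add: sum_subtractf sum_distrib_left)
    also have "(\<Sum>b\<in>Basis. ((x - y) \<bullet> b)\<^sup>2) = (norm (x - y))\<^sup>2"
      unfolding power2_norm_eq_inner euclidean_inner[of "x - y" "x - y"] by (simp add: power2_eq_square)
    finally show "(\<Sum>b\<in>Basis. k2' b 0 y) = k y * ((4 * a\<^sup>2 * (norm (x - y))\<^sup>2 - 2 * a * real DIM('a)) * exp (- a * (norm (x - y))\<^sup>2))"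
      by (simp only: mult_ac)
  qed
  finally have S: "(\<Sum>b\<in>Basis. LINT y|lborel. k2' b 0 y) = (LINT y|lborel. k y * ((4 * a\<^sup>2 * (norm (x - y))\<^sup>2 - 2 * a * real DIM('a)) * exp (- a * (norm (x - y))\<^sup>2)))" .
  show ?thesis
    unfolding has_laplacian_def a_def[symmetric] S[symmetric]
  proof (intro exI[of _ "\<lambda>b t. s ^ DIM('a) * (LINT y|lborel. k1 b t y)"] exI[of _ "\<lambda>b. s ^ DIM('a) * (LINT y|lborel. k2' b 0 y)"] conjI ballI)
    show "(\<Sum>b\<in>Basis. s ^ DIM('a) * (LINT y|lborel. k2' b 0 y)) = s ^ DIM('a) * (\<Sum>b\<in>Basis. LINT y|lborel. k2' b 0 y)"
      by (simp add: sum_distrib_left)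
    fix b :: 'a assume b: "b \<in> Basis"
    have "\<forall>\<^sub>F t in nhds (0::real). \<bar>t\<bar> < 1" unfolding eventually_nhds_metric by (intro exI[of _ 1]) auto
    then show "\<forall>\<^sub>F t in nhds 0. ((\<lambda>t. moll k s (x + t *\<^sub>R b)) has_real_derivative s ^ DIM('a) * (LINT y|lborel. k1 b t y)) (at t)"
    proof eventually_elim
      case (elim t)
      show ?case unfolding moll_def a_def[symmetric] using DERIV_cmult[OF D1[OF b elim]] by (simp add: e_def)
    qed
    show "((\<lambda>t. s ^ DIM('a) * (LINT y|lborel. k1 b t y)) has_real_derivative s ^ DIM('a) * (LINT y|lborel. k2' b 0 y)) (at 0)"
      by (rule DERIV_cmult[OF D2[OF b]])
  qed
qed


text \<open>Near x, uniform continuity lets V x stand for V y at the cost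
  \<open>\<epsilon>1\<close>. Far from x the growth bounds give an error of at most a multiple of |x
  - y|^2, whose Gaussian average is of order s^-2. Here k may have any sign, since both v and -v
  will be inserted.\<close>

lemma moll_potential_bound:
  fixes k hh V :: "'a::euclidean_space \<Rightarrow> real"
  assumes km[measurable]: "k \<in> borel_measurable borel" and hm[measurable]: "hh \<in> borel_measurable borel"
    and k2: "integrable lborel (\<lambda>y. (k y)\<^sup>2)"
    and kb: "AE y in lborel. \<bar>k y\<bar> \<le> B" and hb: "AE y in lborel. \<bar>hh y\<bar> \<le> B * (1 + (norm y)\<^sup>2)"
    and ge: "AE y in lborel. R' \<le> norm y \<longrightarrow> V y * k y \<le> hh y"
    and Vc: "continuous_on {y. R' \<le> norm y} V" and R: "R' < R" and \<epsilon>: "0 < \<epsilon>"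
  shows "\<forall>\<^sub>F n in sequentially. \<forall>x. R \<le> norm x \<and> norm x \<le> M \<longrightarrow>
    V x * moll k (real (Suc n)) x - \<epsilon> \<le> moll hh (real (Suc n)) x"
proof -
  let ?Z = "gauss_mass TYPE('a)"
  define Z2 where "Z2 = (LINT z|lborel. (norm (z::'a))\<^sup>2 * exp (- (norm z)\<^sup>2))"
  let ?S = "{y::'a. R' \<le> norm y \<and> norm y \<le> M + 1}"
  have "closed ?S" by (intro closed_Collect_conj closed_Collect_le continuous_intros)
  moreover have "bounded ?S" by (rule bounded_subset[OF bounded_cball[of 0 "M + 1"]]) auto
  ultimately have S: "compact ?S" by (simp add: compact_eq_bounded_closed)
  have VS: "continuous_on ?S V" by (rule continuous_on_subset[OF Vc]) auto
  have "bounded (V ` ?S)" by (intro compact_imp_bounded compact_continuous_image VS S)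
  then obtain VB0 where "\<forall>v\<in>V ` ?S. norm v \<le> VB0" unfolding bounded_iff by blast
  then have VB: "\<bar>V y\<bar> \<le> \<bar>VB0\<bar>" if "y \<in> ?S" for y using that by force
  \<comment> \<open>Chosen so that \<open>\<epsilon>1\<close> |B| times the Gaussian mass is at most
    \<epsilon> / 2; the added 1 avoids a zero denominator.\<close>
  define \<epsilon>1 where "\<epsilon>1 = \<epsilon> / (2 * (\<bar>B\<bar> * ?Z + 1))"
  have BZ: "0 \<le> \<bar>B\<bar> * ?Z" using gauss_mass_pos[where 'a='a] by simp
  have \<epsilon>1: "0 < \<epsilon>1" "\<epsilon>1 * (\<bar>B\<bar> * ?Z) \<le> \<epsilon> / 2"
  proof -
    show "0 < \<epsilon>1" using \<epsilon> BZ by (simp add: \<epsilon>1_def)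
    then have "\<epsilon>1 * (\<bar>B\<bar> * ?Z) \<le> \<epsilon>1 * (\<bar>B\<bar> * ?Z + 1)" by simp
    also have "\<dots> = \<epsilon> / 2"
    proof -
      have "\<epsilon> / (2 * P) * P = \<epsilon> / 2" if "P \<noteq> 0" for P :: real using that by simp
      from this[of "\<bar>B\<bar> * ?Z + 1"] show ?thesis using BZ unfolding \<epsilon>1_def by linarith
    qed
    finally show "\<epsilon>1 * (\<bar>B\<bar> * ?Z) \<le> \<epsilon> / 2" .
  qed
  obtain d0 where d0: "0 < d0" "\<And>x y. x \<in> ?S \<Longrightarrow> y \<in> ?S \<Longrightarrow> dist y x < d0 \<Longrightarrow> dist (V y) (V x) < \<epsilon>1"
    using compact_uniformly_continuous[OF VS S] \<epsilon>1(1) unfolding uniformly_continuous_on_def by blast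
  \<comment> \<open>The bounds 1 and R - R' keep every point within d of the annulus R <= |x| <= M
    inside the compact set on which V is uniformly continuous.\<close>
  define d where "d = min d0 (min 1 (R - R'))"
  have d: "0 < d" "d \<le> d0" "d \<le> 1" "d \<le> R - R'" using d0(1) R by (auto simp: d_def)
  \<comment> \<open>For |x - y| >= d a constant is at most itself times |x - y|^2 / d^2; the summand
    2 comes from |y|^2 <= 2 M^2 + 2 |x - y|^2.\<close>
  define K1 where "K1 = \<bar>B\<bar> * ((1 + 2 * M\<^sup>2 + \<bar>VB0\<bar>) / d\<^sup>2 + 2)"
  have K1: "0 \<le> K1" unfolding K1_def by (intro mult_nonneg_nonneg add_nonneg_nonneg divide_nonneg_nonneg) auto
  have pt: "AE y in lborel. - (\<epsilon>1 * \<bar>B\<bar> + K1 * (norm (x - y))\<^sup>2) \<le> hh y - V x * k y"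
    if x: "R \<le> norm x" "norm x \<le> M" for x :: 'a
    using kb hb ge
  proof eventually_elim
    case (elim y)
    have xS: "x \<in> ?S" using x R by auto
    have kB: "\<bar>k y\<bar> \<le> \<bar>B\<bar>" using elim(1) by linarith
    show ?case
    proof (cases "norm (x - y) < d")
      case True
      have "norm x \<le> norm y + norm (x - y)" "norm y \<le> norm x + norm (x - y)"
        using norm_triangle_sub[of x y] norm_triangle_sub[of y x] by (auto simp: norm_minus_commute)
      then have yS: "y \<in> ?S" using True d x by auto
      have "\<bar>V y - V x\<bar> < \<epsilon>1" using d0(2)[OF xS yS] True d by (simp add: dist_norm norm_minus_commute)
      then have "\<bar>(V y - V x) * k y\<bar> \<le> \<epsilon>1 * \<bar>B\<bar>" unfolding abs_mult using kB by (intro mult_mono) auto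
      then have "- (\<epsilon>1 * \<bar>B\<bar>) \<le> V y * k y - V x * k y" by (simp add: left_diff_distrib abs_le_iff)
      also have "\<dots> \<le> hh y - V x * k y" using elim(3) yS by simp
      finally have "- (\<epsilon>1 * \<bar>B\<bar>) \<le> hh y - V x * k y" .
      moreover have "0 \<le> K1 * (norm (x - y))\<^sup>2" using K1 by simp
      ultimately show ?thesis by linarith
    next
      case False
      then have dd: "d\<^sup>2 \<le> (norm (x - y))\<^sup>2" using d(1) by (intro power_mono) auto
      have "norm y \<le> M + norm (x - y)" using norm_triangle_sub[of y x] x(2) by (simp add: norm_minus_commute)
      then have "(norm y)\<^sup>2 \<le> (M + norm (x - y))\<^sup>2" by (intro power_mono) auto
      also have "\<dots> \<le> 2 * M\<^sup>2 + 2 * (norm (x - y))\<^sup>2"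
        using sum_squares_bound[of M "norm (x - y)"] by (simp add: power2_sum)
      finally have ny: "(norm y)\<^sup>2 \<le> 2 * M\<^sup>2 + 2 * (norm (x - y))\<^sup>2" .
      have "\<bar>hh y\<bar> \<le> \<bar>B\<bar> * (1 + (norm y)\<^sup>2)"
        by (rule order_trans[OF elim(2) mult_right_mono[OF abs_ge_self]]) simp
      moreover have "\<bar>V x * k y\<bar> \<le> \<bar>VB0\<bar> * \<bar>B\<bar>" unfolding abs_mult using VB[OF xS] kB by (intro mult_mono) auto
      ultimately have "\<bar>hh y - V x * k y\<bar> \<le> \<bar>B\<bar> * (1 + (norm y)\<^sup>2) + \<bar>VB0\<bar> * \<bar>B\<bar>" by linarith
      also have "\<dots> = \<bar>B\<bar> * (1 + \<bar>VB0\<bar> + (norm y)\<^sup>2)" by (simp add: algebra_simps)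
      also have "\<dots> \<le> \<bar>B\<bar> * ((1 + 2 * M\<^sup>2 + \<bar>VB0\<bar>) + 2 * (norm (x - y))\<^sup>2)"
        using ny by (intro mult_left_mono) auto
      also have "\<dots> \<le> \<bar>B\<bar> * ((1 + 2 * M\<^sup>2 + \<bar>VB0\<bar>) / d\<^sup>2 * (norm (x - y))\<^sup>2 + 2 * (norm (x - y))\<^sup>2)"
      proof (intro mult_left_mono add_right_mono)
        have "(1 + 2 * M\<^sup>2 + \<bar>VB0\<bar>) / d\<^sup>2 * d\<^sup>2 \<le> (1 + 2 * M\<^sup>2 + \<bar>VB0\<bar>) / d\<^sup>2 * (norm (x - y))\<^sup>2"
          by (intro mult_left_mono dd divide_nonneg_nonneg add_nonneg_nonneg) auto
        then show "1 + 2 * M\<^sup>2 + \<bar>VB0\<bar> \<le> (1 + 2 * M\<^sup>2 + \<bar>VB0\<bar>) / d\<^sup>2 * (norm (x - y))\<^sup>2" using d(1) by simp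
      qed simp
      also have "\<dots> = K1 * (norm (x - y))\<^sup>2" unfolding K1_def by (simp only: distrib_right mult.assoc)
      finally have "\<bar>hh y - V x * k y\<bar> \<le> K1 * (norm (x - y))\<^sup>2" .
      moreover have "0 \<le> \<epsilon>1 * \<bar>B\<bar>" using \<epsilon>1(1) by simp
      ultimately show ?thesis by linarith
    qed
  qed
  have main: "V x * moll k s x - (\<epsilon> / 2 + K1 * Z2 / s\<^sup>2) \<le> moll hh s x" if x: "R \<le> norm x" "norm x \<le> M" and s: "0 < s" for x s
  proof -
    let ?E = "\<lambda>y. exp (- s\<^sup>2 * (norm (x - y))\<^sup>2)"
    have s2: "0 < s\<^sup>2" using s by simp
    have iE: "integrable lborel ?E" using integrable_gaussian[OF s2, of x] .
    have iE2: "integrable lborel (\<lambda>y. (norm (x - y))\<^sup>2 * ?E y)" by (rule integrable_gauss_moment2[OF s])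
    have ik: "integrable lborel (\<lambda>y. k y * ?E y)"
      by (rule integrable_gauss_poly[OF km _ k2 s2, where m=0 and C=1 and x=x]) (auto simp: abs_mult)
    obtain C where C: "C > 0" "\<And>r. 0 \<le> r \<Longrightarrow> (1 + r) ^ 2 * exp (- s\<^sup>2 * r\<^sup>2) \<le> C * exp (- (s\<^sup>2/2) * r\<^sup>2)"
      using poly_gauss_bound[OF s2] by blast
    have ih: "integrable lborel (\<lambda>y. hh y * ?E y)"
    proof (rule Bochner_Integration.integrable_bound)
      have "0 < s\<^sup>2 / 2" using s2 by simp
      then show "integrable lborel (\<lambda>y. (\<bar>B\<bar> * 2 * (1 + norm x)\<^sup>2 * C) * exp (- (s\<^sup>2/2) * (norm (x - y))\<^sup>2))"
        by (intro integrable_mult_right integrable_gaussian)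
      show "AE y in lborel. norm (hh y * ?E y) \<le> norm ((\<bar>B\<bar> * 2 * (1 + norm x)\<^sup>2 * C) * exp (- (s\<^sup>2/2) * (norm (x - y))\<^sup>2))"
        using hb
      proof eventually_elim
        case (elim y)
        have "\<bar>hh y\<bar> \<le> \<bar>B\<bar> * (1 + (norm y)\<^sup>2)"
          by (rule order_trans[OF elim mult_right_mono[OF abs_ge_self]]) simp
        also have "\<dots> \<le> \<bar>B\<bar> * ((1 + 1) * (1 + norm x)\<^sup>2 * (1 + norm (x - y))\<^sup>2)"
          using norm_poly_shift[of 1 y x] by (intro mult_left_mono) (auto simp: add.commute)
        finally have "\<bar>hh y\<bar> * ?E y \<le> (\<bar>B\<bar> * ((1 + 1) * (1 + norm x)\<^sup>2 * (1 + norm (x - y))\<^sup>2)) * ?E y"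
          by (rule mult_right_mono) simp
        also have "\<dots> = (\<bar>B\<bar> * 2 * (1 + norm x)\<^sup>2) * ((1 + norm (x - y))\<^sup>2 * ?E y)" by (simp add: mult_ac)
        also have "\<dots> \<le> (\<bar>B\<bar> * 2 * (1 + norm x)\<^sup>2) * (C * exp (- (s\<^sup>2/2) * (norm (x - y))\<^sup>2))"
          by (intro mult_left_mono C(2)) auto
        finally show ?case using C(1) by (simp add: abs_mult mult.assoc)
      qed
    qed simp
    have "(LINT y|lborel. (- (\<epsilon>1 * \<bar>B\<bar>)) * ?E y - K1 * ((norm (x - y))\<^sup>2 * ?E y)) \<le> (LINT y|lborel. hh y * ?E y - V x * (k y * ?E y))"
    proof (rule integral_mono_AE)
      show "integrable lborel (\<lambda>y. (- (\<epsilon>1 * \<bar>B\<bar>)) * ?E y - K1 * ((norm (x - y))\<^sup>2 * ?E y))"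
        by (intro Bochner_Integration.integrable_diff integrable_mult_right iE iE2)
      show "integrable lborel (\<lambda>y. hh y * ?E y - V x * (k y * ?E y))"
        by (intro Bochner_Integration.integrable_diff integrable_mult_right ih ik)
      show "AE y in lborel. (- (\<epsilon>1 * \<bar>B\<bar>)) * ?E y - K1 * ((norm (x - y))\<^sup>2 * ?E y) \<le> hh y * ?E y - V x * (k y * ?E y)"
        using pt[OF x]
      proof eventually_elim
        case (elim y)
        from mult_right_mono[OF elim, of "?E y"] show ?case by (simp add: algebra_simps)
      qed
    qed
    then have "(- (\<epsilon>1 * \<bar>B\<bar>)) * (LINT y|lborel. ?E y) - K1 * (LINT y|lborel. (norm (x - y))\<^sup>2 * ?E y)
      \<le> (LINT y|lborel. hh y * ?E y) - V x * (LINT y|lborel. k y * ?E y)"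
      using iE iE2 ih ik by simp
    from mult_left_mono[OF this, of "s ^ DIM('a)"]
    have "(- (\<epsilon>1 * \<bar>B\<bar>)) * (s ^ DIM('a) * (LINT y|lborel. ?E y)) - K1 * (s ^ DIM('a) * (LINT y|lborel. (norm (x - y))\<^sup>2 * ?E y))
      \<le> moll hh s x - V x * moll k s x"
      using s unfolding moll_def by (simp add: right_diff_distrib mult_ac)
    then have "(- (\<epsilon>1 * \<bar>B\<bar>)) * ?Z - K1 * (Z2 / s\<^sup>2) \<le> moll hh s x - V x * moll k s x"
      unfolding moll_gauss_moments[OF s] Z2_def .
    then show ?thesis using \<epsilon>1(2) by (simp add: mult.assoc)
  qed
  have "(\<lambda>n. K1 * Z2 / (real (Suc n))\<^sup>2) \<longlonglongrightarrow> 0" by real_asymp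
  then have "\<forall>\<^sub>F n in sequentially. K1 * Z2 / (real (Suc n))\<^sup>2 < \<epsilon> / 2" by (rule order_tendstoD) (use \<epsilon> in simp)
  then show ?thesis
  proof eventually_elim
    case (elim n)
    show ?case
    proof (intro allI impI)
      fix x :: 'a assume "R \<le> norm x \<and> norm x \<le> M"
      then show "V x * moll k (real (Suc n)) x - \<epsilon> \<le> moll hh (real (Suc n)) x"
        using main[of x "real (Suc n)"] elim by simp
    qed
  qed
qed

text \<open>Where the difference F of mollification and barrier exceeds \<eta>, its Laplacian is at
  least V F - \<open>V0\<close> \<eta>, up to the choice of n, and this is positive: the surplus
  \<eta> pays for the mollification error \<open>V0\<close> \<eta>. That error is uniform on bounded
  annuli only, so n tends to infinity first, then the outer radius, and \<eta> tends to 0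
  last.\<close>

theorem exterior_comparison_AE:
  fixes k hh V w :: "'a::euclidean_space \<Rightarrow> real"
  assumes km[measurable]: "k \<in> borel_measurable borel" and hm[measurable]: "hh \<in> borel_measurable borel"
    and wm[measurable]: "w \<in> borel_measurable borel"
    and k2: "integrable lborel (\<lambda>y. (k y)\<^sup>2)"
    and kb: "AE y in lborel. \<bar>k y\<bar> \<le> B" and hb: "AE y in lborel. \<bar>hh y\<bar> \<le> B * (1 + (norm y)\<^sup>2)"
    and ge: "AE y in lborel. R' \<le> norm y \<longrightarrow> V y * k y \<le> hh y"
    and Vc: "continuous_on {y. R' \<le> norm y} V" and R: "R' < R"
    and V0: "0 < V0" "\<And>y. R' \<le> norm y \<Longrightarrow> V0 \<le> V y"
    and lap: "\<And>x s. 0 < s \<Longrightarrow> has_laplacian (moll k s) (moll hh s x) x"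
    and wc: "continuous_on {x. R \<le> norm x} w"
    and wlap: "\<And>x. R < norm x \<Longrightarrow> \<exists>L. has_laplacian w L x \<and> L \<le> V x * w x"
    and inner: "\<And>n x. norm x = R \<Longrightarrow> moll k (real (Suc n)) x \<le> w x"
    and outer: "\<And>\<eta>. 0 < \<eta> \<Longrightarrow> \<exists>M0. \<forall>M\<ge>M0. \<forall>n x. norm x = M \<longrightarrow> moll k (real (Suc n)) x - w x \<le> \<eta>"
  shows "AE x in lborel. R < norm x \<longrightarrow> gauss_mass TYPE('a) * k x \<le> w x"
proof -
  let ?Z = "gauss_mass TYPE('a)"
  have step: "\<exists>M0. \<forall>M\<ge>M0. AE x in lborel. R < norm x \<and> norm x < M \<longrightarrow> ?Z * k x \<le> w x + \<eta>" if \<eta>: "0 < \<eta>" for \<eta>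
  proof -
    obtain M0 where M0: "\<And>M n x. M0 \<le> M \<Longrightarrow> norm x = M \<Longrightarrow> moll k (real (Suc n)) x - w x \<le> \<eta>"
      using outer[OF \<eta>] by blast
    have "AE x in lborel. R < norm x \<and> norm x < M \<longrightarrow> ?Z * k x \<le> w x + \<eta>" if M: "M0 \<le> M" for M
    proof -
      have "0 < V0 * \<eta>" using V0 \<eta> by simp
      from moll_potential_bound[OF km hm k2 kb hb ge Vc R this, of M]
      have ev: "\<forall>\<^sub>F n in sequentially. \<forall>x. R < norm x \<and> norm x < M \<longrightarrow> moll k (real (Suc n)) x \<le> w x + \<eta>"
      proof eventually_elim
        case (elim n)
        let ?F = "\<lambda>x. moll k (real (Suc n)) x - w x"
        have "?F x \<le> \<eta>" if x: "R \<le> norm x" "norm x \<le> M" for x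
        proof (rule maximum_principle_annulus[of R M ?F \<eta>, OF _ _ _ x])
          show "continuous_on {x. R \<le> norm x \<and> norm x \<le> M} ?F"
            by (intro continuous_on_diff moll_continuous[OF km k2] continuous_on_subset[OF wc]) auto
          show "?F x \<le> \<eta>" if "norm x = R \<or> norm x = M" for x
            using that inner[of x n] M0[OF M, of x n] \<eta> by fastforce
          show "\<exists>L>0. has_laplacian ?F L x" if h: "R < norm x" "norm x < M" "\<eta> < ?F x" for x
          proof -
            obtain L where L: "has_laplacian w L x" "L \<le> V x * w x" using wlap[OF h(1)] by blast
            have "V0 \<le> V x" using V0(2)[of x] R h(1) by simp
            then have "V0 * \<eta> < V x * ?F x" using V0(1) h(3) \<eta> by (intro mult_le_less_imp_less) auto
            moreover have "V x * moll k (real (Suc n)) x - V0 * \<eta> \<le> moll hh (real (Suc n)) x" using elim h by simp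
            ultimately have "0 < moll hh (real (Suc n)) x - L" using L(2) by (simp add: right_diff_distrib)
            moreover have "has_laplacian ?F (moll hh (real (Suc n)) x - L) x"
              by (rule has_laplacian_diff[OF lap L(1)]) simp
            ultimately show ?thesis by blast
          qed
        qed
        then show ?case by (auto simp: less_imp_le algebra_simps)
      qed
      let ?U = "{x::'a. R < norm x \<and> norm x < M}"
      let ?D = "{x::'a. R \<le> norm x \<and> norm x \<le> M}"
      have "closed ?D" by (intro closed_Collect_conj closed_Collect_le continuous_intros)
      moreover have "bounded ?D" by (rule bounded_subset[OF bounded_cball[of 0 M]]) auto
      ultimately have "compact ?D" by (simp add: compact_eq_bounded_closed)
      moreover have "continuous_on ?D (\<lambda>x. w x + \<eta>)" by (intro continuous_intros continuous_on_subset[OF wc]) auto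
      ultimately have "bounded ((\<lambda>x. w x + \<eta>) ` ?D)" by (intro compact_imp_bounded compact_continuous_image)
      then obtain G where G: "\<forall>v\<in>(\<lambda>x. w x + \<eta>) ` ?D. norm v \<le> G" unfolding bounded_iff by blast
      have "AE x in lborel. x \<in> ?U \<longrightarrow> ?Z * k x \<le> w x + \<eta>"
      proof (rule moll_limit_AE_le[OF km k2])
        show "open ?U" by (intro open_Collect_conj open_Collect_less continuous_intros)
        show "(\<lambda>x. w x + \<eta>) \<in> borel_measurable borel" by measurable
        show "\<bar>w x + \<eta>\<bar> \<le> G" if "x \<in> ?U" for x
        proof -
          have "x \<in> ?D" using that by auto
          then show ?thesis using G by fastforce
        qed
        show "\<forall>\<^sub>F n in sequentially. \<forall>x\<in>?U. moll k (real (Suc n)) x \<le> w x + \<eta>"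
          using ev by simp
      qed
      then show ?thesis by simp
    qed
    then show ?thesis by blast
  qed
  \<comment> \<open>Both \<eta> and the outer radius run through sequences, so that only countably
    many null sets are discarded.\<close>
  have "AE x in lborel. R < norm x \<longrightarrow> ?Z * k x \<le> w x + 1 / real (Suc j)" for j
  proof -
    obtain M0 where M0: "\<And>M. M0 \<le> M \<Longrightarrow> AE x in lborel. R < norm x \<and> norm x < M \<longrightarrow> ?Z * k x \<le> w x + 1 / real (Suc j)"
      using step[of "1 / real (Suc j)"] by auto
    have "AE x in lborel. \<forall>i::nat. R < norm x \<and> norm x < \<bar>M0\<bar> + real i \<longrightarrow> ?Z * k x \<le> w x + 1 / real (Suc j)"
      unfolding AE_all_countable by (intro allI M0) simp
    then show ?thesis
    proof eventually_elim
      case (elim x)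
      obtain i :: nat where "norm x < real i" using reals_Archimedean2 by blast
      then have "norm x < \<bar>M0\<bar> + real i" by simp
      then show ?case using elim by blast
    qed
  qed
  then have "AE x in lborel. \<forall>j. R < norm x \<longrightarrow> ?Z * k x \<le> w x + 1 / real (Suc j)"
    unfolding AE_all_countable by blast
  then show ?thesis
  proof eventually_elim
    case (elim x)
    show ?case
    proof
      assume "R < norm x"
      then have b: "\<forall>j. ?Z * k x \<le> w x + 1 / real (Suc j)" using elim by blast
      have "(\<lambda>j. w x + 1 / real (Suc j)) \<longlonglongrightarrow> w x + 0"
        using LIMSEQ_inverse_real_of_nat by (intro tendsto_intros) (simp add: inverse_eq_divide)
      then show "?Z * k x \<le> w x" using b by (intro LIMSEQ_le_const[where X="\<lambda>j. w x + 1 / real (Suc j)"]) auto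
    qed
  qed
qed

section \<open>Radial barriers\<close>

text \<open>Radial functions are written in q = |x|^2, which is a quadratic polynomial along each
  axis; the chain rule then produces no square roots.\<close>

lemma has_laplacian_radial:
  fixes x :: "'a::euclidean_space"
  assumes d1: "\<And>q. 0 < q \<Longrightarrow> (\<psi> has_real_derivative \<psi>1 q) (at q)"
    and d2: "\<And>q. 0 < q \<Longrightarrow> (\<psi>1 has_real_derivative \<psi>2 q) (at q)" and x: "x \<noteq> 0"
  shows "has_laplacian (\<lambda>x. \<psi> ((norm x)\<^sup>2)) (4 * (norm x)\<^sup>2 * \<psi>2 ((norm x)\<^sup>2) + 2 * real DIM('a) * \<psi>1 ((norm x)\<^sup>2)) x"
proof -
  define q where "q b t = (norm x)\<^sup>2 + 2 * t * (x \<bullet> b) + t\<^sup>2" for b :: 'a and t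
  have q0: "0 < (norm x)\<^sup>2" using x by simp
  have qd: "(q b has_real_derivative 2 * (x \<bullet> b) + 2 * t) (at t)" for b t
    unfolding q_def by (auto intro!: derivative_eq_intros)
  have shift: "(norm (x + t *\<^sub>R b))\<^sup>2 = q b t" if "b \<in> Basis" for b t
    unfolding q_def by (rule norm_shift_sq) (use that in simp)
  show ?thesis unfolding has_laplacian_def
  proof (intro exI[of _ "\<lambda>b t. \<psi>1 (q b t) * (2 * (x \<bullet> b) + 2 * t)"]
      exI[of _ "\<lambda>b. \<psi>2 ((norm x)\<^sup>2) * (2 * (x \<bullet> b))\<^sup>2 + 2 * \<psi>1 ((norm x)\<^sup>2)"] conjI ballI)
    have "(\<Sum>b\<in>Basis. (x \<bullet> b)\<^sup>2) = (norm x)\<^sup>2"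
      unfolding power2_norm_eq_inner euclidean_inner[of x x] by (simp add: power2_eq_square)
    then show "(\<Sum>b\<in>Basis. \<psi>2 ((norm x)\<^sup>2) * (2 * (x \<bullet> b))\<^sup>2 + 2 * \<psi>1 ((norm x)\<^sup>2))
      = 4 * (norm x)\<^sup>2 * \<psi>2 ((norm x)\<^sup>2) + 2 * real DIM('a) * \<psi>1 ((norm x)\<^sup>2)"
      by (simp add: sum.distrib power_mult_distrib flip: sum_distrib_left)
    fix b :: 'a assume b: "b \<in> Basis"
    have "isCont (q b) 0" using qd DERIV_isCont by blast
    then have "(q b \<longlongrightarrow> q b 0) (nhds 0)" by (simp add: isCont_def tendsto_at_iff_tendsto_nhds)
    then have "\<forall>\<^sub>F t in nhds 0. 0 < q b t" by (rule order_tendstoD) (use q0 in \<open>simp add: q_def\<close>)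
    then show "\<forall>\<^sub>F t in nhds 0. ((\<lambda>s. \<psi> ((norm (x + s *\<^sub>R b))\<^sup>2)) has_real_derivative \<psi>1 (q b t) * (2 * (x \<bullet> b) + 2 * t)) (at t)"
    proof eventually_elim
      case (elim t)
      show ?case unfolding shift[OF b] by (rule DERIV_chain2[OF d1[OF elim] qd])
    qed
    have "((\<lambda>t. \<psi>1 (q b t)) has_real_derivative \<psi>2 (q b 0) * (2 * (x \<bullet> b) + 2 * 0)) (at 0)"
      by (rule DERIV_chain2[OF d2 qd]) (use q0 in \<open>simp add: q_def\<close>)
    moreover have "((\<lambda>t. 2 * (x \<bullet> b) + 2 * t) has_real_derivative 2) (at 0)" by (auto intro!: derivative_eq_intros)
    ultimately have "((\<lambda>t. \<psi>1 (q b t) * (2 * (x \<bullet> b) + 2 * t)) has_real_derivative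
        \<psi>2 (q b 0) * (2 * (x \<bullet> b) + 2 * 0) * (2 * (x \<bullet> b) + 2 * 0) + 2 * \<psi>1 (q b 0)) (at 0)"
      by (rule DERIV_mult)
    moreover have "q b 0 = (norm x)\<^sup>2" by (simp add: q_def)
    ultimately show "((\<lambda>t. \<psi>1 (q b t) * (2 * (x \<bullet> b) + 2 * t)) has_real_derivative
        \<psi>2 ((norm x)\<^sup>2) * (2 * (x \<bullet> b))\<^sup>2 + 2 * \<psi>1 ((norm x)\<^sup>2)) (at 0)"
      by (simp add: power2_eq_square mult.assoc)
  qed
qed

lemma has_laplacian_gauss_quarter:
  fixes x :: "'a::euclidean_space"
  assumes "x \<noteq> 0"
  shows "has_laplacian (\<lambda>x. exp (- ((norm x)\<^sup>2 / 4))) (((norm x)\<^sup>2 / 4 - real DIM('a) / 2) * exp (- ((norm x)\<^sup>2 / 4))) x"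
proof -
  have "has_laplacian (\<lambda>x. exp (- ((norm x)\<^sup>2 / 4)))
     (4 * (norm x)\<^sup>2 * (1 / 16 * exp (- ((norm x)\<^sup>2 / 4))) + 2 * real DIM('a) * (- 1 / 4 * exp (- ((norm x)\<^sup>2 / 4)))) x"
    by (rule has_laplacian_radial[of "\<lambda>q. exp (- (q / 4))" "\<lambda>q. - 1 / 4 * exp (- (q / 4))" "\<lambda>q. 1 / 16 * exp (- (q / 4))", OF _ _ assms])
      (auto intro!: derivative_eq_intros)
  then show ?thesis by (simp add: algebra_simps)
qed

text \<open>The function |x|^\<gamma> exp (-|x|^2 / 2), expressed through |x|^2 to fit the formula
  for radial Laplacians.\<close>

definition barrier :: "real \<Rightarrow> 'a::euclidean_space \<Rightarrow> real" where
  "barrier \<gamma> x = ((norm x)\<^sup>2) powr (\<gamma> / 2) * exp (- ((norm x)\<^sup>2 / 2))"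

text \<open>With g the logarithmic derivative of the profile, \<psi>' = g \<psi> and \<psi>'' = (g'
  + g^2) \<psi>, so the profile factors out of the Laplacian.\<close>

lemma has_laplacian_barrier:
  fixes x :: "'a::euclidean_space"
  assumes x: "x \<noteq> 0"
  shows "has_laplacian (barrier \<gamma>)
    (((norm x)\<^sup>2 - 2 * \<gamma> - real DIM('a) + \<gamma> * (\<gamma> + real DIM('a) - 2) / (norm x)\<^sup>2) * barrier \<gamma> x) x"
proof -
  define \<psi> where "\<psi> q = q powr (\<gamma> / 2) * exp (- (q / 2))" for q :: real
  define g where "g q = \<gamma> / (2 * q) - 1 / 2" for q :: real
  have d1: "(\<psi> has_real_derivative g q * \<psi> q) (at q)" if "0 < q" for q
  proof -
    have "((\<lambda>q. q powr (\<gamma> / 2)) has_real_derivative (\<gamma> / 2) * q powr (\<gamma> / 2 - 1)) (at q)"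
      using that by (auto intro!: derivative_eq_intros)
    moreover have "((\<lambda>q. exp (- (q / 2))) has_real_derivative - 1 / 2 * exp (- (q / 2))) (at q)"
      by (auto intro!: derivative_eq_intros)
    ultimately have "(\<psi> has_real_derivative (\<gamma> / 2) * q powr (\<gamma> / 2 - 1) * exp (- (q / 2)) + (- 1 / 2 * exp (- (q / 2))) * q powr (\<gamma> / 2)) (at q)"
      unfolding \<psi>_def[abs_def] by (rule DERIV_mult)
    moreover have "(\<gamma> / 2) * q powr (\<gamma> / 2 - 1) * exp (- (q / 2)) + (- 1 / 2 * exp (- (q / 2))) * q powr (\<gamma> / 2) = g q * \<psi> q"
    proof -
      have "(\<gamma> / 2) * (p / q) * e + (- 1 / 2 * e) * p = (\<gamma> / (2 * q) - 1 / 2) * (p * e)" for p e :: real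
        by (simp add: algebra_simps)
      moreover have "q powr (\<gamma> / 2 - 1) = q powr (\<gamma> / 2) / q" using that by (simp add: powr_diff)
      ultimately show ?thesis by (simp only: \<psi>_def g_def)
    qed
    ultimately show ?thesis by simp
  qed
  have gd: "(g has_real_derivative - (\<gamma> / (2 * q\<^sup>2))) (at q)" if "0 < q" for q
    unfolding g_def[abs_def] using that by (auto intro!: derivative_eq_intros simp: power2_eq_square)
  have d2: "((\<lambda>q. g q * \<psi> q) has_real_derivative (- (\<gamma> / (2 * q\<^sup>2))) * \<psi> q + (g q * \<psi> q) * g q) (at q)" if "0 < q" for q
    by (rule DERIV_mult[OF gd[OF that] d1[OF that]])
  let ?q = "(norm x)\<^sup>2"
  have q0: "0 < ?q" using x by simp
  have L: "has_laplacian (\<lambda>x. \<psi> ((norm x)\<^sup>2)) (4 * ?q * ((- (\<gamma> / (2 * ?q\<^sup>2))) * \<psi> ?q + (g ?q * \<psi> ?q) * g ?q) + 2 * real DIM('a) * (g ?q * \<psi> ?q)) x"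
    by (rule has_laplacian_radial[OF d1 d2 x])
  have E: "4 * q * ((- (\<gamma> / (2 * q\<^sup>2))) * P + (g q * P) * g q) + 2 * n * (g q * P)
      = (q - 2 * \<gamma> - n + \<gamma> * (\<gamma> + n - 2) / q) * P" if "0 < q" for q P n :: real
    using that by (simp add: g_def field_simps power2_eq_square)
  show ?thesis using L unfolding E[OF q0] by (simp only: barrier_def[abs_def] \<psi>_def)
qed

lemma barrier_pos: "x \<noteq> 0 \<Longrightarrow> 0 < barrier \<gamma> x"
  by (simp add: barrier_def)

lemma barrier_minus_one: "x \<noteq> 0 \<Longrightarrow> barrier (\<gamma> - 1) x = barrier \<gamma> x / norm x"
proof -
  assume x: "x \<noteq> 0"
  have "((norm x)\<^sup>2) powr ((\<gamma> - 1) / 2) = ((norm x)\<^sup>2) powr (\<gamma> / 2) / ((norm x)\<^sup>2) powr (1 / 2)"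
    by (simp add: diff_divide_distrib powr_diff)
  also have "((norm x)\<^sup>2) powr (1 / 2) = norm x" by (simp add: powr_half_sqrt)
  finally show ?thesis by (simp add: barrier_def)
qed

lemma barrier_eq:
  "x \<noteq> 0 \<Longrightarrow> barrier \<gamma> x = norm x powr \<gamma> * exp (- (norm x)\<^sup>2 / 2)"
  by (simp add: barrier_def powr_powr flip: powr_numeral)

lemma barrier_continuous: "0 < R \<Longrightarrow> continuous_on {x. R \<le> norm x} (barrier \<gamma>)"
  unfolding barrier_def[abs_def] by (intro continuous_intros) auto

lemma barrier_measurable [measurable]: "barrier \<gamma> \<in> borel_measurable borel"
  unfolding barrier_def[abs_def] by measurable

lemma barrier_tendsto_0: "((\<lambda>M. (M\<^sup>2) powr (\<gamma> / 2) * exp (- (M\<^sup>2 / 2))) \<longlongrightarrow> (0::real)) at_top"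
  by real_asymp

text \<open>With \<open>\<gamma> = (\<omega> - N) / 2\<close> the remainder of \<open>barrier \<gamma>\<close> is of order \<open>|x|\<^sup>-\<^sup>2\<close>, while
  \<open>barrier (\<gamma> - 1)\<close> gains \<open>2 barrier (\<gamma> - 1)\<close>, which is of order \<open>|x|\<^sup>-\<^sup>1\<close> relative to
  \<open>barrier \<gamma>\<close>.  Subtracting or adding it absorbs every error of order \<open>|x|\<^sup>-\<^sup>2\<close>.\<close>

lemma barrier_super_sub:
  fixes \<omega> K :: real
  assumes \<gamma>: "\<gamma> = (\<omega> - real DIM('a::euclidean_space)) / 2" and K: "0 \<le> K"
  obtains R0 where "1 \<le> R0"
    "\<And>x::'a. R0 \<le> norm x \<Longrightarrow> \<exists>L. has_laplacian (\<lambda>x. barrier \<gamma> x - barrier (\<gamma> - 1) x) L x \<and>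
        L \<le> ((norm x)\<^sup>2 - \<omega> - K / (norm x)\<^sup>2) * (barrier \<gamma> x - barrier (\<gamma> - 1) x)"
    "\<And>x::'a. R0 \<le> norm x \<Longrightarrow> \<exists>L. has_laplacian (\<lambda>x. barrier \<gamma> x + barrier (\<gamma> - 1) x) L x \<and>
        ((norm x)\<^sup>2 - \<omega> + K / (norm x)\<^sup>2) * (barrier \<gamma> x + barrier (\<gamma> - 1) x) \<le> L"
proof -
  let ?n = "real DIM('a)"
  define c1 where "c1 = \<gamma> * (\<gamma> + ?n - 2)"
  define c2 where "c2 = (\<gamma> - 1) * ((\<gamma> - 1) + ?n - 2)"
  \<comment> \<open>At least the sum of the coefficients of all errors of order |x|^-2, so that
    (|c1| + K) r + |c2| + K <= r^2 for r >= \<open>R0\<close>.\<close>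
  define R0 where "R0 = 1 + \<bar>c1\<bar> + \<bar>c2\<bar> + 2 * K"
  have R0: "1 \<le> R0" using K by (simp add: R0_def)
  have facts: "x \<noteq> 0 \<and>
      has_laplacian (barrier \<gamma>) (((norm x)\<^sup>2 - \<omega> + c1 / (norm x)\<^sup>2) * barrier \<gamma> x) x \<and>
      has_laplacian (barrier (\<gamma> - 1)) (((norm x)\<^sup>2 - \<omega> + 2 + c2 / (norm x)\<^sup>2) * barrier (\<gamma> - 1) x) x \<and>
      (\<bar>c1\<bar> + K) / (norm x)\<^sup>2 * barrier \<gamma> x + (\<bar>c2\<bar> + K) / (norm x)\<^sup>2 * barrier (\<gamma> - 1) x \<le> 2 * barrier (\<gamma> - 1) x"
    if x: "R0 \<le> norm x" for x :: 'a
  proof (intro conjI)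
    have r1: "1 \<le> norm x" using x R0 by simp
    then show x0: "x \<noteq> 0" by auto
    have e1: "(norm x)\<^sup>2 - 2 * \<gamma> - ?n + \<gamma> * (\<gamma> + ?n - 2) / (norm x)\<^sup>2 = (norm x)\<^sup>2 - \<omega> + c1 / (norm x)\<^sup>2"
      unfolding c1_def using \<gamma> by simp
    have e2: "(norm x)\<^sup>2 - 2 * (\<gamma> - 1) - ?n + (\<gamma> - 1) * ((\<gamma> - 1) + ?n - 2) / (norm x)\<^sup>2 = (norm x)\<^sup>2 - \<omega> + 2 + c2 / (norm x)\<^sup>2"
      unfolding c2_def using \<gamma> by simp
    show "has_laplacian (barrier \<gamma>) (((norm x)\<^sup>2 - \<omega> + c1 / (norm x)\<^sup>2) * barrier \<gamma> x) x"
      using has_laplacian_barrier[OF x0, of \<gamma>] unfolding e1 .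
    show "has_laplacian (barrier (\<gamma> - 1)) (((norm x)\<^sup>2 - \<omega> + 2 + c2 / (norm x)\<^sup>2) * barrier (\<gamma> - 1) x) x"
      using has_laplacian_barrier[OF x0, of "\<gamma> - 1"] unfolding e2 .
    define r where "r = norm x"
    define W where "W = barrier (\<gamma> - 1) x"
    have W: "0 < W" "barrier \<gamma> x = r * W"
      using barrier_pos[OF x0] barrier_minus_one[OF x0, of \<gamma>] x0 by (auto simp: W_def r_def)
    have r: "1 \<le> r" "R0 \<le> r" using r1 x by (auto simp: r_def)
    have "(\<bar>c1\<bar> + K) * r + (\<bar>c2\<bar> + K) \<le> (\<bar>c1\<bar> + K) * r + (\<bar>c2\<bar> + K) * r"
      using mult_left_mono[OF r(1), of "\<bar>c2\<bar> + K"] K by simp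
    also have "\<dots> \<le> r * r"
    proof -
      have "(\<bar>c1\<bar> + K + (\<bar>c2\<bar> + K)) * r \<le> r * r" using r by (intro mult_right_mono) (auto simp: R0_def)
      then show ?thesis by (simp add: distrib_right)
    qed
    also have "\<dots> \<le> 2 * r\<^sup>2" by (simp add: power2_eq_square)
    finally have le: "(\<bar>c1\<bar> + K) * r + (\<bar>c2\<bar> + K) \<le> 2 * r\<^sup>2" .
    have r20: "0 < r\<^sup>2" using r(1) by simp
    have "((\<bar>c1\<bar> + K) * r + (\<bar>c2\<bar> + K)) / r\<^sup>2 \<le> 2" using le r20 by (subst pos_divide_le_eq) auto
    then have "((\<bar>c1\<bar> + K) * r + (\<bar>c2\<bar> + K)) / r\<^sup>2 * W \<le> 2 * W" using W(1) by (intro mult_right_mono) auto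
    then show "(\<bar>c1\<bar> + K) / (norm x)\<^sup>2 * barrier \<gamma> x + (\<bar>c2\<bar> + K) / (norm x)\<^sup>2 * barrier (\<gamma> - 1) x \<le> 2 * barrier (\<gamma> - 1) x"
    proof -
      have "X / q * (r * W) + Y / q * W = (X * r + Y) / q * W" for X Y q :: real
        by (simp add: add_divide_distrib algebra_simps)
      with \<open>((\<bar>c1\<bar> + K) * r + (\<bar>c2\<bar> + K)) / r\<^sup>2 * W \<le> 2 * W\<close> show ?thesis
        unfolding W(2) r_def[symmetric] W_def[symmetric] by (simp only:)
    qed
  qed
  \<comment> \<open>Algebra with q = |x|^2 and A, B the values of the two barriers: the two sides
    differ by 2 B and error terms, and the assumption bounds the errors by 2 B.\<close>
  have fin: "((q - \<omega> + c1 / q) * A) - ((q - \<omega> + 2 + c2 / q) * B) \<le> (q - \<omega> - K / q) * (A - B)"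
    "(q - \<omega> + K / q) * (A + B) \<le> ((q - \<omega> + c1 / q) * A) + ((q - \<omega> + 2 + c2 / q) * B)"
    if "(\<bar>c1\<bar> + K) / q * A + (\<bar>c2\<bar> + K) / q * B \<le> 2 * B" "0 < A" "0 < B" "0 < q" for q A B :: real
  proof -
    have m: "c / q * X \<le> d / q * X" if "c \<le> d" "0 < X" for c d X :: real
      using that \<open>0 < q\<close> by (intro mult_right_mono divide_right_mono) auto
    have a: "(c1 + K) / q * A \<le> (\<bar>c1\<bar> + K) / q * A" "(- c2 - K) / q * B \<le> (\<bar>c2\<bar> + K) / q * B"
      "(K - c1) / q * A \<le> (\<bar>c1\<bar> + K) / q * A" "(K - c2) / q * B \<le> (\<bar>c2\<bar> + K) / q * B"
      by (rule m; use that(2,3) K in linarith)+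
    have "((q - \<omega> + c1 / q) * A) - ((q - \<omega> + 2 + c2 / q) * B) = (q - \<omega> - K / q) * (A - B) + ((c1 + K) / q * A + (- c2 - K) / q * B - 2 * B)"
      by (simp add: algebra_simps add_divide_distrib diff_divide_distrib)
    then show "((q - \<omega> + c1 / q) * A) - ((q - \<omega> + 2 + c2 / q) * B) \<le> (q - \<omega> - K / q) * (A - B)" using a that(1) by linarith
    have "((q - \<omega> + c1 / q) * A) + ((q - \<omega> + 2 + c2 / q) * B) = (q - \<omega> + K / q) * (A + B) + (2 * B - (K - c1) / q * A - (K - c2) / q * B)"
      by (simp add: algebra_simps add_divide_distrib diff_divide_distrib)
    then show "(q - \<omega> + K / q) * (A + B) \<le> ((q - \<omega> + c1 / q) * A) + ((q - \<omega> + 2 + c2 / q) * B)" using a that(1) by linarith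
  qed
  show ?thesis
  proof (rule that[OF R0])
    fix x :: 'a assume "R0 \<le> norm x"
    note F = facts[OF this]
    have p: "0 < barrier \<gamma> x" "0 < barrier (\<gamma> - 1) x" "0 < (norm x)\<^sup>2" using F barrier_pos by auto
    note fin' = fin[OF F[THEN conjunct2, THEN conjunct2, THEN conjunct2] p]
    show "\<exists>L. has_laplacian (\<lambda>x. barrier \<gamma> x - barrier (\<gamma> - 1) x) L x \<and>
        L \<le> ((norm x)\<^sup>2 - \<omega> - K / (norm x)\<^sup>2) * (barrier \<gamma> x - barrier (\<gamma> - 1) x)"
      using has_laplacian_diff F fin'(1) by blast
    have "has_laplacian (\<lambda>x. barrier \<gamma> x - (- 1) * barrier (\<gamma> - 1) x)
       (((norm x)\<^sup>2 - \<omega> + c1 / (norm x)\<^sup>2) * barrier \<gamma> x - (- 1) * (((norm x)\<^sup>2 - \<omega> + 2 + c2 / (norm x)\<^sup>2) * barrier (\<gamma> - 1) x)) x"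
      using F by (intro has_laplacian_diff has_laplacian_cmult) auto
    then show "\<exists>L. has_laplacian (\<lambda>x. barrier \<gamma> x + barrier (\<gamma> - 1) x) L x \<and>
        ((norm x)\<^sup>2 - \<omega> + K / (norm x)\<^sup>2) * (barrier \<gamma> x + barrier (\<gamma> - 1) x) \<le> L"
      using fin'(2) by auto
  qed
qed

section \<open>Bounds from the heat flow\<close>

text \<open>All that is kept of the equation is the identity obtained from Gaussian test functions.
  The representative v is Borel measurable and nonnegative everywhere, so its integrals can be
  compared pointwise.\<close>

locale gaussian_solution =
  fixes f :: "real \<Rightarrow> real" and \<omega> :: real and v :: "'a::euclidean_space \<Rightarrow> real"
  assumes dc: "dual_change f" and vm [measurable]: "v \<in> borel_measurable borel" and v_nonneg: "\<And>y. 0 \<le> v y"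
    and v_pos: "AE y in lborel. 0 < v y"
    and v2: "integrable lborel (\<lambda>y. (v y)\<^sup>2)" and vx2: "integrable lborel (\<lambda>y. (v y)\<^sup>2 * (norm y)\<^sup>2)"
    and gauss_eq: "\<And>a x. 0 < a \<Longrightarrow>
      (LINT y|lborel. v y * ((4 * a\<^sup>2 * (norm (x - y))\<^sup>2 - 2 * a * real DIM('a)) * exp (- a * (norm (x - y))\<^sup>2)))
      = (LINT y|lborel. dual_h f \<omega> y (v y) * exp (- a * (norm (x - y))\<^sup>2))"
begin

text \<open>Up to a constant, a^(N/2) times this is the heat flow started from v, at time 1 / (4
  a).\<close>

definition I :: "real \<Rightarrow> 'a \<Rightarrow> real" where
  "I a x = (LINT y|lborel. v y * exp (- a * (norm (x - y))\<^sup>2))"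

text \<open>The second Gaussian moment of v, which is minus the derivative of \<open>I\<close> in
  a.\<close>

definition Q :: "real \<Rightarrow> 'a \<Rightarrow> real" where
  "Q a x = (LINT y|lborel. v y * ((norm (x - y))\<^sup>2 * exp (- a * (norm (x - y))\<^sup>2)))"

definition h :: "'a \<Rightarrow> real" where
  "h y = dual_h f \<omega> y (v y)"

lemma h_measurable [measurable]: "h \<in> borel_measurable borel"
  unfolding h_def[abs_def] by (rule dual_h_measurable[OF dc vm])

lemma integrable_I: "0 < a \<Longrightarrow> integrable lborel (\<lambda>y. v y * exp (- a * (norm (x - y))\<^sup>2))"
  by (rule integrable_gauss_poly[OF vm _ v2, where m=0 and C=1 and x=x and a=a]) (auto simp: abs_mult)

lemma sq_le_one_plus_sq: "(norm z)\<^sup>2 \<le> (1 + norm z)\<^sup>2"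
  by (intro power_mono) auto

lemma integrable_Q: "0 < a \<Longrightarrow> integrable lborel (\<lambda>y. v y * ((norm (x - y))\<^sup>2 * exp (- a * (norm (x - y))\<^sup>2)))"
  by (rule integrable_gauss_poly[OF vm _ v2, where m=2 and C=1 and x=x and a=a])
    (auto simp: abs_mult intro!: mult_left_mono mult_right_mono sq_le_one_plus_sq)

lemma integrable_h:
  assumes a: "0 < a"
  shows "integrable lborel (\<lambda>y. h y * exp (- a * (norm (x - y))\<^sup>2))"
proof (rule integrable_gauss_poly[OF vm _ v2 a])
  show "\<bar>h y * exp (- a * (norm (x - y))\<^sup>2)\<bar>
    \<le> \<bar>v y\<bar> * (((2 + \<bar>\<omega>\<bar>) * (1 + norm x)\<^sup>2) * ((1 + norm (x - y)) ^ 2 * exp (- a * (norm (x - y))\<^sup>2)))" for y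
    unfolding h_def by (rule dual_h_gauss_bound[OF dc])
qed measurable

lemma I_nonneg: "0 \<le> I a x"
  unfolding I_def using v_nonneg by (intro Bochner_Integration.integral_nonneg) auto

text \<open>As Q is minus the derivative of I, this is a first-order equation in a; pointwise bounds
  for h turn it into differential inequalities.\<close>

lemma gauss_eq_IQ:
  assumes a: "0 < a"
  shows "4 * a\<^sup>2 * Q a x - 2 * a * real DIM('a) * I a x = (LINT y|lborel. h y * exp (- a * (norm (x - y))\<^sup>2))"
proof -
  have "(LINT y|lborel. v y * ((4 * a\<^sup>2 * (norm (x - y))\<^sup>2 - 2 * a * real DIM('a)) * exp (- a * (norm (x - y))\<^sup>2)))
    = (LINT y|lborel. 4 * a\<^sup>2 * (v y * ((norm (x - y))\<^sup>2 * exp (- a * (norm (x - y))\<^sup>2))) - 2 * a * real DIM('a) * (v y * exp (- a * (norm (x - y))\<^sup>2)))"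
    by (rule Bochner_Integration.integral_cong) (auto simp: algebra_simps)
  also have "\<dots> = 4 * a\<^sup>2 * Q a x - 2 * a * real DIM('a) * I a x"
    unfolding I_def Q_def using integrable_I[OF a, of x] integrable_Q[OF a, of x] by simp
  finally show ?thesis using gauss_eq[OF a, of x] by (simp add: h_def)
qed

lemma DERIV_I:
  assumes a: "0 < a"
  shows "((\<lambda>a. I a x) has_real_derivative - Q a x) (at a)"
proof -
  have "((\<lambda>a. LINT y|lborel. v y * exp (- a * (norm (x - y))\<^sup>2)) has_real_derivative
     (LINT y|lborel. v y * (- ((norm (x - y))\<^sup>2) * exp (- a * (norm (x - y))\<^sup>2)))) (at a)"
  proof (rule has_real_derivative_integral[where \<delta>="a / 2"
        and D="\<lambda>y. v y * ((norm (x - y))\<^sup>2 * exp (- (a / 2) * (norm (x - y))\<^sup>2))"])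
    show "((\<lambda>s. v y * exp (- s * (norm (x - y))\<^sup>2)) has_real_derivative v y * (- ((norm (x - y))\<^sup>2) * exp (- s * (norm (x - y))\<^sup>2))) (at s)" for s y
      by (auto intro!: derivative_eq_intros)
    show "integrable lborel (\<lambda>y. v y * exp (- a * (norm (x - y))\<^sup>2))" by (rule integrable_I[OF a])
    show "integrable lborel (\<lambda>y. v y * ((norm (x - y))\<^sup>2 * exp (- (a / 2) * (norm (x - y))\<^sup>2)))"
      by (rule integrable_Q) (use a in simp)
    fix s y assume "\<bar>s - a\<bar> < a / 2"
    then have "a / 2 \<le> s" by linarith
    then have "exp (- s * (norm (x - y))\<^sup>2) \<le> exp (- (a / 2) * (norm (x - y))\<^sup>2)"
      using mult_right_mono[of "a / 2" s "(norm (x - y))\<^sup>2"] by simp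
    then have "(norm (x - y))\<^sup>2 * exp (- s * (norm (x - y))\<^sup>2) \<le> (norm (x - y))\<^sup>2 * exp (- (a / 2) * (norm (x - y))\<^sup>2)"
      by (rule mult_left_mono) simp
    from mult_left_mono[OF this v_nonneg[of y]]
    show "\<bar>v y * (- ((norm (x - y))\<^sup>2) * exp (- s * (norm (x - y))\<^sup>2))\<bar> \<le> v y * ((norm (x - y))\<^sup>2 * exp (- (a / 2) * (norm (x - y))\<^sup>2))"
      using v_nonneg[of y] by (simp add: abs_mult)
  qed (use a in auto)
  then show ?thesis unfolding I_def Q_def by simp
qed

text \<open>The power compensates the spreading of the Gaussian, and exp (c / a) is an integrating
  factor: c is to be chosen so that the bracket has a sign.\<close>

lemma DERIV_weighted_I:
  assumes a: "0 < a"
  shows "((\<lambda>a. a powr (real DIM('a) / 2) * exp (c / a) * I a x) has_real_derivative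
    a powr (real DIM('a) / 2) * exp (c / a) * ((real DIM('a) / (2 * a) - c / a\<^sup>2) * I a x - Q a x)) (at a)"
proof -
  let ?n = "real DIM('a) / 2"
  have "((\<lambda>a. a powr ?n) has_real_derivative ?n * a powr (?n - 1)) (at a)"
    using a by (auto intro!: derivative_eq_intros)
  moreover have "a powr (?n - 1) = a powr ?n / a" using a by (simp add: powr_diff)
  ultimately have p: "((\<lambda>a. a powr ?n) has_real_derivative a powr ?n * (?n / a)) (at a)" by (simp add: mult.commute)
  have e: "((\<lambda>a. exp (c / a)) has_real_derivative exp (c / a) * (- (c / a\<^sup>2))) (at a)"
    using a by (auto intro!: derivative_eq_intros simp: power2_eq_square)
  have "((\<lambda>a. a powr ?n * exp (c / a) * I a x) has_real_derivative
     (a powr ?n * (?n / a) * exp (c / a) + exp (c / a) * (- (c / a\<^sup>2)) * a powr ?n) * I a x + (- Q a x) * (a powr ?n * exp (c / a))) (at a)"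
    by (rule DERIV_mult[OF DERIV_mult[OF p e] DERIV_I[OF a]])
  moreover have "(a powr ?n * (?n / a) * exp (c / a) + exp (c / a) * (- (c / a\<^sup>2)) * a powr ?n) * I a x + (- Q a x) * (a powr ?n * exp (c / a))
     = a powr ?n * exp (c / a) * ((real DIM('a) / (2 * a) - c / a\<^sup>2) * I a x - Q a x)"
    by (simp add: algebra_simps)
  ultimately show ?thesis by simp
qed

lemma h_ge: "- \<bar>\<omega>\<bar> * v y \<le> h y"
proof -
  have p: "0 \<le> dual_p f (v y)" "dual_p f (v y) \<le> v y" "0 \<le> dual_q f (v y)"
    using dual_p_nonneg[OF dc v_nonneg] dual_p_abs[OF dc, of "v y"] dual_q_nonneg[OF dc v_nonneg] v_nonneg[of y] by auto
  have "- \<bar>\<omega>\<bar> * v y \<le> - \<bar>\<omega>\<bar> * dual_p f (v y)" using p(2) by (simp add: mult_left_mono)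
  also have "\<dots> \<le> ((norm y)\<^sup>2 - \<omega>) * dual_p f (v y)"
  proof (rule mult_right_mono[OF _ p(1)])
    show "- \<bar>\<omega>\<bar> \<le> (norm y)\<^sup>2 - \<omega>" using zero_le_power2[of "norm y"] by linarith
  qed
  finally show ?thesis using p(3) by (simp add: h_def dual_h_def)
qed

lemma h_le: "h y \<le> ((norm y)\<^sup>2 + \<bar>\<omega>\<bar> + 1) * v y"
  using dual_h_bound[OF dc, of \<omega> y "v y"] v_nonneg[of y] by (simp add: h_def abs_le_iff)

text \<open>From h >= -|\<omega>| v follows 4 a^2 Q >= (2 a N - |\<omega>|) I, so c = |\<omega>| / 4
  makes the derivative nonpositive. All sharper averages are thereby controlled by the one at a =
  1.\<close>

lemma weighted_I_decreasing:
  assumes b: "1 \<le> b"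
  shows "b powr (real DIM('a) / 2) * I b x \<le> exp (\<bar>\<omega>\<bar> / 4) * I 1 x"
proof -
  let ?n = "real DIM('a)"
  define M where "M a = a powr (?n / 2) * exp ((\<bar>\<omega>\<bar> / 4) / a) * I a x" for a
  have "M b \<le> M 1"
  proof (rule DERIV_nonpos_imp_nonincreasing[OF b])
    fix a :: real assume "1 \<le> a" "a \<le> b"
    then have a: "0 < a" by simp
    have "- \<bar>\<omega>\<bar> * I a x \<le> 4 * a\<^sup>2 * Q a x - 2 * a * ?n * I a x"
    proof -
      have "- \<bar>\<omega>\<bar> * I a x = (LINT y|lborel. - \<bar>\<omega>\<bar> * (v y * exp (- a * (norm (x - y))\<^sup>2)))" unfolding I_def by simp
      also have "\<dots> \<le> (LINT y|lborel. h y * exp (- a * (norm (x - y))\<^sup>2))"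
      proof (rule integral_mono)
        show "- \<bar>\<omega>\<bar> * (v y * exp (- a * (norm (x - y))\<^sup>2)) \<le> h y * exp (- a * (norm (x - y))\<^sup>2)" for y
          using mult_right_mono[OF h_ge[of y], of "exp (- a * (norm (x - y))\<^sup>2)"] by (simp add: mult.assoc)
      qed (intro integrable_mult_right integrable_I[OF a] integrable_h[OF a])+
      finally show ?thesis using gauss_eq_IQ[OF a, of x] by simp
    qed
    then have "(2 * a * ?n - \<bar>\<omega>\<bar>) * I a x \<le> 4 * a\<^sup>2 * Q a x" by (simp add: algebra_simps)
    then have "(2 * a * ?n - \<bar>\<omega>\<bar>) * I a x / (4 * a\<^sup>2) \<le> Q a x" using a by (simp add: pos_divide_le_eq mult.commute)
    moreover have "(2 * a * ?n - \<bar>\<omega>\<bar>) * I a x / (4 * a\<^sup>2) = (?n / (2 * a) - (\<bar>\<omega>\<bar> / 4) / a\<^sup>2) * I a x"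
      using a by (simp add: field_simps power2_eq_square)
    ultimately have "(?n / (2 * a) - (\<bar>\<omega>\<bar> / 4) / a\<^sup>2) * I a x - Q a x \<le> 0" by simp
    then have "a powr (?n / 2) * exp ((\<bar>\<omega>\<bar> / 4) / a) * ((?n / (2 * a) - (\<bar>\<omega>\<bar> / 4) / a\<^sup>2) * I a x - Q a x) \<le> 0"
      by (intro mult_nonneg_nonpos) auto
    then show "\<exists>y. (M has_real_derivative y) (at a) \<and> y \<le> 0"
      unfolding M_def[abs_def] using DERIV_weighted_I[OF a] by blast
  qed
  moreover have "b powr (?n / 2) * I b x \<le> M b"
  proof -
    have "1 \<le> exp ((\<bar>\<omega>\<bar> / 4) / b)" using b by simp
    then have "b powr (?n / 2) * I b x * 1 \<le> b powr (?n / 2) * I b x * exp ((\<bar>\<omega>\<bar> / 4) / b)"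
      by (rule mult_left_mono) (simp add: I_nonneg)
    then show ?thesis by (simp add: M_def mult_ac)
  qed
  ultimately show ?thesis by (simp add: M_def)
qed

text \<open>By |y|^2 <= 2 |x|^2 + 2 |x - y|^2 the upper bound for h involves Q itself and gives (4
  a^2 - 2) Q <= (2 a N + K) I. For a >= 1 the coefficient of Q is positive, and the integrating
  factor exp (-c / (2 a)) makes the derivative nonnegative; the price is a factor depending on
  |x|.\<close>

lemma weighted_I_increasing:
  assumes b: "1 \<le> b"
  shows "exp (- ((real DIM('a) + 2 * (norm x)\<^sup>2 + \<bar>\<omega>\<bar> + 1) / 2)) * I 1 x \<le> b powr (real DIM('a) / 2) * I b x"
proof -
  let ?n = "real DIM('a)"
  define K where "K = 2 * (norm x)\<^sup>2 + \<bar>\<omega>\<bar> + 1"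
  \<comment> \<open>The product (4 a^2 - 2) (N / (2 a) + c / (2 a^2)) equals 2 a N - N / a + 2 c - c
    / a^2, which for a >= 1 is at least 2 a N + c - N; this has to be 2 a N + K.\<close>
  define c where "c = ?n + K"
  have K0: "0 \<le> K" by (simp add: K_def)
  define M where "M a = a powr (?n / 2) * exp ((- (c / 2)) / a) * I a x" for a
  have "M 1 \<le> M b"
  proof (rule DERIV_nonneg_imp_nondecreasing[OF b])
    fix a :: real assume a1: "1 \<le> a" "a \<le> b"
    then have a: "0 < a" by simp
    have "4 * a\<^sup>2 * Q a x - 2 * a * ?n * I a x \<le> 2 * Q a x + K * I a x"
    proof -
      have "(LINT y|lborel. h y * exp (- a * (norm (x - y))\<^sup>2))
        \<le> (LINT y|lborel. 2 * (v y * ((norm (x - y))\<^sup>2 * exp (- a * (norm (x - y))\<^sup>2))) + K * (v y * exp (- a * (norm (x - y))\<^sup>2)))"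
      proof (rule integral_mono)
        fix y
        have "norm y \<le> norm x + norm (x - y)" using norm_triangle_sub[of y x] by (simp add: norm_minus_commute)
        then have "(norm y)\<^sup>2 \<le> (norm x + norm (x - y))\<^sup>2" by (intro power_mono) auto
        also have "\<dots> \<le> 2 * (norm x)\<^sup>2 + 2 * (norm (x - y))\<^sup>2"
          using sum_squares_bound[of "norm x" "norm (x - y)"] by (simp add: power2_sum)
        finally have "((norm y)\<^sup>2 + \<bar>\<omega>\<bar> + 1) * v y \<le> (2 * (norm (x - y))\<^sup>2 + K) * v y"
          using v_nonneg[of y] by (intro mult_right_mono) (auto simp: K_def)
        then have "h y \<le> (2 * (norm (x - y))\<^sup>2 + K) * v y" using h_le[of y] by simp
        from mult_right_mono[OF this, of "exp (- a * (norm (x - y))\<^sup>2)"]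
        show "h y * exp (- a * (norm (x - y))\<^sup>2)
          \<le> 2 * (v y * ((norm (x - y))\<^sup>2 * exp (- a * (norm (x - y))\<^sup>2))) + K * (v y * exp (- a * (norm (x - y))\<^sup>2))"
          by (simp add: algebra_simps)
      qed (intro Bochner_Integration.integrable_add integrable_mult_right integrable_I[OF a] integrable_h[OF a] integrable_Q[OF a])+
      also have "\<dots> = 2 * Q a x + K * I a x"
        unfolding I_def Q_def using integrable_I[OF a, of x] integrable_Q[OF a, of x] by simp
      finally show ?thesis using gauss_eq_IQ[OF a, of x] by simp
    qed
    then have "(4 * a\<^sup>2 - 2) * Q a x \<le> (2 * a * ?n + K) * I a x" by (simp add: algebra_simps)
    also have "\<dots> \<le> ((4 * a\<^sup>2 - 2) * (?n / (2 * a) + (c / 2) / a\<^sup>2)) * I a x"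
    proof (rule mult_right_mono[OF _ I_nonneg])
      have "(4 * a\<^sup>2 - 2) * (?n / (2 * a) + (c / 2) / a\<^sup>2) = 2 * a * ?n - ?n / a + 2 * c - c / a\<^sup>2"
        using a by (simp add: field_simps power2_eq_square)
      moreover have "c / a\<^sup>2 \<le> c / 1" using a1(1) K0 by (intro divide_left_mono) (auto simp: c_def)
      moreover have "?n / a \<le> ?n / 1" using a1(1) by (intro divide_left_mono) auto
      ultimately show "2 * a * ?n + K \<le> (4 * a\<^sup>2 - 2) * (?n / (2 * a) + (c / 2) / a\<^sup>2)" by (simp add: c_def)
    qed
    finally have "(4 * a\<^sup>2 - 2) * Q a x \<le> (4 * a\<^sup>2 - 2) * ((?n / (2 * a) + (c / 2) / a\<^sup>2) * I a x)" by (simp add: mult.assoc)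
    moreover have "0 < 4 * a\<^sup>2 - 2" using one_le_power[OF a1(1), of 2] by simp
    ultimately have "Q a x \<le> (?n / (2 * a) + (c / 2) / a\<^sup>2) * I a x" by (rule mult_left_le_imp_le)
    then have "0 \<le> a powr (?n / 2) * exp ((- (c / 2)) / a) * ((?n / (2 * a) - (- (c / 2)) / a\<^sup>2) * I a x - Q a x)"
      by (intro mult_nonneg_nonneg) auto
    then show "\<exists>y. (M has_real_derivative y) (at a) \<and> 0 \<le> y"
      unfolding M_def[abs_def] using DERIV_weighted_I[OF a, of "- (c / 2)" x] by blast
  qed
  moreover have "M b \<le> b powr (?n / 2) * I b x"
  proof -
    have "exp ((- (c / 2)) / b) \<le> 1" using b K0 by (simp add: c_def)
    then have "b powr (?n / 2) * I b x * exp ((- (c / 2)) / b) \<le> b powr (?n / 2) * I b x * 1"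
      by (rule mult_left_mono) (simp add: I_nonneg)
    then show ?thesis by (simp add: M_def mult_ac)
  qed
  ultimately show ?thesis by (simp add: M_def c_def K_def add.assoc)
qed

lemma moll_eq_I:
  assumes "0 < s"
  shows "moll v s x = (s\<^sup>2) powr (real DIM('a) / 2) * I (s\<^sup>2) x"
proof -
  have "(s\<^sup>2) powr (real DIM('a) / 2) = s ^ DIM('a)"
    using assms by (simp add: powr_powr powr_realpow flip: powr_numeral)
  then show ?thesis by (simp add: moll_def I_def)
qed

text \<open>From 1 + |x| <= (1 + |y|) (1 + |x - y|) and a b <= a^2 + b^2. The weight (1 + |y|)^2 is
  integrable against v^2 because v lies in H: here the confining part of the norm produces
  decay.\<close>

lemma I1_decay: "\<exists>C>0. \<forall>x. I 1 x \<le> C / (1 + norm x)"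
proof -
  define A where "A = (LINT y|lborel. (1 + norm y)\<^sup>2 * (v y)\<^sup>2)"
  define D where "D = (LINT z|lborel. (1 + norm (z::'a))\<^sup>2 * exp (- 2 * (norm z)\<^sup>2))"
  have iA: "integrable lborel (\<lambda>y. (1 + norm y)\<^sup>2 * (v y)\<^sup>2)"
  proof (rule Bochner_Integration.integrable_bound)
    show "integrable lborel (\<lambda>y. 2 * (v y)\<^sup>2 + 2 * ((v y)\<^sup>2 * (norm y)\<^sup>2))"
      using v2 vx2 by (intro Bochner_Integration.integrable_add integrable_mult_right)
    show "AE y in lborel. norm ((1 + norm y)\<^sup>2 * (v y)\<^sup>2) \<le> norm (2 * (v y)\<^sup>2 + 2 * ((v y)\<^sup>2 * (norm y)\<^sup>2))"
    proof (rule AE_I2)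
      fix y :: 'a
      have "(1 + norm y)\<^sup>2 \<le> 2 + 2 * (norm y)\<^sup>2" using sum_squares_bound[of 1 "norm y"] by (simp add: power2_sum)
      then have "(1 + norm y)\<^sup>2 * (v y)\<^sup>2 \<le> (2 + 2 * (norm y)\<^sup>2) * (v y)\<^sup>2" by (rule mult_right_mono) simp
      then show "norm ((1 + norm y)\<^sup>2 * (v y)\<^sup>2) \<le> norm (2 * (v y)\<^sup>2 + 2 * ((v y)\<^sup>2 * (norm y)\<^sup>2))"
        by (simp add: algebra_simps abs_mult)
    qed
  qed simp
  obtain C :: real where C: "C > 0" "\<And>r. 0 \<le> r \<Longrightarrow> (1 + r) ^ 2 * exp (- 2 * r\<^sup>2) \<le> C * exp (- (2/2) * r\<^sup>2)"
    by (rule poly_gauss_bound[of 2 2], simp, rule that, assumption+)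
  have iD: "integrable lborel (\<lambda>z::'a. (1 + norm z)\<^sup>2 * exp (- 2 * (norm z)\<^sup>2))"
  proof (rule Bochner_Integration.integrable_bound)
    show "integrable lborel (\<lambda>z::'a. C * exp (- (norm z)\<^sup>2))" by (intro integrable_mult_right integrable_gauss0)
    show "AE z::'a in lborel. norm ((1 + norm z)\<^sup>2 * exp (- 2 * (norm z)\<^sup>2)) \<le> norm (C * exp (- (norm z)\<^sup>2))"
      using C(2)[OF norm_ge_zero] C(1) by (auto simp: abs_mult)
  qed simp
  have D: "(LINT y|lborel. (1 + norm (x - y))\<^sup>2 * exp (- 2 * (norm (x - y))\<^sup>2)) = D"
    "integrable lborel (\<lambda>y. (1 + norm (x - y))\<^sup>2 * exp (- 2 * (norm (x - y))\<^sup>2))" for x :: 'a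
    using integrable_affine_euclidean[of "-1" "\<lambda>z::'a. (1 + norm z)\<^sup>2 * exp (- 2 * (norm z)\<^sup>2)" x] iD
    by (auto simp: D_def)
  have "I 1 x \<le> (A + D + 1) / (1 + norm x)" for x
  proof -
    have "(1 + norm x) * I 1 x = (LINT y|lborel. (1 + norm x) * (v y * exp (- 1 * (norm (x - y))\<^sup>2)))"
      unfolding I_def by simp
    also have "\<dots> \<le> (LINT y|lborel. (1 + norm y)\<^sup>2 * (v y)\<^sup>2 + (1 + norm (x - y))\<^sup>2 * exp (- 2 * (norm (x - y))\<^sup>2))"
    proof (rule integral_mono)
      show "integrable lborel (\<lambda>y. (1 + norm x) * (v y * exp (- 1 * (norm (x - y))\<^sup>2)))"
        by (intro integrable_mult_right integrable_I) simp
      show "integrable lborel (\<lambda>y. (1 + norm y)\<^sup>2 * (v y)\<^sup>2 + (1 + norm (x - y))\<^sup>2 * exp (- 2 * (norm (x - y))\<^sup>2))"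
        by (intro Bochner_Integration.integrable_add iA D)
      fix y
      let ?e = "exp (- 1 * (norm (x - y))\<^sup>2)"
      have e2: "?e\<^sup>2 = exp (- 2 * (norm (x - y))\<^sup>2)" by (simp add: exp_double[symmetric] power2_eq_square exp_add[symmetric])
      have "norm x \<le> norm y + norm (x - y)" using norm_triangle_sub[of x y] by simp
      then have "1 + norm x \<le> (1 + norm y) * (1 + norm (x - y))"
      proof -
        have "(1 + norm y) * (1 + norm (x - y)) = 1 + norm y + norm (x - y) + norm y * norm (x - y)" by (simp add: algebra_simps)
        moreover have "0 \<le> norm y * norm (x - y)" by simp
        ultimately show ?thesis using \<open>norm x \<le> norm y + norm (x - y)\<close> by linarith
      qed
      then have "(1 + norm x) * (v y * ?e) \<le> ((1 + norm y) * (1 + norm (x - y))) * (v y * ?e)"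
        using v_nonneg[of y] by (intro mult_right_mono) auto
      also have "\<dots> = ((1 + norm y) * v y) * ((1 + norm (x - y)) * ?e)" by (simp only: mult_ac)
      also have "\<dots> \<le> ((1 + norm y) * v y)\<^sup>2 + ((1 + norm (x - y)) * ?e)\<^sup>2"
      proof -
        have "0 \<le> ((1 + norm y) * v y) * ((1 + norm (x - y)) * ?e)" using v_nonneg[of y] by simp
        then show ?thesis using sum_squares_bound[of "(1 + norm y) * v y" "(1 + norm (x - y)) * ?e"] by linarith
      qed
      also have "\<dots> = (1 + norm y)\<^sup>2 * (v y)\<^sup>2 + (1 + norm (x - y))\<^sup>2 * exp (- 2 * (norm (x - y))\<^sup>2)"
        unfolding power_mult_distrib e2 by (rule refl)
      finally show "(1 + norm x) * (v y * ?e) \<le> (1 + norm y)\<^sup>2 * (v y)\<^sup>2 + (1 + norm (x - y))\<^sup>2 * exp (- 2 * (norm (x - y))\<^sup>2)" .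
    qed
    also have "\<dots> = A + D" unfolding A_def using iA D[of x] by simp
    finally have "(1 + norm x) * I 1 x \<le> A + D + 1" by simp
    moreover have "0 < 1 + norm x" using norm_ge_zero[of x] by linarith
    ultimately show ?thesis by (simp add: pos_le_divide_eq mult.commute)
  qed
  moreover have "0 < A + D + 1"
  proof -
    have "0 \<le> A" "0 \<le> D" unfolding A_def D_def by (auto intro!: Bochner_Integration.integral_nonneg)
    then show ?thesis by simp
  qed
  ultimately show ?thesis by blast
qed

text \<open>Uniform in n, because the average at a = (n + 1)^2 is controlled by the one at a =
  1.\<close>

lemma moll_decay: "\<exists>C>0. \<forall>n x. moll v (real (Suc n)) x \<le> C / (1 + norm x)"
proof -
  obtain C where C: "C > 0" "\<And>x. I 1 x \<le> C / (1 + norm x)" using I1_decay by blast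
  have "moll v (real (Suc n)) x \<le> (exp (\<bar>\<omega>\<bar> / 4) * C) / (1 + norm x)" for n x
  proof -
    have "1 \<le> (real (Suc n))\<^sup>2" by (intro one_le_power) simp
    from weighted_I_decreasing[OF this, of x] have "moll v (real (Suc n)) x \<le> exp (\<bar>\<omega>\<bar> / 4) * I 1 x"
      by (subst moll_eq_I) auto
    also have "\<dots> \<le> exp (\<bar>\<omega>\<bar> / 4) * (C / (1 + norm x))" by (rule mult_left_mono[OF C(2)]) simp
    finally show ?thesis by simp
  qed
  moreover have "0 < exp (\<bar>\<omega>\<bar> / 4) * C" using C(1) by simp
  ultimately show ?thesis by blast
qed

text \<open>This takes the role of Harnack's inequality. Positivity of v almost everywhere makes the
  average at a = 1 positive, uniformly on balls, and the monotone weight carries this to all sharper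
  averages.\<close>

lemma moll_lower: "\<exists>c>0. \<forall>n x. norm x \<le> R \<longrightarrow> c \<le> moll v (real (Suc n)) x"
proof -
  define J where "J = (LINT y|lborel. v y * exp (- 2 * (norm y)\<^sup>2))"
  have iJ: "integrable lborel (\<lambda>y. v y * exp (- 2 * (norm y)\<^sup>2))" using integrable_I[of 2 0] by simp
  have "0 < J"
  proof -
    have "0 \<le> J" unfolding J_def using v_nonneg by (intro Bochner_Integration.integral_nonneg) auto
    moreover have "J \<noteq> 0"
    proof
      assume "J = 0"
      then have "AE y in lborel. v y * exp (- 2 * (norm y)\<^sup>2) = 0"
        unfolding J_def using integral_nonneg_eq_0_iff_AE[OF iJ] v_nonneg by simp
      then have "AE y::'a in lborel. False" using v_pos by eventually_elim simp
      then obtain N :: "'a set" where N: "{z \<in> space lborel. \<not> False} \<subseteq> N" "emeasure lborel N = 0"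
        by (rule AE_E)
      then have "N = UNIV" by auto
      then show False using N(2) by simp
    qed
    ultimately show ?thesis by simp
  qed
  \<comment> \<open>The second factor bounds \<open>I 1 x\<close> from below, since |x - y|^2 <= 2
    R^2 + 2 |y|^2; the first is the loss in passing from a = 1 to larger a.\<close>
  define c where "c = exp (- ((real DIM('a) + 2 * R\<^sup>2 + \<bar>\<omega>\<bar> + 1) / 2)) * (exp (- 2 * R\<^sup>2) * J)"
  have "c \<le> moll v (real (Suc n)) x" if x: "norm x \<le> R" for n x
  proof -
    have x2: "(norm x)\<^sup>2 \<le> R\<^sup>2" using x by (intro power_mono) auto
    have "exp (- 2 * R\<^sup>2) * J = (LINT y|lborel. exp (- 2 * R\<^sup>2) * (v y * exp (- 2 * (norm y)\<^sup>2)))" unfolding J_def by simp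
    also have "\<dots> \<le> I 1 x"
      unfolding I_def
    proof (rule integral_mono)
      show "integrable lborel (\<lambda>y. exp (- 2 * R\<^sup>2) * (v y * exp (- 2 * (norm y)\<^sup>2)))" by (rule integrable_mult_right[OF iJ])
      show "integrable lborel (\<lambda>y. v y * exp (- 1 * (norm (x - y))\<^sup>2))" by (rule integrable_I) simp
      fix y
      have "(norm (x - y))\<^sup>2 \<le> (norm x + norm y)\<^sup>2" by (intro power_mono norm_triangle_ineq4) simp
      also have "\<dots> \<le> 2 * (norm x)\<^sup>2 + 2 * (norm y)\<^sup>2"
        using sum_squares_bound[of "norm x" "norm y"] by (simp add: power2_sum)
      finally have "exp (- 2 * R\<^sup>2) * exp (- 2 * (norm y)\<^sup>2) \<le> exp (- 1 * (norm (x - y))\<^sup>2)"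
        using x2 by (simp add: exp_add[symmetric])
      from mult_left_mono[OF this v_nonneg[of y]]
      show "exp (- 2 * R\<^sup>2) * (v y * exp (- 2 * (norm y)\<^sup>2)) \<le> v y * exp (- 1 * (norm (x - y))\<^sup>2)" by (simp add: mult_ac)
    qed
    finally have "c \<le> exp (- ((real DIM('a) + 2 * R\<^sup>2 + \<bar>\<omega>\<bar> + 1) / 2)) * I 1 x" unfolding c_def by (intro mult_left_mono) auto
    also have "\<dots> \<le> exp (- ((real DIM('a) + 2 * (norm x)\<^sup>2 + \<bar>\<omega>\<bar> + 1) / 2)) * I 1 x"
      using x2 by (intro mult_right_mono I_nonneg) simp
    also have "\<dots> \<le> ((real (Suc n))\<^sup>2) powr (real DIM('a) / 2) * I ((real (Suc n))\<^sup>2) x"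
      by (rule weighted_I_increasing) (intro one_le_power, simp)
    also have "\<dots> = moll v (real (Suc n)) x" by (rule moll_eq_I[symmetric]) simp
    finally show ?thesis .
  qed
  moreover have "0 < c" using \<open>0 < J\<close> by (simp add: c_def)
  ultimately show ?thesis by blast
qed

text \<open>The Gaussian identity at a = s^2, whose left-hand kernel is the Laplacian in x of the
  mollifier.\<close>

lemma moll_laplacian: "0 < s \<Longrightarrow> has_laplacian (moll v s) (moll h s x) x"
  using moll_has_laplacian[OF vm v2, of s x] gauss_eq[of "s\<^sup>2" x] by (simp add: moll_def h_def)

section \<open>Decay of the solution and the two bounds\<close>

lemma v_AE_decay: "\<exists>C>0. AE y in lborel. v y \<le> C / (1 + norm y)"
proof -
  obtain C where C: "C > 0" "\<And>n x. moll v (real (Suc n)) x \<le> C / (1 + norm x)" using moll_decay by blast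
  let ?Z = "gauss_mass TYPE('a)"
  have pos: "0 < 1 + norm x" for x :: 'a using norm_ge_zero[of x] by linarith
  have "AE x in lborel. x \<in> (UNIV::'a set) \<longrightarrow> ?Z * v x \<le> C / (1 + norm x)"
  proof (rule moll_limit_AE_le[OF vm v2])
    show "\<bar>C / (1 + norm x)\<bar> \<le> C" for x :: 'a
    proof -
      have "C / (1 + norm x) \<le> C / 1" using C(1) pos[of x] by (intro divide_left_mono) auto
      then show ?thesis using C(1) pos[of x] by simp
    qed
  qed (use C in auto)
  then have "AE y in lborel. v y \<le> (C / ?Z) / (1 + norm y)"
  proof eventually_elim
    case (elim x)
    then have "v x \<le> C / (1 + norm x) / ?Z"
      using gauss_mass_pos[where 'a='a] by (subst pos_le_divide_eq) (auto simp: mult.commute)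
    then show ?case by (simp only: divide_divide_eq_left mult.commute)
  qed
  moreover have "0 < C / ?Z" using C(1) gauss_mass_pos[where 'a='a] by simp
  ultimately show ?thesis by blast
qed

text \<open>Near v = 0 the right-hand side is linear up to cubic terms: the first nonlinearity lies
  between v - 4 v^3 and v, the second between 0 and v^3. The assumption on y gives |y|^2 - \<omega>
  a sign, so that these bounds may be multiplied by it.\<close>

lemma nonlinear_estimate:
  assumes "\<bar>\<omega>\<bar> \<le> (norm y)\<^sup>2"
  shows "((norm y)\<^sup>2 - \<omega> - 4 * ((norm y)\<^sup>2 + \<bar>\<omega>\<bar>) * (v y)\<^sup>2) * v y \<le> h y"
    and "h y \<le> ((norm y)\<^sup>2 - \<omega> + (v y)\<^sup>2) * v y"
proof -
  have q: "0 \<le> (norm y)\<^sup>2 - \<omega>" using assms by linarith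
  have v3: "0 \<le> (v y) ^ 3" using v_nonneg by simp
  have "((norm y)\<^sup>2 - \<omega>) * (v y - 4 * (v y) ^ 3) \<le> ((norm y)\<^sup>2 - \<omega>) * dual_p f (v y)"
    by (rule mult_left_mono[OF dual_p_ge[OF dc v_nonneg] q])
  moreover have "((norm y)\<^sup>2 - \<omega>) * (4 * (v y) ^ 3) \<le> ((norm y)\<^sup>2 + \<bar>\<omega>\<bar>) * (4 * (v y) ^ 3)"
    using v3 by (intro mult_right_mono) auto
  moreover have "((norm y)\<^sup>2 - \<omega> - 4 * ((norm y)\<^sup>2 + \<bar>\<omega>\<bar>) * (v y)\<^sup>2) * v y
     = ((norm y)\<^sup>2 - \<omega>) * v y - ((norm y)\<^sup>2 + \<bar>\<omega>\<bar>) * (4 * (v y) ^ 3)"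
    by (simp add: algebra_simps power2_eq_square power3_eq_cube)
  ultimately show "((norm y)\<^sup>2 - \<omega> - 4 * ((norm y)\<^sup>2 + \<bar>\<omega>\<bar>) * (v y)\<^sup>2) * v y \<le> h y"
    using dual_q_nonneg[OF dc v_nonneg, of y] by (simp add: h_def dual_h_def right_diff_distrib)
  have "((norm y)\<^sup>2 - \<omega>) * dual_p f (v y) \<le> ((norm y)\<^sup>2 - \<omega>) * v y"
    using dual_p_abs[OF dc, of "v y"] v_nonneg[of y] by (intro mult_left_mono[OF _ q]) auto
  then show "h y \<le> ((norm y)\<^sup>2 - \<omega> + (v y)\<^sup>2) * v y"
    using dual_q_le_cube[OF dc v_nonneg, of y]
    by (simp add: h_def dual_h_def distrib_right power2_eq_square power3_eq_cube)
qed

lemma h_AE_bound: "\<exists>B. (AE y in lborel. \<bar>v y\<bar> \<le> B) \<and> (AE y in lborel. \<bar>h y\<bar> \<le> B * (1 + (norm y)\<^sup>2))"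
proof -
  obtain C where C: "C > 0" "AE y in lborel. v y \<le> C / (1 + norm y)" using v_AE_decay by blast
  have vC: "AE y in lborel. \<bar>v y\<bar> \<le> C"
    using C(2)
  proof eventually_elim
    case (elim y)
    have "C / (1 + norm y) \<le> C / 1" using C(1) by (intro divide_left_mono) (auto intro: add_pos_nonneg)
    then show ?case using elim v_nonneg[of y] by simp
  qed
  have "AE y in lborel. \<bar>v y\<bar> \<le> (1 + \<bar>\<omega>\<bar>) * C"
    using vC
  proof eventually_elim
    case (elim y)
    have "C \<le> (1 + \<bar>\<omega>\<bar>) * C" using C(1) by simp
    then show ?case using elim by linarith
  qed
  moreover have "AE y in lborel. \<bar>h y\<bar> \<le> ((1 + \<bar>\<omega>\<bar>) * C) * (1 + (norm y)\<^sup>2)"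
    using vC
  proof eventually_elim
    case (elim y)
    have "\<bar>h y\<bar> \<le> ((norm y)\<^sup>2 + \<bar>\<omega>\<bar> + 1) * \<bar>v y\<bar>" unfolding h_def by (rule dual_h_bound[OF dc])
    also have "\<dots> \<le> ((1 + \<bar>\<omega>\<bar>) * (1 + (norm y)\<^sup>2)) * C"
      using elim by (intro mult_mono) (auto simp: algebra_simps)
    finally show ?case by (simp add: mult_ac)
  qed
  ultimately show ?thesis by blast
qed

text \<open>With v <= C / (1 + |y|) the cubic error is at most a constant times v, hence h >= (|y|^2
  - K) v. The barrier exp (-|x|^2 / 4) has the potential |x|^2 / 4 - N / 2, which stays below |x|^2
  - K far out; the gap between the leading coefficients 1/4 and 1 swallows the constant.\<close>

lemma gaussian_decay: "\<exists>R C. 0 < C \<and> (AE y in lborel. R < norm y \<longrightarrow> v y \<le> C * exp (- ((norm y)\<^sup>2 / 4)))"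
proof -
  obtain C where C: "C > 0" "AE y in lborel. v y \<le> C / (1 + norm y)" using v_AE_decay by blast
  obtain C0 where C0: "C0 > 0" "\<And>n x. moll v (real (Suc n)) x \<le> C0 / (1 + norm x)" using moll_decay by blast
  obtain B where B: "AE y in lborel. \<bar>v y\<bar> \<le> B" "AE y in lborel. \<bar>h y\<bar> \<le> B * (1 + (norm y)\<^sup>2)"
    using h_AE_bound by blast
  \<comment> \<open>|\<omega>| covers the shift \<omega>, and the other summand bounds 4 (|y|^2 +
    |\<omega>|) v^2.\<close>
  define K where "K = \<bar>\<omega>\<bar> + 4 * (1 + \<bar>\<omega>\<bar>) * C\<^sup>2"
  have K0: "0 \<le> K" "\<bar>\<omega>\<bar> \<le> K" by (auto simp: K_def)
  \<comment> \<open>Gives |y|^2 >= 2 K + 1, hence both |y|^2 - K >= 1 and |\<omega>| <=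
    |y|^2.\<close>
  define R' where "R' = 2 * K + 1"
  have R': "1 \<le> R'" using K0 by (simp add: R'_def)
  have q: "2 * K + 1 \<le> (norm y)\<^sup>2" if "R' \<le> norm y" for y :: 'a
  proof -
    have "norm y * 1 \<le> norm y * norm y" using that R' by (intro mult_left_mono) auto
    then show ?thesis using that by (simp add: R'_def power2_eq_square)
  qed
  define R where "R = R' + 1"
  \<comment> \<open>Normalises the barrier to the value \<open>C0\<close> on |x| = R, where
    \<open>C0\<close> bounds all mollifications.\<close>
  define A where "A = C0 * exp (R\<^sup>2 / 4)"
  have A: "0 < A" using C0(1) by (simp add: A_def)
  define w where "w x = A * exp (- ((norm x)\<^sup>2 / 4))" for x :: 'a
  have dec: "C0 / (1 + norm x) \<le> C0" for x :: 'a
  proof -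
    have "C0 / (1 + norm x) \<le> C0 / 1" using C0(1) by (intro divide_left_mono) (auto intro: add_pos_nonneg)
    then show ?thesis by simp
  qed
  have "AE x in lborel. R < norm x \<longrightarrow> gauss_mass TYPE('a) * v x \<le> w x"
  proof (rule exterior_comparison_AE[OF vm h_measurable _ v2 B, where R'=R' and R=R and V="\<lambda>y. (norm y)\<^sup>2 - K" and ?V0.0=1])
    show "AE y in lborel. R' \<le> norm y \<longrightarrow> ((norm y)\<^sup>2 - K) * v y \<le> h y"
      using C(2)
    proof eventually_elim
      case (elim y)
      show ?case
      proof
        assume "R' \<le> norm y"
        then have om: "\<bar>\<omega>\<bar> \<le> (norm y)\<^sup>2" using q[of y] K0 by linarith
        have p: "0 < 1 + norm y" by (simp add: add_pos_nonneg)
        have "(1 + norm y) * v y \<le> C" using elim p by (simp add: pos_le_divide_eq mult.commute)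
        then have "((1 + norm y) * v y)\<^sup>2 \<le> C\<^sup>2" using v_nonneg[of y] by (intro power_mono) auto
        then have c: "(1 + norm y)\<^sup>2 * (v y)\<^sup>2 \<le> C\<^sup>2" by (simp add: power_mult_distrib)
        have "(norm y)\<^sup>2 + \<bar>\<omega>\<bar> \<le> (1 + \<bar>\<omega>\<bar>) * (1 + norm y)\<^sup>2"
        proof -
          have "(norm y)\<^sup>2 \<le> (1 + norm y)\<^sup>2" by (rule sq_le_one_plus_sq)
          moreover have "\<bar>\<omega>\<bar> * 1 \<le> \<bar>\<omega>\<bar> * (1 + norm y)\<^sup>2" by (intro mult_left_mono one_le_power) auto
          ultimately show ?thesis by (simp only: distrib_right mult_1_left mult_1_right)
        qed
        then have "((norm y)\<^sup>2 + \<bar>\<omega>\<bar>) * (v y)\<^sup>2 \<le> ((1 + \<bar>\<omega>\<bar>) * (1 + norm y)\<^sup>2) * (v y)\<^sup>2" by (rule mult_right_mono) simp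
        also have "\<dots> \<le> (1 + \<bar>\<omega>\<bar>) * C\<^sup>2" unfolding mult.assoc by (intro mult_left_mono c) simp
        finally have "4 * (((norm y)\<^sup>2 + \<bar>\<omega>\<bar>) * (v y)\<^sup>2) \<le> 4 * ((1 + \<bar>\<omega>\<bar>) * C\<^sup>2)" by simp
        then have "4 * ((norm y)\<^sup>2 + \<bar>\<omega>\<bar>) * (v y)\<^sup>2 \<le> 4 * (1 + \<bar>\<omega>\<bar>) * C\<^sup>2" by (simp only: mult.assoc)
        then have "(norm y)\<^sup>2 - K \<le> (norm y)\<^sup>2 - \<omega> - 4 * ((norm y)\<^sup>2 + \<bar>\<omega>\<bar>) * (v y)\<^sup>2" unfolding K_def by linarith
        from mult_right_mono[OF this v_nonneg[of y]] nonlinear_estimate(1)[OF om]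
        show "((norm y)\<^sup>2 - K) * v y \<le> h y" by linarith
      qed
    qed
    show "\<exists>L. has_laplacian w L x \<and> L \<le> ((norm x)\<^sup>2 - K) * w x" if "R < norm x" for x
    proof -
      have x0: "x \<noteq> 0" using that R' by (auto simp: R_def)
      have "has_laplacian w (A * (((norm x)\<^sup>2 / 4 - real DIM('a) / 2) * exp (- ((norm x)\<^sup>2 / 4)))) x"
        unfolding w_def[abs_def] by (rule has_laplacian_cmult[OF has_laplacian_gauss_quarter[OF x0]])
      moreover have "A * (((norm x)\<^sup>2 / 4 - real DIM('a) / 2) * exp (- ((norm x)\<^sup>2 / 4))) \<le> ((norm x)\<^sup>2 - K) * w x"
      proof -
        have "(norm x)\<^sup>2 / 4 - real DIM('a) / 2 \<le> (norm x)\<^sup>2 - K"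
          using q[of x] that K0 by (simp add: R_def)
        then have "((norm x)\<^sup>2 / 4 - real DIM('a) / 2) * w x \<le> ((norm x)\<^sup>2 - K) * w x"
          using A by (intro mult_right_mono) (auto simp: w_def)
        then show ?thesis by (simp add: w_def mult_ac)
      qed
      ultimately show ?thesis by blast
    qed
    show "moll v (real (Suc n)) x \<le> w x" if "norm x = R" for n x
    proof -
      have "w x = C0" unfolding w_def A_def that by (simp add: exp_add[symmetric] mult.assoc)
      then show ?thesis using C0(2)[of n x] dec[of x] by linarith
    qed
    show "\<exists>M0. \<forall>M\<ge>M0. \<forall>n x. norm x = M \<longrightarrow> moll v (real (Suc n)) x - w x \<le> \<eta>" if "0 < \<eta>" for \<eta>
    proof (intro exI[of _ "C0 / \<eta>"] allI impI)
      fix M n and x :: 'a assume M: "C0 / \<eta> \<le> M" "norm x = M"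
      have p: "0 < 1 + norm x" by (simp add: add_pos_nonneg)
      have "C0 \<le> norm x * \<eta>" using M that by (simp add: pos_divide_le_eq)
      then have "C0 \<le> \<eta> * (1 + norm x)" using that by (simp add: algebra_simps)
      then have "C0 / (1 + norm x) \<le> \<eta>" using p by (simp add: pos_divide_le_eq)
      moreover have "0 \<le> w x" using A by (simp add: w_def)
      ultimately show "moll v (real (Suc n)) x - w x \<le> \<eta>" using C0(2)[of n x] by linarith
    qed
    show "w \<in> borel_measurable borel" unfolding w_def[abs_def] by measurable
    show "continuous_on {x. R \<le> norm x} w" unfolding w_def[abs_def] by (intro continuous_intros) auto
    show "continuous_on {y. R' \<le> norm y} (\<lambda>y. (norm y)\<^sup>2 - K)" by (intro continuous_intros)
    show "1 \<le> (norm y)\<^sup>2 - K" if "R' \<le> norm y" for y :: 'a using q[OF that] K0 by simp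
  qed (auto simp: R_def intro: moll_laplacian)
  then have "AE y in lborel. R < norm y \<longrightarrow> v y \<le> (A / gauss_mass TYPE('a)) * exp (- ((norm y)\<^sup>2 / 4))"
  proof eventually_elim
    case (elim y)
    show ?case
    proof
      assume "R < norm y"
      then have "v y * gauss_mass TYPE('a) \<le> w y" using elim by (simp add: mult.commute)
      then have "v y \<le> w y / gauss_mass TYPE('a)" using gauss_mass_pos[where 'a='a] by (simp add: pos_le_divide_eq)
      then show "v y \<le> (A / gauss_mass TYPE('a)) * exp (- ((norm y)\<^sup>2 / 4))" by (simp add: w_def)
    qed
  qed
  moreover have "0 < A / gauss_mass TYPE('a)" using A gauss_mass_pos[where 'a='a] by simp
  ultimately show ?thesis by blast
qed

text \<open>exp (q / 2) is at least q^2 / 8 and at least q / 2.\<close>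

lemma gaussian_absorbs_powers:
  fixes q k :: real
  assumes "0 \<le> q" "0 \<le> k"
  shows "(q + k) * exp (- (q / 2)) * q \<le> 8 + 2 * k"
proof -
  let ?e = "exp (- (q / 2))"
  have e: "?e * exp (q / 2) = 1" by (simp add: exp_add[symmetric])
  have l: "q / 2 \<le> exp (q / 2)" using exp_ge_add_one_self[of "q / 2"] by linarith
  have s: "q\<^sup>2 / 2 / 4 \<le> exp (q / 2)"
    using exp_lower_Taylor_quadratic[of "q / 2"] assms by (simp add: power_divide)
  have E: "(c * exp (q / 2)) * ?e = c" for c using e by (simp add: mult.assoc mult.commute)
  have "q\<^sup>2 * ?e \<le> (8 * exp (q / 2)) * ?e" using s by (intro mult_right_mono) auto
  then have a: "q\<^sup>2 * ?e \<le> 8" unfolding E .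
  have "q * ?e \<le> (2 * exp (q / 2)) * ?e" using l by (intro mult_right_mono) auto
  then have "q * ?e \<le> 2" unfolding E .
  then have "k * (q * ?e) \<le> k * 2" using assms(2) by (rule mult_left_mono)
  moreover have "(q + k) * ?e * q = q\<^sup>2 * ?e + k * (q * ?e)" by (simp add: algebra_simps power2_eq_square)
  ultimately show ?thesis using a by simp
qed

text \<open>Gaussian decay bounds v^2 by C^2 exp (-|y|^2 / 2), which remains bounded after
  multiplication with both |y|^2 + |\<omega>| and |y|^2. This is the accuracy that the refined
  barriers can absorb.\<close>

lemma inverse_square_estimate:
  "\<exists>R K. 1 \<le> R \<and> 0 \<le> K \<and> (AE y in lborel. R < norm y \<longrightarrow>
     ((norm y)\<^sup>2 - \<omega> - K / (norm y)\<^sup>2) * v y \<le> h y \<and> h y \<le> ((norm y)\<^sup>2 - \<omega> + K / (norm y)\<^sup>2) * v y)"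
proof -
  obtain R C where C: "0 < C" "AE y in lborel. R < norm y \<longrightarrow> v y \<le> C * exp (- ((norm y)\<^sup>2 / 4))"
    using gaussian_decay by blast
  \<comment> \<open>The bound for 4 (q + |\<omega>|) v^2 q with q = |y|^2; it covers the error of
    the upper estimate, v^2 q, as well.\<close>
  define K where "K = 4 * C\<^sup>2 * (8 + 2 * \<bar>\<omega>\<bar>)"
  have "AE y in lborel. \<bar>R\<bar> + \<bar>\<omega>\<bar> + 1 < norm y \<longrightarrow>
     ((norm y)\<^sup>2 - \<omega> - K / (norm y)\<^sup>2) * v y \<le> h y \<and> h y \<le> ((norm y)\<^sup>2 - \<omega> + K / (norm y)\<^sup>2) * v y"
    using C(2)
  proof eventually_elim
    case (elim y)
    show ?case
    proof
      assume y: "\<bar>R\<bar> + \<bar>\<omega>\<bar> + 1 < norm y"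
      define q where "q = (norm y)\<^sup>2"
      have q1: "norm y \<le> q" "1 \<le> q"
      proof -
        have "norm y * 1 \<le> norm y * norm y" using y by (intro mult_left_mono) auto
        then show "norm y \<le> q" by (simp add: q_def power2_eq_square)
        then show "1 \<le> q" using y by linarith
      qed
      have om: "\<bar>\<omega>\<bar> \<le> (norm y)\<^sup>2" using q1 y by (simp add: q_def)
      have "v y \<le> C * exp (- (q / 4))" using elim y by (simp add: q_def)
      then have "(v y)\<^sup>2 \<le> (C * exp (- (q / 4)))\<^sup>2" using v_nonneg[of y] by (intro power_mono) auto
      also have "\<dots> = C\<^sup>2 * exp (- (q / 2))" by (simp add: power_mult_distrib power2_eq_square exp_add[symmetric])
      finally have v2e: "(v y)\<^sup>2 \<le> C\<^sup>2 * exp (- (q / 2))" .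
      have "(q + \<bar>\<omega>\<bar>) * (v y)\<^sup>2 * q \<le> (q + \<bar>\<omega>\<bar>) * (C\<^sup>2 * exp (- (q / 2))) * q"
        using q1 v2e by (intro mult_right_mono mult_left_mono) auto
      also have "\<dots> = C\<^sup>2 * ((q + \<bar>\<omega>\<bar>) * exp (- (q / 2)) * q)" by (simp only: mult_ac)
      also have "\<dots> \<le> C\<^sup>2 * (8 + 2 * \<bar>\<omega>\<bar>)" using q1 by (intro mult_left_mono gaussian_absorbs_powers) auto
      finally have "4 * ((q + \<bar>\<omega>\<bar>) * (v y)\<^sup>2 * q) \<le> 4 * (C\<^sup>2 * (8 + 2 * \<bar>\<omega>\<bar>))" by simp
      then have k: "4 * (q + \<bar>\<omega>\<bar>) * (v y)\<^sup>2 * q \<le> K" by (simp only: K_def mult.assoc)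
      then have k1: "4 * (q + \<bar>\<omega>\<bar>) * (v y)\<^sup>2 \<le> K / q" using q1 by (subst pos_le_divide_eq) auto
      have "1 * (v y)\<^sup>2 \<le> (4 * (q + \<bar>\<omega>\<bar>)) * (v y)\<^sup>2" using q1 by (intro mult_right_mono) auto
      then have k2: "(v y)\<^sup>2 \<le> K / q" using k1 by simp
      have "((norm y)\<^sup>2 - \<omega> - K / (norm y)\<^sup>2) * v y \<le> ((norm y)\<^sup>2 - \<omega> - 4 * ((norm y)\<^sup>2 + \<bar>\<omega>\<bar>) * (v y)\<^sup>2) * v y"
        using k1 v_nonneg[of y] by (intro mult_right_mono) (auto simp: q_def)
      moreover have "((norm y)\<^sup>2 - \<omega> + (v y)\<^sup>2) * v y \<le> ((norm y)\<^sup>2 - \<omega> + K / (norm y)\<^sup>2) * v y"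
        using k2 v_nonneg[of y] by (intro mult_right_mono) (auto simp: q_def)
      ultimately show "((norm y)\<^sup>2 - \<omega> - K / (norm y)\<^sup>2) * v y \<le> h y \<and> h y \<le> ((norm y)\<^sup>2 - \<omega> + K / (norm y)\<^sup>2) * v y"
        using nonlinear_estimate[OF om] by linarith
    qed
  qed
  moreover have "0 \<le> K" by (simp add: K_def)
  ultimately show ?thesis by (intro exI[of _ "\<bar>R\<bar> + \<bar>\<omega>\<bar> + 1"] exI[of _ K]) auto
qed

text \<open>The comparison is used for v with a multiple of the difference of the barriers, and for
  -v with a negative multiple of their sum. The correction \<open>barrier (\<gamma> - 1)\<close> is
  at most half of \<open>barrier \<gamma>\<close> in the region considered, so the main barrier
  alone describes both bounds.\<close>

theorem two_sided_AE:
  "\<exists>C1>0. \<exists>C2>0. \<exists>R>0. AE x in lborel. R < norm x \<longrightarrow>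
     C1 * barrier ((\<omega> - real DIM('a)) / 2) x \<le> v x \<and> v x \<le> C2 * barrier ((\<omega> - real DIM('a)) / 2) x"
proof -
  define \<gamma> where "\<gamma> = (\<omega> - real DIM('a)) / 2"
  let ?Z = "gauss_mass TYPE('a)"
  have Z: "0 < ?Z" by (rule gauss_mass_pos)
  obtain R1 K where R1: "1 \<le> R1" and K: "0 \<le> K" and hh: "AE y in lborel. R1 < norm y \<longrightarrow>
     ((norm y)\<^sup>2 - \<omega> - K / (norm y)\<^sup>2) * v y \<le> h y \<and> h y \<le> ((norm y)\<^sup>2 - \<omega> + K / (norm y)\<^sup>2) * v y"
    using inverse_square_estimate by blast
  obtain R2 where R2: "1 \<le> R2"
    "\<And>x::'a. R2 \<le> norm x \<Longrightarrow> \<exists>L. has_laplacian (\<lambda>x. barrier \<gamma> x - barrier (\<gamma> - 1) x) L x \<and>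
        L \<le> ((norm x)\<^sup>2 - \<omega> - K / (norm x)\<^sup>2) * (barrier \<gamma> x - barrier (\<gamma> - 1) x)"
    "\<And>x::'a. R2 \<le> norm x \<Longrightarrow> \<exists>L. has_laplacian (\<lambda>x. barrier \<gamma> x + barrier (\<gamma> - 1) x) L x \<and>
        ((norm x)\<^sup>2 - \<omega> + K / (norm x)\<^sup>2) * (barrier \<gamma> x + barrier (\<gamma> - 1) x) \<le> L"
    using barrier_super_sub[OF \<gamma>_def K] by blast
  obtain C0 where C0: "C0 > 0" "\<And>n x. moll v (real (Suc n)) x \<le> C0 / (1 + norm x)" using moll_decay by blast
  obtain B where B: "AE y in lborel. \<bar>v y\<bar> \<le> B" "AE y in lborel. \<bar>h y\<bar> \<le> B * (1 + (norm y)\<^sup>2)"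
    using h_AE_bound by blast
  \<comment> \<open>For |y| >= R' the potential |y|^2 - \<omega> - K / |y|^2 is at least |y| -
    \<omega> - K >= 1. Adding 1 once more gives R >= 2, hence the factor 1/2 between the
    barriers.\<close>
  define R' where "R' = R1 + R2 + \<bar>\<omega>\<bar> + K + 1"
  define R where "R = R' + 1"
  have RR: "R' < R" "2 \<le> R" "R1 < R'" "R2 \<le> R" "1 \<le> R'" using R1 R2(1) K by (auto simp: R_def R'_def)
  obtain c0 where c0: "0 < c0" "\<And>n x. norm x \<le> R \<Longrightarrow> c0 \<le> moll v (real (Suc n)) x" using moll_lower by blast
  define P where "P = (R\<^sup>2) powr (\<gamma> / 2) * exp (- (R\<^sup>2 / 2))"
  have P: "0 < P" using RR by (simp add: P_def)
  have bR: "barrier \<gamma> x = P" if "norm x = R" for x :: 'a unfolding barrier_def P_def that ..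
  have half: "0 < barrier \<gamma> x" "0 < barrier (\<gamma> - 1) x" "barrier (\<gamma> - 1) x \<le> barrier \<gamma> x / 2" if "R \<le> norm x" for x :: 'a
  proof -
    have x0: "x \<noteq> 0" using that RR by auto
    show b: "0 < barrier \<gamma> x" "0 < barrier (\<gamma> - 1) x" using barrier_pos[OF x0] by auto
    show "barrier (\<gamma> - 1) x \<le> barrier \<gamma> x / 2"
      unfolding barrier_minus_one[OF x0] using b(1) that RR by (intro divide_left_mono mult_pos_pos) auto
  qed
  have V_lower: "1 \<le> (norm y)\<^sup>2 - \<omega> - K / (norm y)\<^sup>2" if "R' \<le> norm y" for y :: 'a
  proof -
    have n1: "1 \<le> norm y" using that RR by simp
    have "norm y * 1 \<le> norm y * norm y" using n1 by (intro mult_left_mono) auto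
    then have q: "norm y \<le> (norm y)\<^sup>2" by (simp add: power2_eq_square)
    have "K / (norm y)\<^sup>2 \<le> K / 1" using K q n1 by (intro divide_left_mono) auto
    then show ?thesis using q that R1 R2(1) unfolding R'_def by linarith
  qed
  have V_cont: "continuous_on {y::'a. R' \<le> norm y} (\<lambda>y. (norm y)\<^sup>2 - \<omega> + c / (norm y)\<^sup>2)" for c
    using RR by (intro continuous_intros) auto
  \<comment> \<open>On |x| = R the difference of the barriers is at least P / 2, so the factor 2
    \<open>C0\<close> / P lifts it to \<open>C0\<close>, the bound for all mollifications. At
    infinity the mollifications tend to 0 uniformly in n and the barrier is nonnegative.\<close>
  have upper: "AE x in lborel. R < norm x \<longrightarrow> ?Z * v x \<le> (2 * C0 / P) * (barrier \<gamma> x - barrier (\<gamma> - 1) x)"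
  proof (rule exterior_comparison_AE[OF vm h_measurable _ v2 B, where R'=R' and R=R and V="\<lambda>y. (norm y)\<^sup>2 - \<omega> - K / (norm y)\<^sup>2" and ?V0.0=1])
    show "AE y in lborel. R' \<le> norm y \<longrightarrow> ((norm y)\<^sup>2 - \<omega> - K / (norm y)\<^sup>2) * v y \<le> h y"
      using hh by eventually_elim (use RR in auto)
    show "\<exists>L. has_laplacian (\<lambda>x. (2 * C0 / P) * (barrier \<gamma> x - barrier (\<gamma> - 1) x)) L x
        \<and> L \<le> ((norm x)\<^sup>2 - \<omega> - K / (norm x)\<^sup>2) * ((2 * C0 / P) * (barrier \<gamma> x - barrier (\<gamma> - 1) x))" if x: "R < norm x" for x :: 'a
    proof -
      obtain L where L: "has_laplacian (\<lambda>x. barrier \<gamma> x - barrier (\<gamma> - 1) x) L x"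
        "L \<le> ((norm x)\<^sup>2 - \<omega> - K / (norm x)\<^sup>2) * (barrier \<gamma> x - barrier (\<gamma> - 1) x)"
        using R2(2)[of x] x RR by auto
      have "(2 * C0 / P) * L \<le> (2 * C0 / P) * (((norm x)\<^sup>2 - \<omega> - K / (norm x)\<^sup>2) * (barrier \<gamma> x - barrier (\<gamma> - 1) x))"
        using C0(1) P by (intro mult_left_mono[OF L(2)]) auto
      then show ?thesis
        by (intro exI[of _ "(2 * C0 / P) * L"] conjI has_laplacian_cmult[OF L(1)]) (simp only: mult_ac)
    qed
    show "moll v (real (Suc n)) x \<le> (2 * C0 / P) * (barrier \<gamma> x - barrier (\<gamma> - 1) x)" if x: "norm x = R" for n x
    proof -
      have "C0 / (1 + norm x) \<le> C0 / 1" using C0(1) by (intro divide_left_mono) (auto intro: add_pos_nonneg)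
      moreover have "C0 = (2 * C0 / P) * (P / 2)" using P by simp
      moreover have "(2 * C0 / P) * (P / 2) \<le> (2 * C0 / P) * (barrier \<gamma> x - barrier (\<gamma> - 1) x)"
        using half(3)[of x] x bR[OF x] C0(1) P by (intro mult_left_mono) auto
      ultimately show ?thesis using C0(2)[of n x] by linarith
    qed
    show "\<exists>M0. \<forall>M\<ge>M0. \<forall>n x. norm x = M \<longrightarrow> moll v (real (Suc n)) x - (2 * C0 / P) * (barrier \<gamma> x - barrier (\<gamma> - 1) x) \<le> \<eta>"
      if \<eta>: "0 < \<eta>" for \<eta>
    proof (intro exI[of _ "max R (C0 / \<eta>)"] allI impI)
      fix M n and x :: 'a assume M: "max R (C0 / \<eta>) \<le> M" "norm x = M"
      have p: "0 < 1 + norm x" by (simp add: add_pos_nonneg)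
      have "C0 \<le> norm x * \<eta>" using M \<eta> by (simp add: pos_divide_le_eq)
      then have "C0 \<le> \<eta> * (1 + norm x)" using \<eta> by (simp add: algebra_simps)
      then have "C0 / (1 + norm x) \<le> \<eta>" using p by (simp add: pos_divide_le_eq)
      moreover have "0 \<le> (2 * C0 / P) * (barrier \<gamma> x - barrier (\<gamma> - 1) x)"
        using half[of x] M C0(1) P by (intro mult_nonneg_nonneg) auto
      ultimately show "moll v (real (Suc n)) x - (2 * C0 / P) * (barrier \<gamma> x - barrier (\<gamma> - 1) x) \<le> \<eta>" using C0(2)[of n x] by linarith
    qed
    show "continuous_on {x::'a. R \<le> norm x} (\<lambda>x. (2 * C0 / P) * (barrier \<gamma> x - barrier (\<gamma> - 1) x))"
      using RR by (intro continuous_on_mult continuous_on_const continuous_on_diff barrier_continuous) auto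
    show "continuous_on {y::'a. R' \<le> norm y} (\<lambda>y. (norm y)\<^sup>2 - \<omega> - K / (norm y)\<^sup>2)"
      using V_cont[of "- K"] by simp
  qed (use V_lower RR in \<open>auto intro: moll_laplacian\<close>)
  have neg: "moll (\<lambda>y. - k y) s x = - moll k s x" for k :: "'a \<Rightarrow> real" and s x
    by (simp add: moll_def)
  let ?c = "c0 / (2 * P)"
  have c: "0 < ?c" using c0(1) P by simp
  \<comment> \<open>The change of sign turns the subsolution into a supersolution. On |x| = R the
    sum of the barriers is at most 2 P, so the factor brings it below \<open>c0\<close>; at infinity
    it tends to 0, while mollifications of v are nonnegative.\<close>
  have lower: "AE x in lborel. R < norm x \<longrightarrow> ?Z * (- v x) \<le> - ?c * (barrier \<gamma> x + barrier (\<gamma> - 1) x)"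
  proof (rule exterior_comparison_AE[where hh="\<lambda>y. - h y" and B=B and R'=R' and R=R and V="\<lambda>y. (norm y)\<^sup>2 - \<omega> + K / (norm y)\<^sup>2" and ?V0.0=1])
    show "AE y in lborel. R' \<le> norm y \<longrightarrow> ((norm y)\<^sup>2 - \<omega> + K / (norm y)\<^sup>2) * (- v y) \<le> - h y"
      using hh by eventually_elim (use RR in auto)
    show "1 \<le> (norm y)\<^sup>2 - \<omega> + K / (norm y)\<^sup>2" if "R' \<le> norm y" for y :: 'a
    proof -
      have "0 \<le> K / (norm y)\<^sup>2" using K by simp
      then show ?thesis using V_lower[OF that] by linarith
    qed
    show "has_laplacian (moll (\<lambda>y. - v y) s) (moll (\<lambda>y. - h y) s x) x" if "0 < s" for x s
      using has_laplacian_cmult[OF moll_laplacian[OF that, of x], of "- 1"] by (simp add: neg[abs_def])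
    show "\<exists>L. has_laplacian (\<lambda>x. - ?c * (barrier \<gamma> x + barrier (\<gamma> - 1) x)) L x
        \<and> L \<le> ((norm x)\<^sup>2 - \<omega> + K / (norm x)\<^sup>2) * (- ?c * (barrier \<gamma> x + barrier (\<gamma> - 1) x))" if x: "R < norm x" for x :: 'a
    proof -
      obtain L where L: "has_laplacian (\<lambda>x. barrier \<gamma> x + barrier (\<gamma> - 1) x) L x"
        "((norm x)\<^sup>2 - \<omega> + K / (norm x)\<^sup>2) * (barrier \<gamma> x + barrier (\<gamma> - 1) x) \<le> L"
        using R2(3)[of x] x RR by auto
      have "?c * (((norm x)\<^sup>2 - \<omega> + K / (norm x)\<^sup>2) * (barrier \<gamma> x + barrier (\<gamma> - 1) x)) \<le> ?c * L"
        using c by (intro mult_left_mono[OF L(2)]) simp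
      then have "- ?c * L \<le> - (?c * (((norm x)\<^sup>2 - \<omega> + K / (norm x)\<^sup>2) * (barrier \<gamma> x + barrier (\<gamma> - 1) x)))" by simp
      also have "\<dots> = ((norm x)\<^sup>2 - \<omega> + K / (norm x)\<^sup>2) * (- ?c * (barrier \<gamma> x + barrier (\<gamma> - 1) x))"
        by (simp only: mult_minus_left mult_minus_right mult_ac)
      finally show ?thesis by (intro exI[of _ "- ?c * L"] conjI has_laplacian_cmult[OF L(1)])
    qed
    show "moll (\<lambda>y. - v y) (real (Suc n)) x \<le> - ?c * (barrier \<gamma> x + barrier (\<gamma> - 1) x)" if x: "norm x = R" for n x
    proof -
      have "?c * (barrier \<gamma> x + barrier (\<gamma> - 1) x) \<le> ?c * (2 * P)"
        using half[of x] x bR[OF x] c by (intro mult_left_mono) auto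
      also have "\<dots> = c0" using P by simp
      finally show ?thesis using c0(2)[of x n] x by (simp add: neg)
    qed
    show "\<exists>M0. \<forall>M\<ge>M0. \<forall>n x. norm x = M \<longrightarrow> moll (\<lambda>y. - v y) (real (Suc n)) x - (- ?c * (barrier \<gamma> x + barrier (\<gamma> - 1) x)) \<le> \<eta>"
      if \<eta>: "0 < \<eta>" for \<eta>
    proof -
      have "0 < \<eta> / (2 * ?c)" by (rule divide_pos_pos[OF \<eta>]) (use c in linarith)
      from order_tendstoD(2)[OF barrier_tendsto_0[of \<gamma>] this]
      obtain M1 where M1: "\<And>M. M1 \<le> M \<Longrightarrow> (M\<^sup>2) powr (\<gamma> / 2) * exp (- (M\<^sup>2 / 2)) < \<eta> / (2 * ?c)"
        by (auto simp: eventually_at_top_linorder)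
      show ?thesis
      proof (intro exI[of _ "max R M1"] allI impI)
        fix M n and x :: 'a assume M: "max R M1 \<le> M" "norm x = M"
        have "barrier \<gamma> x < \<eta> / (2 * ?c)" using M1[of M] M by (simp add: barrier_def)
        then have "barrier \<gamma> x * (2 * ?c) < \<eta>" using c by (subst (asm) pos_less_divide_eq) auto
        moreover have "?c * (barrier \<gamma> x + barrier (\<gamma> - 1) x) \<le> ?c * (barrier \<gamma> x * 2)"
          using half[of x] M c by (intro mult_left_mono) auto
        moreover have "0 \<le> moll v (real (Suc n)) x"
          unfolding moll_def using v_nonneg by (intro mult_nonneg_nonneg Bochner_Integration.integral_nonneg) auto
        ultimately show "moll (\<lambda>y. - v y) (real (Suc n)) x - (- ?c * (barrier \<gamma> x + barrier (\<gamma> - 1) x)) \<le> \<eta>"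
          unfolding neg by (simp add: mult_ac)
      qed
    qed
    show "continuous_on {x::'a. R \<le> norm x} (\<lambda>x. - ?c * (barrier \<gamma> x + barrier (\<gamma> - 1) x))"
      using RR by (intro continuous_on_mult continuous_on_const continuous_on_add barrier_continuous) auto
    show "continuous_on {y::'a. R' \<le> norm y} (\<lambda>y. (norm y)\<^sup>2 - \<omega> + K / (norm y)\<^sup>2)" by (rule V_cont)
  qed (use v2 B RR in auto)
  have "AE x in lborel. R < norm x \<longrightarrow> (?c / ?Z) * barrier \<gamma> x \<le> v x \<and> v x \<le> (2 * C0 / P / ?Z) * barrier \<gamma> x"
    using upper lower
  proof eventually_elim
    case (elim x)
    show ?case
    proof
      assume x: "R < norm x"
      note b = half[of x]
      have "?Z * v x \<le> (2 * C0 / P) * (barrier \<gamma> x - barrier (\<gamma> - 1) x)" using elim x by simp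
      also have "\<dots> \<le> (2 * C0 / P) * barrier \<gamma> x" using b x C0(1) P by (intro mult_left_mono) auto
      finally have "v x * ?Z \<le> (2 * C0 / P) * barrier \<gamma> x" by (simp add: mult.commute)
      then have u: "v x \<le> (2 * C0 / P) * barrier \<gamma> x / ?Z" using Z by (subst pos_le_divide_eq)
      have "?c * barrier \<gamma> x \<le> ?c * (barrier \<gamma> x + barrier (\<gamma> - 1) x)" using b x c by (intro mult_left_mono) auto
      also have "\<dots> \<le> v x * ?Z" using elim(2) x by (simp add: mult_ac)
      finally have l: "?c * barrier \<gamma> x / ?Z \<le> v x" using Z by (subst pos_divide_le_eq)
      show "(?c / ?Z) * barrier \<gamma> x \<le> v x \<and> v x \<le> (2 * C0 / P / ?Z) * barrier \<gamma> x"
        using u l by simp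
    qed
  qed
  moreover have "0 < ?c / ?Z" "0 < 2 * C0 / P / ?Z" "0 < R" using divide_pos_pos[OF c Z] Z C0(1) P RR by auto
  ultimately show ?thesis unfolding \<gamma>_def by blast
qed

end

section \<open>From weak solutions to the asymptotics\<close>

text \<open>Elements of H are Lebesgue measurable classes; passing to a Borel representative moves
  the equation from \<open>lebesgue\<close> to \<open>lborel\<close>, where Fubini and affine
  substitutions were set up.\<close>

lemma solution_imp_gaussian_solution:
  fixes v :: "'a::euclidean_space \<Rightarrow> real"
  assumes dc: "dual_change f" and sol: "solves_semilinear f \<omega> v" and pos: "ae_positive v"
  obtains v' where "gaussian_solution f \<omega> v'" "AE x in lebesgue. v x = v' x"
proof -
  have vH: "v \<in> H" using sol by (simp add: solves_semilinear_def critical_point_H_def)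
  have vm: "v \<in> borel_measurable lebesgue" and v2: "integrable lebesgue (\<lambda>x. (v x)\<^sup>2)"
    and vx2: "integrable lebesgue (\<lambda>x. (v x)\<^sup>2 * (norm x)\<^sup>2)"
    using vH by (auto simp: H_def H1_def square_integrable_def)
  have pos': "AE x in lborel. 0 < v x" using pos by (simp add: ae_positive_def AE_completion_iff)
  obtain v0 where v0[measurable]: "v0 \<in> borel_measurable lborel" and ae0: "AE x in lborel. v x = v0 x"
    using completion_ex_borel_measurable_real[OF vm] by blast
  \<comment> \<open>The maximum with 0 makes nonnegativity hold everywhere; it still agrees with v
    almost everywhere because v is positive almost everywhere.\<close>
  define v' where "v' x = max 0 (v0 x)" for x
  have v'm[measurable]: "v' \<in> borel_measurable borel" using v0 unfolding v'_def[abs_def] by simp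
  have ae: "AE x in lborel. v x = v' x" using ae0 pos' by eventually_elim (simp add: v'_def)
  have ae': "AE x in lebesgue. v x = v' x" using ae by (rule AE_completion)
  have v'p: "AE x in lborel. 0 < v' x" using ae pos' by eventually_elim simp
  have v'l: "v' \<in> borel_measurable lebesgue" by (rule measurable_completion) simp
  have v'2: "integrable lborel (\<lambda>x. (v' x)\<^sup>2)"
  proof -
    have m: "(\<lambda>x. (v' x)\<^sup>2) \<in> borel_measurable lborel" by simp
    have "integrable lebesgue (\<lambda>x. (v' x)\<^sup>2)"
    proof (rule integrable_cong_AE_imp[OF v2 measurable_completion[OF m]])
      show "AE x in lebesgue. (v x)\<^sup>2 = (v' x)\<^sup>2" using ae' by eventually_elim simp
    qed
    then show ?thesis using m by (simp add: integrable_completion)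
  qed
  have v'x2: "integrable lborel (\<lambda>x. (v' x)\<^sup>2 * (norm x)\<^sup>2)"
  proof -
    have m: "(\<lambda>x. (v' x)\<^sup>2 * (norm x)\<^sup>2) \<in> borel_measurable lborel" by simp
    have "integrable lebesgue (\<lambda>x. (v' x)\<^sup>2 * (norm x)\<^sup>2)"
    proof (rule integrable_cong_AE_imp[OF vx2 measurable_completion[OF m]])
      show "AE x in lebesgue. (v x)\<^sup>2 * (norm x)\<^sup>2 = (v' x)\<^sup>2 * (norm x)\<^sup>2" using ae' by eventually_elim simp
    qed
    then show ?thesis using m by (simp add: integrable_completion)
  qed
  have eq: "(LINT x|lborel. v' x * (\<Sum>b\<in>Basis. Phi (g(b := deriv (deriv (g b)))) x)) = (LINT x|lborel. dual_h f \<omega> x (v' x) * Phi g x)"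
    if g: "\<And>b. b \<in> Basis \<Longrightarrow> smooth (g b)" "\<And>b s. b \<in> Basis \<Longrightarrow> R < \<bar>s\<bar> \<Longrightarrow> g b s = 0" for g :: "'a \<Rightarrow> real \<Rightarrow> real" and R
  proof -
    have c: "continuous_on UNIV (\<lambda>x. \<Sum>b\<in>Basis. Phi (g(b := deriv (deriv (g b)))) x)" "continuous_on UNIV (Phi g)"
    proof -
      have "continuous_on UNIV (Phi (g(b := deriv (deriv (g b)))))" if "b \<in> Basis" for b
        using C_k_Phi[of "g(b := deriv (deriv (g b)))" 0] g(1) smooth_deriv that by auto
      then show "continuous_on UNIV (\<lambda>x. \<Sum>b\<in>Basis. Phi (g(b := deriv (deriv (g b)))) x)" by (intro continuous_on_sum)
      show "continuous_on UNIV (Phi g)" using C_k_Phi[of g 0] g(1) by auto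
    qed
    note cb = c[THEN borel_measurable_continuous_onI] and cl = c[THEN continuous_measurable_lebesgue]
    have pq: "dual_p f \<in> borel_measurable borel" "dual_q f \<in> borel_measurable borel" using dual_measurable[OF dc] by auto
    have hm: "(\<lambda>x. dual_h f \<omega> x (u x)) \<in> borel_measurable lebesgue" if u: "u \<in> borel_measurable lebesgue" for u :: "'a \<Rightarrow> real"
    proof -
      have "(\<lambda>x::'a. (norm x)\<^sup>2 - \<omega>) \<in> borel_measurable lebesgue"
        by (rule continuous_measurable_lebesgue) (intro continuous_intros)
      then show ?thesis unfolding dual_h_def
        by (intro borel_measurable_add borel_measurable_times measurable_compose[OF u pq(1)] measurable_compose[OF u pq(2)])
    qed
    have m1: "(\<lambda>x. v' x * (\<Sum>b\<in>Basis. Phi (g(b := deriv (deriv (g b)))) x)) \<in> borel_measurable lborel"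
      using borel_measurable_times[OF v'm cb(1)] by simp
    have m2: "(\<lambda>x. dual_h f \<omega> x (v' x) * Phi g x) \<in> borel_measurable lborel"
      using borel_measurable_times[OF dual_h_measurable[OF dc v'm] cb(2)] by simp
    have "(LINT x|lborel. v' x * (\<Sum>b\<in>Basis. Phi (g(b := deriv (deriv (g b)))) x))
      = (LINT x|lebesgue. v' x * (\<Sum>b\<in>Basis. Phi (g(b := deriv (deriv (g b)))) x))"
      by (rule integral_completion[OF m1, symmetric])
    also have "\<dots> = (LINT x|lebesgue. v x * (\<Sum>b\<in>Basis. Phi (g(b := deriv (deriv (g b)))) x))"
      by (rule integral_cong_AE[OF borel_measurable_times[OF v'l cl(1)] borel_measurable_times[OF vm cl(1)]])
        (use ae' in \<open>eventually_elim, simp\<close>)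
    also have "\<dots> = (LINT x|lebesgue. dual_h f \<omega> x (v x) * Phi g x)"
      by (rule weak_equation_laplacian[OF dc sol g])
    also have "\<dots> = (LINT x|lebesgue. dual_h f \<omega> x (v' x) * Phi g x)"
      by (rule integral_cong_AE[OF borel_measurable_times[OF hm[OF vm] cl(2)] borel_measurable_times[OF hm[OF v'l] cl(2)]])
        (use ae' in \<open>eventually_elim, simp\<close>)
    also have "\<dots> = (LINT x|lborel. dual_h f \<omega> x (v' x) * Phi g x)" by (rule integral_completion[OF m2])
    finally show ?thesis .
  qed
  have "gaussian_solution f \<omega> v'"
  proof
    show "0 \<le> v' y" for y by (simp add: v'_def)
    show "(LINT y|lborel. v' y * ((4 * a\<^sup>2 * (norm (x - y))\<^sup>2 - 2 * a * real DIM('a)) * exp (- a * (norm (x - y))\<^sup>2)))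
      = (LINT y|lborel. dual_h f \<omega> y (v' y) * exp (- a * (norm (x - y))\<^sup>2))" if "0 < a" for a and x :: 'a
      by (rule gaussian_equation_from_products[OF dc v'm v'2 eq that])
  qed (use dc v'm v'p v'2 v'x2 in auto)
  then show ?thesis using that ae' by blast
qed

text \<open>An inequality failing at a point of continuity fails on a neighbourhood, and nonempty
  open sets are not null.\<close>

lemma AE_imp_at_continuity_point:
  fixes d :: "'a::euclidean_space \<Rightarrow> real"
  assumes ae: "AE y in lebesgue. R < norm y \<longrightarrow> 0 \<le> d y" and x: "R < norm x" and c: "isCont d x"
  shows "0 \<le> d x"
proof (rule ccontr)
  assume "\<not> 0 \<le> d x"
  then have neg: "d x < 0" by simp
  have "(d \<longlongrightarrow> d x) (nhds x)" using c by (simp add: isCont_def tendsto_at_iff_tendsto_nhds)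
  then have "\<forall>\<^sub>F y in nhds x. d y < 0" using neg by (rule order_tendstoD)
  moreover have "\<forall>\<^sub>F y in nhds x. R < norm y"
  proof -
    have "open {y::'a. R < norm y}" by (intro open_Collect_less continuous_intros)
    then show ?thesis using x unfolding eventually_nhds by blast
  qed
  ultimately have "\<forall>\<^sub>F y in nhds x. d y < 0 \<and> R < norm y" by eventually_elim simp
  then obtain S where S: "open S" "x \<in> S" "\<And>y. y \<in> S \<Longrightarrow> d y < 0 \<and> R < norm y" unfolding eventually_nhds by blast
  have "AE y \<in> S in lebesgue. y \<in> {}" using ae by eventually_elim (use S(3) in force)
  then have "x \<in> {}" by (rule mem_closed_if_AE_lebesgue_open[OF S(1) closed_empty _ S(2)])
  then show False by simp
qed

text \<open>The almost-everywhere bounds on the open set |x| > R extend to points of continuity; the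
  closed region |x| >= R + 1 of the conclusion lies in that open set.\<close>

lemma asymp_two_sidedI:
  fixes u w :: "'a::euclidean_space \<Rightarrow> real"
  assumes C: "0 < C1" "0 < C2" and ae: "AE x in lebesgue. R < norm x \<longrightarrow> C1 * w x \<le> u x \<and> u x \<le> C2 * w x"
    and w: "\<And>x. R < norm x \<Longrightarrow> isCont w x"
  shows "asymp_two_sided u w"
  unfolding asymp_two_sided_def
proof (rule exI[of _ C1], rule conjI[OF C(1)], rule exI[of _ C2], rule conjI[OF C(2)], rule exI[of _ "R + 1"], intro conjI allI impI)
  show "AE x in lebesgue. R + 1 \<le> norm x \<longrightarrow> C1 * w x \<le> u x \<and> u x \<le> C2 * w x"
    using ae by eventually_elim simp
  fix x assume x: "R + 1 \<le> norm x \<and> isCont u x"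
  then have R: "R < norm x" by simp
  have "0 \<le> u x - C1 * w x"
  proof (rule AE_imp_at_continuity_point[OF _ R])
    show "AE y in lebesgue. R < norm y \<longrightarrow> 0 \<le> u y - C1 * w y" using ae by eventually_elim simp
    show "isCont (\<lambda>y. u y - C1 * w y) x" using x w[OF R] by (intro continuous_intros) auto
  qed
  then show "C1 * w x \<le> u x" by simp
  have "0 \<le> C2 * w x - u x"
  proof (rule AE_imp_at_continuity_point[OF _ R])
    show "AE y in lebesgue. R < norm y \<longrightarrow> 0 \<le> C2 * w y - u y" using ae by eventually_elim simp
    show "isCont (\<lambda>y. C2 * w y - u y) x" using x w[OF R] by (intro continuous_intros) auto
  qed
  then show "u x \<le> C2 * w x" by simp
qed

theorem theorem8p3:
  fixes f :: "real \<Rightarrow> real" and \<omega> :: real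
  assumes "dual_change f"
  shows "(\<forall>v :: 'a::euclidean_space \<Rightarrow> real.
            solves_semilinear f \<omega> v \<and> ae_positive v \<longrightarrow>
            asymp_two_sided v
              (\<lambda>x. norm x powr ((\<omega> - real DIM('a)) / 2) * exp (- (norm x)\<^sup>2 / 2)))
       \<and> (\<forall>u :: 'a \<Rightarrow> real.
            solves_quasilinear f \<omega> u \<and> ae_positive u \<longrightarrow>
            asymp_two_sided u
              (\<lambda>x. norm x powr ((\<omega> - real DIM('a)) / 2) * exp (- (norm x)\<^sup>2 / 2)))"
proof -
  note dc = assms
  let ?\<gamma> = "(\<omega> - real DIM('a)) / 2"
  let ?w = "\<lambda>x::'a. norm x powr ?\<gamma> * exp (- (norm x)\<^sup>2 / 2)"
  \<comment> \<open>The global bound B is recorded along with the asymptotics because it makes f(v)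
    comparable to v for the quasilinear equation.\<close>
  have main: "\<exists>C1>0. \<exists>C2>0. \<exists>R>0. \<exists>B\<ge>0. AE x in lebesgue. v x \<le> B \<and> (R < norm x \<longrightarrow> C1 * ?w x \<le> v x \<and> v x \<le> C2 * ?w x)"
    if sol: "solves_semilinear f \<omega> v" "ae_positive v" for v :: "'a \<Rightarrow> real"
  proof -
    obtain v' where v': "gaussian_solution f \<omega> v'" "AE x in lebesgue. v x = v' x"
      using solution_imp_gaussian_solution[OF dc sol] by blast
    interpret gaussian_solution f \<omega> v' by (rule v'(1))
    obtain C1 C2 R where C: "0 < C1" "0 < C2" "0 < R"
      and ae: "AE x in lborel. R < norm x \<longrightarrow> C1 * barrier ?\<gamma> x \<le> v' x \<and> v' x \<le> C2 * barrier ?\<gamma> x"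
      using two_sided_AE by blast
    obtain B where B: "AE y in lborel. \<bar>v' y\<bar> \<le> B" using h_AE_bound by blast
    have bd: "AE x in lebesgue. v x \<le> \<bar>B\<bar> \<and> (R < norm x \<longrightarrow> C1 * ?w x \<le> v x \<and> v x \<le> C2 * ?w x)"
      using v'(2) AE_completion[OF ae] AE_completion[OF B]
    proof eventually_elim
      case (elim x)
      have "x \<noteq> 0" if "R < norm x" using that C(3) by auto
      then show ?case using elim barrier_eq[of x ?\<gamma>] by auto
    qed
    have "\<exists>B\<ge>0. AE x in lebesgue. v x \<le> B \<and> (R < norm x \<longrightarrow> C1 * ?w x \<le> v x \<and> v x \<le> C2 * ?w x)"
      by (rule exI[of _ "\<bar>B\<bar>"], rule conjI[OF abs_ge_zero bd])
    then show ?thesis using C by blast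
  qed
  \<comment> \<open>R > 0 keeps x away from the origin, where a power with negative exponent is
    singular.\<close>
  have wc: "isCont ?w x" if "0 < R" "R < norm x" for x and R :: real
  proof -
    have "x \<noteq> 0" using that by auto
    then show ?thesis by (intro continuous_intros) auto
  qed
  show ?thesis
  proof (intro conjI allI impI; elim conjE)
    fix v :: "'a \<Rightarrow> real" assume "solves_semilinear f \<omega> v" "ae_positive v"
    from main[OF this] obtain C1 C2 R B where C: "0 < C1" "0 < C2" "0 < R"
      and ae: "AE x in lebesgue. v x \<le> B \<and> (R < norm x \<longrightarrow> C1 * ?w x \<le> v x \<and> v x \<le> C2 * ?w x)" by blast
    show "asymp_two_sided v ?w"
    proof (rule asymp_two_sidedI[OF C(1,2)])
      show "AE x in lebesgue. R < norm x \<longrightarrow> C1 * ?w x \<le> v x \<and> v x \<le> C2 * ?w x" using ae by eventually_elim simp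
    qed (rule wc[OF C(3)])
  next
    fix u :: "'a \<Rightarrow> real" assume "solves_quasilinear f \<omega> u" and up: "ae_positive u"
    then obtain v where uv: "\<And>x. u x = f (v x)" and sol: "solves_semilinear f \<omega> v" by (auto simp: solves_quasilinear_def)
    \<comment> \<open>f preserves signs, so positivity passes from u back to v.\<close>
    have vp: "ae_positive v" using up by (simp add: ae_positive_def uv dual_f_pos_iff[OF dc])
    from main[OF sol vp] obtain C1 C2 R B where C: "0 < C1" "0 < C2" "0 < R"
      and ae: "AE x in lebesgue. v x \<le> B \<and> (R < norm x \<longrightarrow> C1 * ?w x \<le> v x \<and> v x \<le> C2 * ?w x)" by blast
    \<comment> \<open>Since v <= B almost everywhere, the bounds for f place u = f(v) between k v
      and v.\<close>
    define k where "k = 1 / sqrt (1 + 2 * B\<^sup>2)"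
    have k: "0 < k" using one_plus_two_sq(1)[of B] by (simp add: k_def)
    have vp': "AE x in lebesgue. 0 < v x" using vp by (simp add: ae_positive_def)
    show "asymp_two_sided u ?w"
    proof (rule asymp_two_sidedI[of "k * C1" C2])
      show "AE x in lebesgue. R < norm x \<longrightarrow> k * C1 * ?w x \<le> u x \<and> u x \<le> C2 * ?w x"
        using ae vp'
      proof eventually_elim
        case (elim x)
        have v0: "0 \<le> v x" using elim by simp
        have "(v x)\<^sup>2 \<le> B\<^sup>2" using elim v0 by (intro power_mono) auto
        then have "sqrt (1 + 2 * (v x)\<^sup>2) \<le> sqrt (1 + 2 * B\<^sup>2)" by simp
        then have "v x / sqrt (1 + 2 * B\<^sup>2) \<le> v x / sqrt (1 + 2 * (v x)\<^sup>2)"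
          using v0 one_plus_two_sq(1) by (intro divide_left_mono mult_pos_pos) auto
        then have lo: "k * v x \<le> u x" using dual_f_bounds(3)[OF dc v0] uv[of x] by (simp add: k_def)
        have up: "u x \<le> v x" using dual_f_bounds(2)[OF dc v0] uv[of x] by simp
        show ?case
        proof
          assume R: "R < norm x"
          then have "k * (C1 * ?w x) \<le> k * v x" using elim k by (intro mult_left_mono) auto
          then show "k * C1 * ?w x \<le> u x \<and> u x \<le> C2 * ?w x" using elim R lo up by (simp add: mult.assoc)
        qed
      qed
    qed (use k C wc in auto)
  qed
qed

end
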